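(* Let $\omega$ be a radial weight, $0<p<\infty$ and $k\in\mathbb{N}$. Then $$\|f\|_{A^p_\omega}^p\asymp\int_{\mathbb{D}}|f^{(k)}(z)|^p(1-|z|)^{kp}\omega(z)\,dA(z)+\sum_{j=0}^{k-1}|f^{(j)}(0)|^p,\quad f\in\mathcal{H}(\mathbb{D}),$$ if and only if $\omega\in\mathcal{D}$.
   Context: $\mathbb{D}$ is the open unit disc of $\mathbb{C}$, $\mathcal{H}(\mathbb{D})$ the space of analytic functions in $\mathbb{D}$, and $dA(z)=\frac{dx\,dy}{\pi}$. A radial weight is a nonnegative function $\omega\in L^1([0,1))$ extended to $\mathbb{D}$ by $\omega(z)=\omega(|z|)$; it is assumed throughout that $\widehat{\omega}(z)=\int_{|z|}^1\omega(s)\,ds>0$ for all $z\in\mathbb{D}$. $\|f\|_{A^p_\omega}^p=\int_{\mathbb{D}}|f(z)|^p\omega(z)\,dA(z)$ (possibly infinite). The symbol $\asymp$ means that each side is bounded by a constant times the other, with constants independent of $f$. $\omega\in\widehat{\mathcal{D}}$ if there is $C\ge1$ with $\widehat{\omega}(r)\le C\widehat{\omega}\left(\frac{1+r}{2}\right)$ for all $0\le r<1$; $\omega\in\check{\mathcal{D}}$ if there are $K>1$ and $C>1$ with $\widehat{\omega}(r)\ge C\widehat{\omega}\left(1-\frac{1-r}{K}\right)$ for all $0\le r<1$; $\mathcal{D}=\widehat{\mathcal{D}}\cap\check{\mathcal{D}}$. *)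

theory Defs
  imports "HOL-Complex_Analysis.Complex_Analysis"
begin

(* A radial weight is represented by its profile on [0,1); its extension to the disc is
   z |-> \<omega> (norm z).  Values of the profile outside [0,1) are never used. *)

definition radial_weight :: "(real \<Rightarrow> real) \<Rightarrow> bool" where
  "radial_weight \<omega> \<longleftrightarrow>
     (\<forall>r\<in>{0..<1}. 0 \<le> \<omega> r) \<and> set_integrable lebesgue {0..<1} \<omega>"

definition weight_tail :: "(real \<Rightarrow> real) \<Rightarrow> complex \<Rightarrow> real" where
  "weight_tail \<omega> z = (LINT s:{norm z..<1}|lebesgue. \<omega> s)"

definition D_hat :: "(real \<Rightarrow> real) set" where
  "D_hat = {\<omega>. radial_weight \<omega> \<and>
     (\<exists>C\<ge>1. \<forall>r::real. 0 \<le> r \<and> r < 1 \<longrightarrow>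
        weight_tail \<omega> (of_real r) \<le> C * weight_tail \<omega> (of_real ((1 + r) / 2)))}"

definition D_check :: "(real \<Rightarrow> real) set" where
  "D_check = {\<omega>. radial_weight \<omega> \<and>
     (\<exists>K>1. \<exists>C>1. \<forall>r::real. 0 \<le> r \<and> r < 1 \<longrightarrow>
        weight_tail \<omega> (of_real r) \<ge> C * weight_tail \<omega> (of_real (1 - (1 - r) / K)))}"

definition D_class :: "(real \<Rightarrow> real) set" where
  "D_class = D_hat \<inter> D_check"

(* Area measure on the unit disc, normalised to total mass 1. *)

definition disc_area :: "complex measure" where
  "disc_area = scale_measure (ennreal (1 / pi)) (lebesgue_on (ball 0 1))"

(* The p-th power of the Bergman (quasi)norm; it may be infinite. *)

definition bergman_norm_pow :: "(real \<Rightarrow> real) \<Rightarrow> real \<Rightarrow> (complex \<Rightarrow> complex) \<Rightarrow> ennreal" where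
  "bergman_norm_pow \<omega> p f =
     (\<integral>\<^sup>+ z. ennreal (norm (f z) powr p * \<omega> (norm z)) \<partial>disc_area)"

definition comparable_on :: "'a set \<Rightarrow> ('a \<Rightarrow> ennreal) \<Rightarrow> ('a \<Rightarrow> ennreal) \<Rightarrow> bool" where
  "comparable_on S F G \<longleftrightarrow>
     (\<exists>C::real. C > 0 \<and> (\<forall>x\<in>S. F x \<le> ennreal C * G x \<and> G x \<le> ennreal C * F x))"

end

(* By rotation invariance and polar coordinates every integral in the statement is an integral of the
   circle means M(r, f) of |f|^p against the measure omega(r) dr.  Since |f|^p is subharmonic, M(r, f)
   increases with r; for omega in D the integral is therefore comparable to a sum of M(r_n, f) times the
   tail of omega at r_n, over nodes with 1 - r_n = x^n.  A circle average of suprema of |f|^p over small discs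
   is bounded by a slightly larger circle mean.  This controls M(r_n, f') by (1 - r_n)^(-p) M(r_(n+1), f), and
   M(r_(n+1), f) by (1 + e) M(r_n, f) plus a term in f'.  As the tails decay geometrically, summing the
   second bound recovers f from f' and f(0); induction on k gives sufficiency.

   Conversely, testing the comparison on z^n gives moments of omega.  One inequality concentrates the
   n-th moment on [1 - b/n, 1), which yields the doubling condition.  With it, the other inequality
   concentrates the moment on [1 - a/n, 1 - e/n), so a fixed proportion of the tail at 1 - a/n lies there,
   which is the reverse condition. *)

theory Submission
  imports Defs
begin

section \<open>Area measure: rotations and radial functions\<close>


text \<open>Two obstacles shape the proof. For p < 1 the function t^p is not convex and Minkowski's
  inequality fails, so subharmonicity is drawn from one maximum principle for finite sums of
  |f_i|^p, and powers of sums are split by a perturbation inequality whose leading factor is as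
  close to 1 as desired. That closeness is decisive: passing to the next node multiplies the mean by
  1 + e and the tail by at most \<theta> < 1, and the series can be absorbed only if (1 + e)
  \<theta> < 1. Both sides may be infinite, hence absorption is done on partial sums. In the
  converse the constant C of the comparison is arbitrary, so each unwanted piece of a moment must be
  made small against it. The k-th derivative of z^n supplies the factor (n (1 - r))^(kp), large
  beyond distance b/n from 1 and small within distance e/n; k >= 1 makes both choices possible. The
  piece far from 1 is small only against the moment of half the index, and the return from n/2 to n
  is where the upper estimate of moments by tails enters again.\<close>

lemma lborel_complex_eq_distr_prod:
  "(lborel :: complex measure) = distr (lborel \<Otimes>\<^sub>M lborel) borel (\<lambda>(x, y). Complex x y)"
proof (rule lborel_eqI)
  have meas[measurable]: "(\<lambda>(x, y). Complex x y) \<in> borel_measurable (lborel \<Otimes>\<^sub>M lborel)"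
    unfolding lborel_prod by (auto intro!: borel_measurable_continuous_onI continuous_intros simp: case_prod_beta Complex_eq)
  fix l u :: complex
  assume le: "\<And>b. b \<in> Basis \<Longrightarrow> l \<bullet> b \<le> u \<bullet> b"
  have "Re l \<le> Re u" "Im l \<le> Im u"
    using le[of 1] le[of \<i>] by (auto simp: Basis_complex_def)
  moreover have "(\<lambda>(x, y). Complex x y) -` box l u \<inter> space (lborel \<Otimes>\<^sub>M lborel)
      = {Re l<..<Re u} \<times> {Im l<..<Im u}"
    by (auto simp: box_def Basis_complex_def space_pair_measure)
  ultimately show "emeasure (distr (lborel \<Otimes>\<^sub>M lborel) borel (\<lambda>(x, y). Complex x y)) (box l u)
       = ennreal (\<Prod>b\<in>Basis. (u - l) \<bullet> b)"
    by (subst emeasure_distr)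
       (auto simp: lborel.emeasure_pair_measure_Times Basis_complex_def ennreal_mult)
qed simp

lemma nn_integral_lborel_complex_iterated:
  fixes f :: "complex \<Rightarrow> ennreal"
  assumes [measurable]: "f \<in> borel_measurable borel"
  shows "(\<integral>\<^sup>+z. f z \<partial>lborel) = (\<integral>\<^sup>+x. \<integral>\<^sup>+y. f (Complex x y) \<partial>lborel \<partial>lborel)"
    and "(\<integral>\<^sup>+z. f z \<partial>lborel) = (\<integral>\<^sup>+y. \<integral>\<^sup>+x. f (Complex x y) \<partial>lborel \<partial>lborel)"
proof -
  have meas[measurable]: "(\<lambda>(x, y). Complex x y) \<in> borel_measurable (lborel \<Otimes>\<^sub>M lborel)"
    unfolding lborel_prod by (auto intro!: borel_measurable_continuous_onI continuous_intros simp: case_prod_beta Complex_eq)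
  have *: "(\<integral>\<^sup>+z. f z \<partial>lborel) = (\<integral>\<^sup>+z. f (case z of (x, y) \<Rightarrow> Complex x y) \<partial>(lborel \<Otimes>\<^sub>M lborel))"
    by (subst lborel_complex_eq_distr_prod, subst nn_integral_distr) simp_all
  have m: "(\<lambda>(x, y). f (Complex x y)) \<in> borel_measurable (lborel \<Otimes>\<^sub>M lborel)"
    using measurable_compose[OF meas assms] by (simp add: case_prod_beta)
  show "(\<integral>\<^sup>+z. f z \<partial>lborel) = (\<integral>\<^sup>+x. \<integral>\<^sup>+y. f (Complex x y) \<partial>lborel \<partial>lborel)"
    unfolding * using lborel.nn_integral_fst[OF m] by (simp add: case_prod_unfold)
  show "(\<integral>\<^sup>+z. f z \<partial>lborel) = (\<integral>\<^sup>+y. \<integral>\<^sup>+x. f (Complex x y) \<partial>lborel \<partial>lborel)"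
    unfolding * using lborel_pair.nn_integral_snd[OF m] by (simp add: case_prod_unfold)
qed

text \<open>On each horizontal line the map is the translation by \<open>a * y\<close>, so with the
  x-integral taken first it preserves Lebesgue measure.\<close>

lemma nn_integral_lborel_horizontal_shear:
  fixes f :: "complex \<Rightarrow> ennreal" and a :: real
  assumes [measurable]: "f \<in> borel_measurable borel"
  shows "(\<integral>\<^sup>+z. f (Complex (Re z + a * Im z) (Im z)) \<partial>lborel) = (\<integral>\<^sup>+z. f z \<partial>lborel)"
proof -
  have [measurable]: "(\<lambda>z. Complex (Re z + a * Im z) (Im z)) \<in> borel_measurable borel"
    by (intro borel_measurable_continuous_onI) (auto intro!: continuous_intros simp: Complex_eq)
  have [measurable]: "(\<lambda>x. Complex x y) \<in> borel_measurable borel" for y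
    by (intro borel_measurable_continuous_onI) (auto intro!: continuous_intros simp: Complex_eq)
  have "(\<integral>\<^sup>+x. f (Complex (x + a * y) y) \<partial>lborel) = (\<integral>\<^sup>+x. f (Complex x y) \<partial>lborel)" for y
    using nn_integral_real_affine[of "\<lambda>x. f (Complex x y)" 1 "a * y"] by (simp add: add.commute)
  then show ?thesis
    by (simp add: nn_integral_lborel_complex_iterated(2))
qed

lemma nn_integral_lborel_vertical_shear:
  fixes f :: "complex \<Rightarrow> ennreal" and a :: real
  assumes [measurable]: "f \<in> borel_measurable borel"
  shows "(\<integral>\<^sup>+z. f (Complex (Re z) (Im z + a * Re z)) \<partial>lborel) = (\<integral>\<^sup>+z. f z \<partial>lborel)"
proof -
  have [measurable]: "(\<lambda>z. Complex (Re z) (Im z + a * Re z)) \<in> borel_measurable borel"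
    by (intro borel_measurable_continuous_onI) (auto intro!: continuous_intros simp: Complex_eq)
  have [measurable]: "(\<lambda>y. Complex x y) \<in> borel_measurable borel" for x
    by (intro borel_measurable_continuous_onI) (auto intro!: continuous_intros simp: Complex_eq)
  have "(\<integral>\<^sup>+y. f (Complex x (y + a * x)) \<partial>lborel) = (\<integral>\<^sup>+y. f (Complex x y) \<partial>lborel)" for x
    using nn_integral_real_affine[of "\<lambda>y. f (Complex x y)" 1 "a * x"] by (simp add: add.commute)
  then show ?thesis
    by (simp add: nn_integral_lborel_complex_iterated(1))
qed

text \<open>A rotation by an angle other than \<open>\<pi>\<close> is a product of three shears.\<close>

lemma nn_integral_lborel_rotation:
  fixes f :: "complex \<Rightarrow> ennreal"
  assumes f[measurable]: "f \<in> borel_measurable borel" and c: "norm c = 1"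
  shows "(\<integral>\<^sup>+z. f (c * z) \<partial>lborel) = (\<integral>\<^sup>+z. f z \<partial>lborel)"
proof -
  have main: "(\<integral>\<^sup>+z. f (c * z) \<partial>lborel) = (\<integral>\<^sup>+z. f z \<partial>lborel)"
    if f[measurable]: "f \<in> borel_measurable borel" and c: "norm c = 1" "Re c \<noteq> -1"
    for f :: "complex \<Rightarrow> ennreal" and c
  proof -
    \<comment> \<open>\<open>t\<close> is the tangent of half the argument of \<open>c\<close>; the
      three shears are x - t y, then y + (Im c) x, then x - t y again.\<close>
    define t where "t = Im c / (1 + Re c)"
    have sq: "(Re c)\<^sup>2 + (Im c)\<^sup>2 = 1"
      using c(1) by (metis cmod_power2 one_power2)
    have ne: "1 + Re c \<noteq> 0"
      using c by auto
    have "Im c * Im c = (1 - Re c) * (1 + Re c)"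
      using sq by (simp add: power2_eq_square algebra_simps)
    then have t1: "1 - Im c * t = Re c" "t * (1 + Re c) = Im c"
      using ne by (simp_all add: t_def field_simps)
    define g where "g = (\<lambda>z. f (Complex (Re z + (- t) * Im z) (Im z)))"
    define h where "h = (\<lambda>z. g (Complex (Re z) (Im z + Im c * Re z)))"
    have [measurable]: "(\<lambda>z. Complex (Re z + a * Im z) (Im z)) \<in> borel_measurable borel"
      "(\<lambda>z. Complex (Re z) (Im z + a * Re z)) \<in> borel_measurable borel" for a
      by (intro borel_measurable_continuous_onI; auto intro!: continuous_intros simp: Complex_eq)+
    have g[measurable]: "g \<in> borel_measurable borel" and h[measurable]: "h \<in> borel_measurable borel"
      unfolding g_def h_def by measurable
    have "h (Complex (Re z + (- t) * Im z) (Im z)) = f (c * z)" for z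
    proof -
      define x1 where "x1 = Re z - t * Im z"
      define y1 where "y1 = Im z + Im c * x1"
      have "y1 = Im c * Re z + (1 - Im c * t) * Im z"
        by (simp add: y1_def x1_def algebra_simps)
      then have y1: "y1 = Im c * Re z + Re c * Im z"
        by (simp only: t1)
      have "x1 - t * y1 = (1 - Im c * t) * Re z - (t * (1 + Re c)) * Im z"
        by (simp add: y1 x1_def algebra_simps)
      then have "x1 - t * y1 = Re c * Re z - Im c * Im z"
        by (simp only: t1)
      then have "Complex (x1 - t * y1) y1 = c * z"
        by (simp add: y1 complex_eq_iff)
      then show ?thesis
        by (simp add: h_def g_def x1_def y1_def)
    qed
    then have "(\<integral>\<^sup>+z. f (c * z) \<partial>lborel) = (\<integral>\<^sup>+z. h z \<partial>lborel)"
      using nn_integral_lborel_horizontal_shear[OF h, of "- t"] by simp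
    also have "\<dots> = (\<integral>\<^sup>+z. g z \<partial>lborel)"
      unfolding h_def by (rule nn_integral_lborel_vertical_shear[OF g])
    also have "\<dots> = (\<integral>\<^sup>+z. f z \<partial>lborel)"
      unfolding g_def by (rule nn_integral_lborel_horizontal_shear[OF f])
    finally show ?thesis .
  qed
  show ?thesis
  proof (cases "Re c = -1")
    case False
    then show ?thesis using main[OF f c] by simp
  next
    case True
    have "(norm c)\<^sup>2 = (Re c)\<^sup>2 + (Im c)\<^sup>2"
      by (rule cmod_power2)
    \<comment> \<open>The excluded rotation by \<pi> is two quarter turns, each covered by the
      generic case.\<close>
    then have "c = \<i> * \<i>"
      using True c by (simp add: complex_eq_iff)
    moreover have "(\<integral>\<^sup>+z. f (\<i> * (\<i> * z)) \<partial>lborel) = (\<integral>\<^sup>+z. f (\<i> * z) \<partial>lborel)"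
      by (rule main) simp_all
    ultimately show ?thesis
      using main[OF f, of \<i>] by (simp add: mult.assoc)
  qed
qed

text \<open>Push the area measure of the disc forward under \<open>norm\<close> and compare it with
  2 pi r dr on [0, R): on a half-line both give the area of an annulus, and measures on the line
  that are finite and equal on these half-lines coincide.\<close>

lemma nn_integral_lborel_radial:
  fixes F :: "real \<Rightarrow> ennreal"
  assumes F[measurable]: "F \<in> borel_measurable borel" and R: "0 \<le> R"
  shows "(\<integral>\<^sup>+z. F (norm z) * indicator (ball 0 R) z \<partial>(lborel :: complex measure))
       = (\<integral>\<^sup>+r. F r * ennreal (2 * pi * r) * indicator {0..<R} r \<partial>lborel)"
proof -
  define M where "M = distr (density lborel (indicator (ball (0::complex) R))) borel norm"
  define N where "N = density lborel (\<lambda>r::real. ennreal (2 * pi * r) * indicator {0..<R} r)"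
  have ball: "emeasure lborel (ball (0::complex) R) = ennreal (pi * R\<^sup>2)"
    using R by (simp add: emeasure_ball unit_ball_vol_2)
  have "M = N"
  proof (rule measure_eqI_lessThan)
    show "sets M = sets borel" "sets N = sets borel"
      by (simp_all add: M_def N_def)
    fix x :: real
    have eM: "emeasure M {x<..} = emeasure lborel (ball (0::complex) R - cball 0 x)"
    proof -
      have "emeasure M {x<..} = (\<integral>\<^sup>+z. indicator (ball (0::complex) R) z * indicator {z. x < norm z} z \<partial>lborel)"
        unfolding M_def by (subst emeasure_distr; (subst emeasure_density)?; simp add: vimage_def borel_measurable_indicator)
      also have "\<dots> = (\<integral>\<^sup>+z. indicator (ball (0::complex) R - cball 0 x) z \<partial>lborel)"
        by (intro nn_integral_cong) (auto simp: indicator_def)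
      finally show ?thesis by simp
    qed
    have "emeasure lborel (ball (0::complex) R - cball 0 x) \<le> emeasure lborel (ball (0::complex) R)"
      by (intro emeasure_mono) auto
    then show "emeasure M {x<..} < \<infinity>"
      unfolding eM ball by (metis ennreal_less_top infinity_ennreal_def le_less_trans)
    \<comment> \<open>Clamping \<open>x\<close> to [0, R] gives one formula for the annulus, also
      when \<open>x\<close> is negative or beyond \<open>R\<close>.\<close>
    define y where "y = max 0 (min x R)"
    have y: "0 \<le> y" "y \<le> R"
      using R by (auto simp: y_def)
    have "emeasure lborel (ball (0::complex) R - cball 0 x) = ennreal (pi * R\<^sup>2 - pi * y\<^sup>2)"
    proof (cases "x < 0")
      case True
      then show ?thesis by (simp add: ball y_def)
    next
      case False
      show ?thesis
      proof (cases "x < R")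
        case True
        then have "cball (0::complex) x \<subseteq> ball 0 R" by auto
        then have "emeasure lborel (ball (0::complex) R - cball 0 x)
           = emeasure lborel (ball (0::complex) R) - emeasure lborel (cball (0::complex) x)"
          by (subst emeasure_Diff) (use False in \<open>auto simp: emeasure_cball\<close>)
        also have "\<dots> = ennreal (pi * R\<^sup>2) - ennreal (pi * x\<^sup>2)"
          using False by (simp add: ball emeasure_cball unit_ball_vol_2)
        also have "\<dots> = ennreal (pi * R\<^sup>2 - pi * x\<^sup>2)"
          by (subst ennreal_minus) auto
        finally show ?thesis
          using True False by (simp add: y_def)
      next
        case xR: False
        then have *: "ball (0::complex) R - cball 0 x = {}" by auto
        show ?thesis
          unfolding * using xR R by (simp add: y_def)
      qed
    qed
    moreover have "emeasure N {x<..} = ennreal (pi * R\<^sup>2 - pi * y\<^sup>2)"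
    proof -
      have "emeasure N {x<..} = (\<integral>\<^sup>+r. ennreal (2 * pi * r) * indicator {0..<R} r * indicator {x<..} r \<partial>lborel)"
        unfolding N_def by (subst emeasure_density) auto
      also have "\<dots> = (\<integral>\<^sup>+r. ennreal (2 * pi * r) * indicator {y..R} r \<partial>lborel)"
      proof (rule nn_integral_cong_AE)
        have "AE r in lborel. r \<noteq> R \<and> r \<noteq> x \<and> r \<noteq> 0"
          by (intro AE_conjI AE_lborel_singleton)
        then show "AE r in lborel. ennreal (2 * pi * r) * indicator {0..<R} r * indicator {x<..} r
            = ennreal (2 * pi * r) * indicator {y..R} r"
          by eventually_elim (auto simp: indicator_def y_def)
      qed
      also have "\<dots> = ennreal (pi * R\<^sup>2 - pi * y\<^sup>2)"
        by (rule nn_integral_FTC_Icc[where F = "\<lambda>r. pi * r\<^sup>2"])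
           (use y in \<open>auto intro!: derivative_eq_intros\<close>)
      finally show ?thesis .
    qed
    ultimately show "emeasure M {x<..} = emeasure N {x<..}"
      by (simp add: eM)
  qed
  have "(\<integral>\<^sup>+z. F (norm z) * indicator (ball 0 R) z \<partial>(lborel :: complex measure)) = (\<integral>\<^sup>+r. F r \<partial>M)"
    unfolding M_def
    by (simp add: nn_integral_distr nn_integral_density borel_measurable_indicator mult.commute)
  also have "\<dots> = (\<integral>\<^sup>+r. F r \<partial>N)"
    by (simp add: \<open>M = N\<close>)
  also have "\<dots> = (\<integral>\<^sup>+r. F r * ennreal (2 * pi * r) * indicator {0..<R} r \<partial>lborel)"
    unfolding N_def by (simp add: nn_integral_density mult_ac)
  finally show ?thesis .
qed

section \<open>Circle means of a holomorphic function\<close>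


lemma continuous_on_norm_powr:
  fixes f :: "'a::topological_space \<Rightarrow> 'b::real_normed_vector"
  assumes "continuous_on S f" "0 < p"
  shows "continuous_on S (\<lambda>x. norm (f x) powr p)"
  using assms by (intro continuous_on_powr' continuous_on_norm continuous_on_const) auto

text \<open>Near \<open>z0\<close> every \<open>f i\<close> that does not vanish there has a
  holomorphic p-th power; multiplied by unimodular constants, these powers are all positive at
  \<open>z0\<close>. Their sum \<open>G\<close> is holomorphic, |G| is at most the sum of |f_i|^p,
  and equality holds at \<open>z0\<close>. The maximum modulus principle makes \<open>G\<close>
  constant, and the sum is squeezed between |G| and its maximum.\<close>

lemma sum_norm_powr_local_maximum:
  fixes f :: "'i \<Rightarrow> complex \<Rightarrow> complex"
  assumes I: "finite I" and p: "0 < p" and S: "open S" "z0 \<in> S"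
    and hol: "\<And>i. i \<in> I \<Longrightarrow> f i holomorphic_on S"
    and max: "\<And>z. z \<in> S \<Longrightarrow> (\<Sum>i\<in>I. norm (f i z) powr p) \<le> (\<Sum>i\<in>I. norm (f i z0) powr p)"
  obtains d where "0 < d" "ball z0 d \<subseteq> S"
    "\<And>z. z \<in> ball z0 d \<Longrightarrow> (\<Sum>i\<in>I. norm (f i z) powr p) = (\<Sum>i\<in>I. norm (f i z0) powr p)"
proof -
  \<comment> \<open>Terms vanishing at \<open>z0\<close> have no logarithm nearby; leaving them out
    of \<open>G\<close> keeps its value at \<open>z0\<close> and keeps |G| below the full
    sum.\<close>
  define J where "J = {i\<in>I. f i z0 \<noteq> 0}"
  have J: "finite J" "J \<subseteq> I" using I by (auto simp: J_def)
  define W where "W = S \<inter> (\<Inter>i\<in>J. {z\<in>S. f i z \<noteq> 0})"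
  have "open {z\<in>S. f i z \<noteq> 0}" if "i \<in> J" for i
  proof -
    have "continuous_on S (f i)" using hol that J by (auto intro: holomorphic_on_imp_continuous_on)
    then have "open (S \<inter> f i -` (- {0}))"
      using S by (intro continuous_open_preimage) auto
    moreover have "S \<inter> f i -` (- {0}) = {z\<in>S. f i z \<noteq> 0}" by auto
    ultimately show ?thesis by simp
  qed
  then have "open W"
    unfolding W_def using S J by (intro open_Int open_INT) auto
  moreover have "z0 \<in> W" using S by (auto simp: W_def J_def)
  ultimately obtain d where d: "0 < d" "ball z0 d \<subseteq> W"
    using open_contains_ball by blast
  have dS: "ball z0 d \<subseteq> S" using d by (auto simp: W_def)
  have "\<exists>g. g holomorphic_on ball z0 d \<and> (\<forall>z\<in>ball z0 d. f i z = exp (g z))" if i: "i \<in> J" for i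
  proof -
    have "f i holomorphic_on ball z0 d"
      using hol[of i] i J dS by (auto intro: holomorphic_on_subset)
    moreover have "\<And>z. z \<in> ball z0 d \<Longrightarrow> f i z \<noteq> 0" using d i by (auto simp: W_def)
    ultimately obtain g where "g holomorphic_on ball z0 d" "\<And>z. z \<in> ball z0 d \<Longrightarrow> f i z = exp (g z)"
      using contractible_imp_holomorphic_log[of "f i" "ball z0 d"] convex_imp_contractible[OF convex_ball]
      by blast
    then show ?thesis by blast
  qed
  then obtain g where g: "\<And>i. i \<in> J \<Longrightarrow> g i holomorphic_on ball z0 d"
      "\<And>i z. i \<in> J \<Longrightarrow> z \<in> ball z0 d \<Longrightarrow> f i z = exp (g i z)"
    by metis
  define h where "h = (\<lambda>i z. exp (of_real p * g i z))"
  have h: "norm (h i z) = norm (f i z) powr p" if "i \<in> J" "z \<in> ball z0 d" for i z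
    using g(2)[OF that] by (simp add: h_def exp_powr_real mult.commute)
  define G where "G = (\<lambda>z. \<Sum>i\<in>J. cnj (sgn (h i z0)) * h i z)"
  have J_sum: "(\<Sum>i\<in>I. norm (f i z0) powr p) = (\<Sum>i\<in>J. norm (f i z0) powr p)"
    using I p by (intro sum.mono_neutral_right) (auto simp: J_def)
  have G_le: "norm (G z) \<le> (\<Sum>i\<in>I. norm (f i z) powr p)" if "z \<in> ball z0 d" for z
  proof -
    have "norm (G z) \<le> (\<Sum>i\<in>J. norm (cnj (sgn (h i z0)) * h i z))"
      unfolding G_def by (rule norm_sum)
    also have "\<dots> \<le> (\<Sum>i\<in>J. norm (f i z) powr p)"
      using that by (intro sum_mono) (auto simp: norm_mult h norm_sgn)
    also have "\<dots> \<le> (\<Sum>i\<in>I. norm (f i z) powr p)"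
      using I J by (intro sum_mono2) auto
    finally show ?thesis .
  qed
  have z0: "z0 \<in> ball z0 d" using d by simp
  have "G z0 = of_real (\<Sum>i\<in>I. norm (f i z0) powr p)"
  proof -
    have "cnj (sgn w) * w = of_real (norm w)" for w :: complex
    proof -
      have "cnj (sgn w) * w = (w * cnj w) / of_real (norm w)"
        by (simp add: sgn_eq)
      also have "\<dots> = of_real (norm w)"
        by (simp add: complex_norm_square[symmetric] power2_eq_square)
      finally show ?thesis .
    qed
    then have "G z0 = (\<Sum>i\<in>J. of_real (norm (h i z0)))"
      by (simp add: G_def)
    then show ?thesis
      unfolding J_sum using h[OF _ z0] by simp
  qed
  then have G0: "norm (G z0) = (\<Sum>i\<in>I. norm (f i z0) powr p)"
    by (simp only: norm_of_real abs_of_nonneg sum_nonneg powr_ge_zero)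
  have "G holomorphic_on ball z0 d"
    unfolding G_def h_def using g(1) by (intro holomorphic_intros) auto
  then have "G constant_on ball z0 d"
  proof (rule maximum_modulus_principle[where U = "ball z0 d" and \<xi> = z0])
    fix z assume z: "z \<in> ball z0 d"
    show "norm (G z) \<le> norm (G z0)"
      unfolding G0 using G_le[OF z] max[of z] dS z by force
  qed (use z0 in auto)
  then have "G z = G z0" if "z \<in> ball z0 d" for z
    using that z0 unfolding constant_on_def by metis
  then have "(\<Sum>i\<in>I. norm (f i z) powr p) = (\<Sum>i\<in>I. norm (f i z0) powr p)" if "z \<in> ball z0 d" for z
    using G_le[OF that] max[of z] dS that G0 by force
  then show thesis using that d dS by blast
qed

text \<open>The set of interior maximum points is open by the local statement and closed by
  continuity, so connectedness leaves only a constant sum, whose value is then also taken on the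
  boundary circle. A single \<open>\<zeta>\<close> serves all summands at once, as required for
  rotated copies of one function.\<close>

lemma sum_norm_powr_max_principle:
  fixes f :: "'i \<Rightarrow> complex \<Rightarrow> complex"
  assumes I: "finite I" and p: "0 < p" and s: "0 \<le> s" "s < R" and z: "norm z \<le> s"
    and hol: "\<And>i. i \<in> I \<Longrightarrow> f i holomorphic_on ball 0 R"
  obtains \<zeta> where "norm \<zeta> = s" "(\<Sum>i\<in>I. norm (f i z) powr p) \<le> (\<Sum>i\<in>I. norm (f i \<zeta>) powr p)"
proof -
  define u where "u = (\<lambda>z. \<Sum>i\<in>I. norm (f i z) powr p)"
  have cont: "continuous_on (ball 0 R) u"
    unfolding u_def using hol p
    by (intro continuous_on_sum continuous_on_norm_powr holomorphic_on_imp_continuous_on)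
  then have contc: "continuous_on (cball 0 s) u"
    by (rule continuous_on_subset) (use s in auto)
  obtain z0 where z0: "norm z0 \<le> s" and max: "\<And>w. norm w \<le> s \<Longrightarrow> u w \<le> u z0"
    using continuous_attains_sup[OF compact_cball _ contc] s by auto
  have "\<exists>\<zeta>. norm \<zeta> = s \<and> u \<zeta> = u z0"
  proof (cases "norm z0 = s")
    case False
    then have z0s: "norm z0 < s" using z0 by simp
    define K where "K = {w\<in>ball 0 s. u w = u z0}"
    have "K = ball 0 s"
    proof (rule ccontr)
      assume neq: "K \<noteq> ball 0 s"
      have "open K"
        unfolding open_contains_ball
      proof
        fix w assume w: "w \<in> K"
        have w': "w \<in> ball 0 s" "u w = u z0" using w by (auto simp: K_def)
        have hol': "f i holomorphic_on ball 0 s" if "i \<in> I" for i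
          using hol[OF that] by (rule holomorphic_on_subset) (use s in auto)
        have max': "u y \<le> u w" if "y \<in> ball 0 s" for y
          using max[of y] that w' by simp
        have "\<exists>d>0. ball w d \<subseteq> ball 0 s \<and> (\<forall>y\<in>ball w d. u y = u w)"
          unfolding u_def
          by (rule sum_norm_powr_local_maximum[OF I p open_ball w'(1) hol' max'[unfolded u_def]]) (assumption | intro exI conjI ballI; assumption)+
        then obtain d where "0 < d" "ball w d \<subseteq> ball 0 s"
            "\<And>y. y \<in> ball w d \<Longrightarrow> u y = u w"
          by blast
        then have "ball w d \<subseteq> K" using w' unfolding K_def by auto
        then show "\<exists>e>0. ball w e \<subseteq> K" using \<open>0 < d\<close> by blast
      qed
      moreover have "closedin (top_of_set (ball 0 s)) K"
      proof -
        have "continuous_on (ball 0 s) u"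
          by (rule continuous_on_subset[OF contc]) auto
        then show ?thesis
          unfolding K_def by (rule continuous_closedin_preimage_constant)
      qed
      moreover have "openin (top_of_set (ball 0 s)) K"
        using \<open>open K\<close> by (intro open_subset) (auto simp: K_def)
      moreover have "z0 \<in> K" using z0s by (simp add: K_def)
      ultimately show False
        using neq connected_clopen[of "ball (0::complex) s"] connected_ball by auto
    qed
    then have const: "u w = u z0" if "w \<in> ball 0 s" for w using that unfolding K_def by blast
    have s0: "0 < s" using z0s norm_ge_zero[of z0] by linarith
    have "u (of_real s) = u z0"
    proof (rule continuous_constant_on_closure[where f = u and S = "ball 0 s"])
      show "continuous_on (closure (ball 0 s)) u"
        using contc s0 by (simp add: closure_ball)
      show "of_real s \<in> closure (ball (0::complex) s)"
        using s s0 by (simp add: closure_ball)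
    qed (rule const)
    then show ?thesis using s by (intro exI[of _ "of_real s"]) auto
  qed blast
  then show thesis using that max[OF z] by (auto simp: u_def)
qed

section \<open>Uniform Riemann sums of periodic functions\<close>

lemma integral_periodic_shift:
  fixes F :: "real \<Rightarrow> real"
  assumes F: "continuous_on UNIV F" and per: "\<And>t. F (t + a) = F t" and \<theta>: "0 \<le> \<theta>" "\<theta> \<le> a"
  shows "integral {\<theta>..\<theta> + a} F = integral {0..a} F"
proof -
  have int: "F integrable_on {x..y}" for x y
    by (intro integrable_continuous_real continuous_on_subset[OF F]) auto
  have "integral {\<theta>..\<theta> + a} F = integral {\<theta>..a} F + integral {a..\<theta> + a} F"
    using \<theta> by (intro Henstock_Kurzweil_Integration.integral_combine[symmetric] int) auto
  also have "integral {a..\<theta> + a} F = integral {0..\<theta>} (F \<circ> (+) a)"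
    by (simp add: integral_shift_Icc_real)
  also have "F \<circ> (+) a = F"
    using per by (auto simp: add.commute)
  also have "integral {\<theta>..a} F + integral {0..\<theta>} F = integral {0..a} F"
    using \<theta> Henstock_Kurzweil_Integration.integral_combine[of 0 \<theta> a F] int by simp
  finally show ?thesis .
qed

lemma riemann_sum_error:
  fixes F :: "real \<Rightarrow> real"
  assumes F: "continuous_on UNIV F" and h: "0 \<le> h"
    and e: "\<And>s t. \<theta> \<le> s \<Longrightarrow> s \<le> t \<Longrightarrow> t \<le> s + h \<Longrightarrow> t \<le> \<theta> + real N * h \<Longrightarrow> \<bar>F t - F s\<bar> \<le> e"
  shows "\<bar>(\<Sum>j<N. h * F (\<theta> + real j * h)) - integral {\<theta>..\<theta> + real N * h} F\<bar> \<le> real N * h * e"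
  using e
proof (induction N)
  case 0
  then show ?case by simp
next
  case (Suc N)
  have int: "F integrable_on {x..y}" for x y
    by (intro integrable_continuous_real continuous_on_subset[OF F]) auto
  define s where "s = \<theta> + real N * h"
  have \<theta>s: "\<theta> \<le> s" using h by (simp add: s_def)
  have sh: "\<theta> + real (Suc N) * h = s + h" by (simp add: s_def algebra_simps)
  have eq: "integral {\<theta>..s + h} F = integral {\<theta>..s} F + integral {s..s + h} F"
    using h \<theta>s by (intro Henstock_Kurzweil_Integration.integral_combine[symmetric] int) auto
  have "integral {s..s + h} (\<lambda>t. F t - F s) = integral {s..s+h} F - h * F s"
    using h by (subst Henstock_Kurzweil_Integration.integral_diff) (auto intro: int)
  moreover have "\<bar>integral {s..s + h} (\<lambda>t. F t - F s)\<bar> \<le> e * (s + h - s)"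
    unfolding real_norm_def[symmetric]
  proof (rule integral_bound)
    show "continuous_on {s..s + h} (\<lambda>t. F t - F s)"
      by (intro continuous_intros continuous_on_subset[OF F]) auto
    show "norm (F t - F s) \<le> e" if "t \<in> {s..s + h}" for t
      using Suc.prems[OF \<theta>s, of t] that unfolding sh by auto
  qed (use h in auto)
  moreover have "\<bar>(\<Sum>j<N. h * F (\<theta> + real j * h)) - integral {\<theta>..s} F\<bar> \<le> real N * h * e"
    unfolding s_def
  proof (rule Suc.IH)
    fix a b assume "\<theta> \<le> a" "a \<le> b" "b \<le> a + h" "b \<le> \<theta> + real N * h"
    then show "\<bar>F b - F a\<bar> \<le> e"
      using h by (intro Suc.prems) (auto simp: algebra_simps)
  qed
  moreover have "(\<Sum>j<Suc N. h * F (\<theta> + real j * h)) = (\<Sum>j<N. h * F (\<theta> + real j * h)) + h * F s"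
    by (simp add: s_def)
  moreover have "real (Suc N) * h * e = real N * h * e + e * (s + h - s)"
    by (simp add: algebra_simps)
  ultimately show ?case
    unfolding sh eq by linarith
qed

text \<open>\<open>N0\<close> does not depend on the starting point \<open>\<theta>\<close>. This
  uniformity matters because the sums are later started at the argument of a maximum point that
  moves with \<open>N\<close>.\<close>

lemma riemann_sum_periodic:
  fixes F :: "real \<Rightarrow> real"
  assumes F: "continuous_on UNIV F" and per: "\<And>t. F (t + a) = F t" and a: "0 < a" and e: "0 < e"
  obtains N0 where "\<And>N \<theta>. N0 \<le> N \<Longrightarrow> 0 < N \<Longrightarrow> 0 \<le> \<theta> \<Longrightarrow> \<theta> \<le> a \<Longrightarrow>
    \<bar>(\<Sum>j<N. F (\<theta> + real j * (a / real N))) / real N - integral {0..a} F / a\<bar> \<le> e"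
proof -
  \<comment> \<open>The sample points start at most at \<open>a\<close> and run over one period, so
    they stay in [0, 2a].\<close>
  have "uniformly_continuous_on {0..2 * a} F"
    by (intro compact_uniformly_continuous continuous_on_subset[OF F]) auto
  then obtain d where d: "0 < d" "\<And>x y. x \<in> {0..2*a} \<Longrightarrow> y \<in> {0..2*a} \<Longrightarrow> dist y x < d \<Longrightarrow> dist (F y) (F x) < e"
    unfolding uniformly_continuous_on_def using e by metis
  obtain N0 :: nat where N0: "a / d < real N0"
    using reals_Archimedean2 by blast
  show thesis
  proof (rule that)
    fix N :: nat and \<theta> assume "N0 \<le> N" and N0: "0 < N" and \<theta>: "0 \<le> \<theta>" "\<theta> \<le> a"
    have N: "a / d < real N"
      using N0 \<open>N0 \<le> N\<close> \<open>a / d < real N0\<close> by linarith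
    define h where "h = a / real N"
    have h: "0 < h" "h < d" "real N * h = a"
      using N N0 a d by (auto simp: h_def field_simps)
    have "\<bar>(\<Sum>j<N. h * F (\<theta> + real j * h)) - integral {\<theta>..\<theta> + real N * h} F\<bar> \<le> real N * h * e"
    proof (rule riemann_sum_error[OF F])
      fix s t assume "\<theta> \<le> s" "s \<le> t" "t \<le> s + h" "t \<le> \<theta> + real N * h"
      then show "\<bar>F t - F s\<bar> \<le> e"
        using d(2)[of s t] h \<theta> by (auto simp: dist_real_def)
    qed (use h in auto)
    then have le: "\<bar>h * (\<Sum>j<N. F (\<theta> + real j * h)) - integral {0..a} F\<bar> \<le> a * e"
      using h integral_periodic_shift[OF F per \<theta>] by (simp add: sum_distrib_left)
    have "(\<Sum>j<N. F (\<theta> + real j * h)) / real N - integral {0..a} F / a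
        = (h * (\<Sum>j<N. F (\<theta> + real j * h)) - integral {0..a} F) / a"
      using a N0 by (simp add: h_def diff_divide_distrib del: times_divide_eq_right)
    then have "\<bar>(\<Sum>j<N. F (\<theta> + real j * h)) / real N - integral {0..a} F / a\<bar>
        = \<bar>h * (\<Sum>j<N. F (\<theta> + real j * h)) - integral {0..a} F\<bar> / a"
      using a by simp
    also have "\<dots> \<le> e" using le a by (simp add: divide_le_eq mult.commute)
    finally show "\<bar>(\<Sum>j<N. F (\<theta> + real j * (a / real N))) / real N - integral {0..a} F / a\<bar> \<le> e"
      by (simp add: h_def)
  qed
qed

text \<open>The p-th power of the classical integral mean M_p(r, f). No root is taken, since it is
  the power that is integrated against the weight.\<close>

definition circle_mean :: "real \<Rightarrow> (complex \<Rightarrow> complex) \<Rightarrow> real \<Rightarrow> real" where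
  "circle_mean p f r = integral {0..2 * pi} (\<lambda>t. norm (f (of_real r * cis t)) powr p) / (2 * pi)"

lemma continuous_on_circle_norm_powr:
  assumes f: "continuous_on (ball 0 R) f" and r: "\<bar>r\<bar> < R" and p: "0 < p"
  shows "continuous_on T (\<lambda>t. norm (f (of_real r * cis t)) powr p)"
  using r p
  by (intro continuous_on_norm_powr continuous_on_compose2[OF f] continuous_intros)
     (auto simp: norm_mult)

text \<open>Rotate \<open>f\<close> through the N-th roots of unity and sum the p-th powers. At the
  point \<open>r\<close> this is N times a Riemann sum of the mean at radius \<open>r\<close>; by
  the maximum principle it is at most the value at some \<open>\<zeta>\<close> of modulus
  \<open>s\<close>, which is N times a Riemann sum for radius \<open>s\<close>. For large N both
  Riemann sums are within e/2 of the means.\<close>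

theorem circle_mean_mono:
  assumes f: "f holomorphic_on ball 0 R" and p: "0 < p" and rs: "0 \<le> r" "r \<le> s" "s < R"
  shows "circle_mean p f r \<le> circle_mean p f s"
proof (rule field_le_epsilon)
  fix e :: real assume e: "0 < e"
  define F where "F = (\<lambda>r t. norm (f (of_real r * cis t)) powr p)"
  have contf: "continuous_on (ball 0 R) f" by (rule holomorphic_on_imp_continuous_on[OF f])
  have F: "continuous_on UNIV (F r')" if "0 \<le> r'" "r' < R" for r'
    unfolding F_def using that p by (intro continuous_on_circle_norm_powr[OF contf]) auto
  have per: "F r' (t + 2 * pi) = F r' t" for r' t
    by (simp add: F_def cis_mult[symmetric])
  have M: "circle_mean p f r' = integral {0..2*pi} (F r') / (2 * pi)" for r'
    by (simp add: circle_mean_def F_def)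
  have mean: "\<exists>N0. \<forall>N \<theta>. N0 \<le> N \<longrightarrow> 0 < N \<longrightarrow> 0 \<le> \<theta> \<longrightarrow> \<theta> \<le> 2 * pi \<longrightarrow>
      \<bar>(\<Sum>j<N. F r' (\<theta> + real j * (2 * pi / real N))) / real N - circle_mean p f r'\<bar> \<le> e / 2"
    if r': "0 \<le> r'" "r' < R" for r'
    using riemann_sum_periodic[OF F[OF r'] per[of r'], of "e/2"] e unfolding M
    by (metis half_gt_zero mult_pos_pos pi_gt_zero zero_less_numeral)
  obtain N1 where N1: "\<And>N \<theta>. N1 \<le> N \<Longrightarrow> 0 < N \<Longrightarrow> 0 \<le> \<theta> \<Longrightarrow> \<theta> \<le> 2 * pi \<Longrightarrow>
      \<bar>(\<Sum>j<N. F r (\<theta> + real j * (2 * pi / real N))) / real N - circle_mean p f r\<bar> \<le> e / 2"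
    using mean[of r] rs by auto
  obtain N2 where N2: "\<And>N \<theta>. N2 \<le> N \<Longrightarrow> 0 < N \<Longrightarrow> 0 \<le> \<theta> \<Longrightarrow> \<theta> \<le> 2 * pi \<Longrightarrow>
      \<bar>(\<Sum>j<N. F s (\<theta> + real j * (2 * pi / real N))) / real N - circle_mean p f s\<bar> \<le> e / 2"
    using mean[of s] rs by auto
  define N where "N = Suc (max N1 N2)"
  have N: "N1 \<le> N" "N2 \<le> N" "0 < N" by (auto simp: N_def)
  \<comment> \<open>\<open>f' j\<close> is the j-th rotated copy of \<open>f\<close>, not a
    derivative.\<close>
  define f' where "f' = (\<lambda>j::nat. \<lambda>z. f (z * cis (real j * (2 * pi / real N))))"
  have "f' j holomorphic_on ball 0 R" for j
    unfolding f'_def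
    by (intro holomorphic_on_compose_gen[OF _ f, unfolded o_def] holomorphic_intros) (auto simp: norm_mult)
  then obtain \<zeta> where \<zeta>: "norm \<zeta> = s"
      "(\<Sum>j<N. norm (f' j (of_real r)) powr p) \<le> (\<Sum>j<N. norm (f' j \<zeta>) powr p)"
    using sum_norm_powr_max_principle[of "{..<N}" p s R "of_real r" f'] p rs by auto
  define \<theta> where "\<theta> = Arg2pi \<zeta>"
  have \<theta>: "0 \<le> \<theta>" "\<theta> \<le> 2 * pi" "\<zeta> = of_real s * cis \<theta>"
    using \<zeta>(1) Arg2pi[of \<zeta>] by (auto simp: \<theta>_def cis_conv_exp is_Arg_def)
  have "norm (f' j (of_real r)) powr p = F r (0 + real j * (2 * pi / real N))"
       "norm (f' j \<zeta>) powr p = F s (\<theta> + real j * (2 * pi / real N))" for j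
    by (auto simp: f'_def F_def \<theta>(3) cis_mult mult.assoc)
  with \<zeta>(2) have le: "(\<Sum>j<N. F r (0 + real j * (2 * pi / real N))) / real N
      \<le> (\<Sum>j<N. F s (\<theta> + real j * (2 * pi / real N))) / real N"
    using N by (intro divide_right_mono) auto
  show "circle_mean p f r \<le> circle_mean p f s + e"
    using le N1[OF N(1,3), OF order_refl] N2[OF N(2,3) \<theta>(1,2)] pi_ge_zero by linarith
qed

section \<open>Polar coordinates and circle averages of suprema\<close>


text \<open>Covers every \<open>f\<close>, because \<open>integral\<close> is 0 on functions that
  are not integrable.\<close>

lemma circle_mean_nonneg: "0 \<le> circle_mean p f r"
proof -
  have "0 \<le> integral {0..2 * pi} (\<lambda>t. norm (f (of_real r * cis t)) powr p)"
    by (cases "(\<lambda>t. norm (f (of_real r * cis t)) powr p) integrable_on {0..2 * pi}")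
       (auto intro: Henstock_Kurzweil_Integration.integral_nonneg simp: not_integrable_integral)
  then show ?thesis by (simp add: circle_mean_def)
qed

lemma circle_mean_0: "circle_mean p f 0 = norm (f 0) powr p"
  by (simp add: circle_mean_def)

lemma nn_integral_circle_mean:
  assumes f: "continuous_on (ball 0 R) f" and r: "\<bar>r\<bar> < R" and p: "0 < p"
  shows "(\<integral>\<^sup>+t. ennreal (norm (f (of_real r * cis t)) powr p) * indicator {0..2 * pi} t \<partial>lborel)
       = ennreal (2 * pi * circle_mean p f r)"
proof -
  have "(\<lambda>t. norm (f (of_real r * cis t)) powr p) integrable_on {0..2 * pi}"
    by (intro integrable_continuous_real continuous_on_circle_norm_powr[OF f r p])
  from nn_integral_has_integral_lebesgue'[OF _ integrable_integral[OF this]]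
  show ?thesis by (simp add: circle_mean_def)
qed

text \<open>With z equal to |z| times \<open>cis a\<close>, rotating z shifts the angle by
  \<open>a\<close>, which periodicity undoes.\<close>

lemma nn_integral_circle_mean_rotated:
  assumes f: "continuous_on (ball 0 R) f" and z: "norm z < R" and p: "0 < p"
  shows "(\<integral>\<^sup>+t. ennreal (norm (f (cis t * z)) powr p) * indicator {0..2 * pi} t \<partial>lborel)
       = ennreal (2 * pi * circle_mean p f (norm z))"
proof -
  define F where "F = (\<lambda>t. norm (f (of_real (norm z) * cis t)) powr p)"
  define a where "a = Arg2pi z"
  have a: "0 \<le> a" "a \<le> 2 * pi" "z = of_real (norm z) * cis a"
    using Arg2pi[of z] by (auto simp: a_def cis_conv_exp is_Arg_def)
  have F: "continuous_on UNIV F"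
    unfolding F_def using z by (intro continuous_on_circle_norm_powr[OF f _ p]) auto
  have eq: "norm (f (cis t * z)) powr p = (F \<circ> (+) a) t" for t
  proof -
    have "cis t * z = of_real (norm z) * cis (a + t)"
      by (subst a(3)) (simp add: cis_mult[symmetric] mult_ac)
    then show ?thesis by (simp add: F_def)
  qed
  have "continuous_on UNIV (F \<circ> (+) a)"
    by (intro continuous_on_compose continuous_intros continuous_on_subset[OF F]) auto
  then have "(F \<circ> (+) a) integrable_on {0..2*pi}"
    by (intro integrable_continuous_real) (rule continuous_on_subset, auto)
  from nn_integral_has_integral_lebesgue'[OF _ integrable_integral[OF this]]
  have "(\<integral>\<^sup>+t. ennreal (norm (f (cis t * z)) powr p) * indicator {0..2 * pi} t \<partial>lborel)
      = ennreal (integral {0..2*pi} (F \<circ> (+) a))"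
    unfolding eq by (auto simp: F_def)
  also have "integral {0..2*pi} (F \<circ> (+) a) = integral {a..a + 2*pi} F"
    by (simp add: integral_shift_Icc_real add.commute)
  also have "\<dots> = integral {0..2*pi} F"
    using a by (intro integral_periodic_shift[OF F]) (auto simp: F_def cis_mult[symmetric])
  finally show ?thesis
    by (simp add: circle_mean_def F_def)
qed

text \<open>By Tonelli and rotation invariance, averaging over rotations replaces an integrand by a
  radial one without changing its integral, apart from the length 2 pi of the interval of
  angles.\<close>

lemma nn_integral_rotation_average:
  fixes H :: "complex \<Rightarrow> ennreal"
  assumes H[measurable]: "H \<in> borel_measurable borel"
  shows "(\<integral>\<^sup>+z. (\<integral>\<^sup>+t. H (cis t * z) * indicator {0..2 * pi} t \<partial>lborel) \<partial>lborel)
       = ennreal (2 * pi) * (\<integral>\<^sup>+z. H z \<partial>lborel)"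
proof -
  have [measurable]: "(\<lambda>x. cis (fst x) * snd x) \<in> borel_measurable (lborel \<Otimes>\<^sub>M (lborel :: complex measure))"
    unfolding lborel_prod by (auto intro!: borel_measurable_continuous_onI continuous_intros)
  have m: "(\<lambda>x. H (cis (fst x) * snd x) * indicator {0..2 * pi} (fst x))
      \<in> borel_measurable (lborel \<Otimes>\<^sub>M (lborel :: complex measure))"
    by measurable
  have [measurable]: "(\<lambda>z. cis t * z) \<in> borel_measurable borel" for t
    by (intro borel_measurable_continuous_onI continuous_intros)
  have "(\<integral>\<^sup>+z. (\<integral>\<^sup>+t. H (cis t * z) * indicator {0..2 * pi} t \<partial>lborel) \<partial>lborel)
      = (\<integral>\<^sup>+t. (\<integral>\<^sup>+z. H (cis t * z) * indicator {0..2 * pi} t \<partial>lborel) \<partial>lborel)"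
    using lborel_pair.Fubini'[of "\<lambda>t z. H (cis t * z) * indicator {0..2 * pi} t"] m
    by (simp add: case_prod_unfold)
  also have "\<dots> = (\<integral>\<^sup>+t. (\<integral>\<^sup>+z. H z \<partial>lborel) * indicator {0..2 * pi} t \<partial>lborel)"
    by (simp add: nn_integral_multc nn_integral_lborel_rotation)
  also have "\<dots> = ennreal (2 * pi) * (\<integral>\<^sup>+z. H z \<partial>lborel)"
    by (subst nn_integral_cmult) (simp_all add: mult.commute)
  finally show ?thesis .
qed

lemma borel_measurable_norm_powr_on_ball:
  fixes f :: "complex \<Rightarrow> complex"
  assumes f: "continuous_on (ball 0 R) f" and p: "0 < p"
  shows "(\<lambda>z. ennreal (norm (f z) powr p) * indicator (ball 0 R) z) \<in> borel_measurable borel"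
proof -
  have "(\<lambda>z. indicator (ball 0 R) z *\<^sub>R (norm (f z) powr p)) \<in> borel_measurable borel"
    by (intro borel_measurable_continuous_on_indicator continuous_on_norm_powr f p) auto
  then have "(\<lambda>z. ennreal (indicator (ball 0 R) z *\<^sub>R (norm (f z) powr p))) \<in> borel_measurable borel"
    by measurable
  also have "(\<lambda>z. ennreal (indicator (ball 0 R) z *\<^sub>R (norm (f z) powr p)))
      = (\<lambda>z. ennreal (norm (f z) powr p) * indicator (ball 0 R) z)"
    by (auto simp: indicator_def)
  finally show ?thesis .
qed

lemma borel_measurable_circle_mean:
  assumes f: "continuous_on (ball 0 R) f" and p: "0 < p"
  shows "(\<lambda>r. ennreal (circle_mean p f r) * indicator {0..<R} r) \<in> borel_measurable borel"
proof -
  define H where "H = (\<lambda>z. ennreal (norm (f z) powr p) * indicator (ball 0 R) z)"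
  have H[measurable]: "H \<in> borel_measurable borel"
    unfolding H_def by (rule borel_measurable_norm_powr_on_ball[OF f p])
  have [measurable]: "(\<lambda>x. complex_of_real (fst x) * cis (snd x)) \<in> borel_measurable (borel \<Otimes>\<^sub>M lborel)"
  proof -
    have "(\<lambda>x::real\<times>real. complex_of_real (fst x) * cis (snd x)) \<in> borel_measurable borel"
      by (intro borel_measurable_continuous_onI continuous_intros)
    moreover have "sets (borel \<Otimes>\<^sub>M lborel) = sets (borel :: (real\<times>real) measure)"
      by (simp add: borel_prod[symmetric] cong: sets_pair_measure_cong)
    ultimately show ?thesis by (simp cong: measurable_cong_sets)
  qed
  have "(\<lambda>r. ennreal (1 / (2*pi)) * (\<integral>\<^sup>+t. H (of_real r * cis t) * indicator {0..2 * pi} t \<partial>lborel) * indicator {0..<R} r)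
      \<in> borel_measurable borel"
    by measurable
  also have "(\<lambda>r. ennreal (1 / (2*pi)) * (\<integral>\<^sup>+t. H (of_real r * cis t) * indicator {0..2 * pi} t \<partial>lborel) * indicator {0..<R} r)
      = (\<lambda>r. ennreal (circle_mean p f r) * indicator {0..<R} r)"
  proof
    fix r :: real
    show "ennreal (1 / (2*pi)) * (\<integral>\<^sup>+t. H (of_real r * cis t) * indicator {0..2 * pi} t \<partial>lborel) * indicator {0..<R} r
      = ennreal (circle_mean p f r) * indicator {0..<R} r"
    proof (cases "r \<in> {0..<R}")
      case True
      then have "H (of_real r * cis t) = ennreal (norm (f (of_real r * cis t)) powr p)" for t
        by (simp add: H_def norm_mult)
      then show ?thesis
        using nn_integral_circle_mean[OF f _ p, of r] True
        by (simp add: ennreal_mult[symmetric] circle_mean_nonneg)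
    qed simp
  qed
  finally show ?thesis .
qed

text \<open>The rotation average of the integrand is a function of |z| alone, namely 2 pi times the
  circle mean times \<open>\<Phi>\<close>, and the formula for radial functions applies to
  it.\<close>

theorem nn_integral_ball_polar:
  assumes f: "continuous_on (ball 0 R) f" and p: "0 < p" and R: "0 < R"
    and \<Phi>[measurable]: "\<Phi> \<in> borel_measurable borel"
  shows "(\<integral>\<^sup>+z. ennreal (norm (f z) powr p) * \<Phi> (norm z) * indicator (ball 0 R) z \<partial>lborel)
       = (\<integral>\<^sup>+r. ennreal (circle_mean p f r) * \<Phi> r * ennreal (2 * pi * r) * indicator {0..<R} r \<partial>lborel)"
proof -
  have fm[measurable]: "(\<lambda>z. ennreal (norm (f z) powr p) * indicator (ball 0 R) z) \<in> borel_measurable borel"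
    by (rule borel_measurable_norm_powr_on_ball[OF f p])
  have cm[measurable]: "(\<lambda>r. ennreal (circle_mean p f r) * indicator {0..<R} r) \<in> borel_measurable borel"
    by (rule borel_measurable_circle_mean[OF f p])
  define H where "H = (\<lambda>z. (ennreal (norm (f z) powr p) * indicator (ball 0 R) z) * \<Phi> (norm z))"
  define F where "F = (\<lambda>r. (ennreal (circle_mean p f r) * indicator {0..<R} r) * \<Phi> r)"
  have H[measurable]: "H \<in> borel_measurable borel" and F[measurable]: "F \<in> borel_measurable borel"
    unfolding H_def F_def by measurable
  have "(\<integral>\<^sup>+t. H (cis t * z) * indicator {0..2 * pi} t \<partial>lborel)
      = ennreal (2 * pi) * (F (norm z) * indicator (ball 0 R) z)" for z
  proof (cases "norm z < R")
    case True
    have "(\<integral>\<^sup>+t. H (cis t * z) * indicator {0..2 * pi} t \<partial>lborel)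
        = (\<integral>\<^sup>+t. \<Phi> (norm z) * (ennreal (norm (f (cis t * z)) powr p) * indicator {0..2 * pi} t) \<partial>lborel)"
      using True by (intro nn_integral_cong) (simp add: H_def norm_mult mult_ac)
    also have "\<dots> = \<Phi> (norm z) * ennreal (2 * pi * circle_mean p f (norm z))"
    proof (subst nn_integral_cmult)
      have "continuous_on UNIV (\<lambda>t. norm (f (cis t * z)) powr p)"
        using True p
        by (intro continuous_on_norm_powr continuous_on_compose2[OF f] continuous_intros)
           (auto simp: norm_mult)
      then have "(\<lambda>t. norm (f (cis t * z)) powr p) \<in> borel_measurable borel"
        by (rule borel_measurable_continuous_onI)
      then show "(\<lambda>t. ennreal (norm (f (cis t * z)) powr p) * indicator {0..2 * pi} t) \<in> borel_measurable lborel"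
        by measurable
    qed (simp add: nn_integral_circle_mean_rotated[OF f True p])
    finally show ?thesis
      using True by (simp add: F_def ennreal_mult circle_mean_nonneg mult_ac)
  next
    case False
    then show ?thesis by (simp add: H_def norm_mult)
  qed
  moreover have "(\<lambda>z. F (norm z) * indicator (ball (0::complex) R) z) \<in> borel_measurable lborel"
  proof -
    have [measurable]: "ball (0::complex) R \<in> sets borel" by simp
    show ?thesis by measurable
  qed
  ultimately have "ennreal (2 * pi) * (\<integral>\<^sup>+z. H z \<partial>lborel)
      = ennreal (2 * pi) * (\<integral>\<^sup>+z. F (norm z) * indicator (ball 0 R) z \<partial>(lborel :: complex measure))"
    by (simp add: nn_integral_rotation_average[symmetric] nn_integral_cmult)
  then have "(\<integral>\<^sup>+z. H z \<partial>lborel)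
      = (\<integral>\<^sup>+z. F (norm z) * indicator (ball 0 R) z \<partial>(lborel :: complex measure))"
    by (subst (asm) ennreal_mult_cancel_left) (auto simp: pi_gt_zero)
  also have "\<dots> = (\<integral>\<^sup>+r. F r * ennreal (2 * pi * r) * indicator {0..<R} r \<partial>lborel)"
    using R by (intro nn_integral_lborel_radial) auto
  also have "\<dots> = (\<integral>\<^sup>+r. ennreal (circle_mean p f r) * \<Phi> r * ennreal (2 * pi * r) * indicator {0..<R} r \<partial>lborel)"
    by (intro nn_integral_cong) (auto simp: F_def indicator_def mult_ac)
  finally show ?thesis
    by (simp add: H_def mult_ac)
qed

section \<open>Sub-mean value property and averages of suprema\<close>

lemma nn_integral_lborel_translation:
  fixes H :: "'a::euclidean_space \<Rightarrow> ennreal"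
  assumes [measurable]: "H \<in> borel_measurable borel"
  shows "(\<integral>\<^sup>+z. H (a + z) \<partial>lborel) = (\<integral>\<^sup>+z. H z \<partial>lborel)"
  by (subst (2) lborel_distr_plus[symmetric, of a]) (simp add: nn_integral_distr)

text \<open>Circle means around \<open>a\<close> increase from |f(a)|^p at radius 0; integrate them
  against 2 pi r dr.\<close>

lemma norm_powr_sub_mean_value:
  assumes f: "f holomorphic_on ball a \<rho>" and p: "0 < p" and \<rho>: "0 < \<rho>"
  shows "ennreal (pi * \<rho>\<^sup>2 * norm (f a) powr p)
     \<le> (\<integral>\<^sup>+z. ennreal (norm (f z) powr p) * indicator (ball a \<rho>) z \<partial>lborel)"
proof -
  define g where "g = (\<lambda>z. f (a + z))"
  have g: "g holomorphic_on ball 0 \<rho>"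
    unfolding g_def
    by (intro holomorphic_on_compose_gen[OF _ f, unfolded o_def] holomorphic_intros) (auto simp: dist_norm)
  have contg: "continuous_on (ball 0 \<rho>) g" by (rule holomorphic_on_imp_continuous_on[OF g])
  have "ennreal (pi * \<rho>\<^sup>2 * norm (f a) powr p) = ennreal (norm (f a) powr p) * ennreal (pi * \<rho>\<^sup>2)"
    by (simp add: ennreal_mult[symmetric] mult.commute)
  also have "ennreal (pi * \<rho>\<^sup>2) = (\<integral>\<^sup>+r. ennreal (2 * pi * r) * indicator {0..\<rho>} r \<partial>lborel)"
    by (subst nn_integral_FTC_Icc[where F = "\<lambda>r. pi * r\<^sup>2"])
       (use \<rho> in \<open>auto intro!: derivative_eq_intros\<close>)
  also have "\<dots> = (\<integral>\<^sup>+r. ennreal (2 * pi * r) * indicator {0..<\<rho>} r \<partial>lborel)"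
    by (intro nn_integral_cong_AE eventually_mono[OF AE_lborel_singleton[of \<rho>]]) (auto simp: indicator_def)
  also have "ennreal (norm (f a) powr p) * (\<integral>\<^sup>+r. ennreal (2 * pi * r) * indicator {0..<\<rho>} r \<partial>lborel)
      = (\<integral>\<^sup>+r. ennreal (norm (f a) powr p) * (ennreal (2 * pi * r) * indicator {0..<\<rho>} r) \<partial>lborel)"
    by (rule nn_integral_cmult[symmetric]) measurable
  also have "\<dots> \<le> (\<integral>\<^sup>+r. ennreal (circle_mean p g r) * 1 * ennreal (2 * pi * r) * indicator {0..<\<rho>} r \<partial>lborel)"
  proof (intro nn_integral_mono)
    fix r :: real
    have "norm (f a) powr p \<le> circle_mean p g r" if "r \<in> {0..<\<rho>}"
      using circle_mean_mono[OF g p, of 0 r] that by (auto simp: circle_mean_0 g_def)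
    then show "ennreal (norm (f a) powr p) * (ennreal (2 * pi * r) * indicator {0..<\<rho>} r)
        \<le> ennreal (circle_mean p g r) * 1 * ennreal (2 * pi * r) * indicator {0..<\<rho>} r"
      by (auto simp: indicator_def intro!: mult_right_mono ennreal_leI)
  qed
  also have "\<dots> = (\<integral>\<^sup>+z. ennreal (norm (g z) powr p) * 1 * indicator (ball 0 \<rho>) z \<partial>lborel)"
    using nn_integral_ball_polar[OF contg p \<rho>, of "\<lambda>_. 1"] by simp
  also have "\<dots> = (\<integral>\<^sup>+z. ennreal (norm (f (a + z)) powr p) * indicator (ball a \<rho>) (a + z) \<partial>lborel)"
    by (intro nn_integral_cong) (auto simp: g_def indicator_def dist_norm)
  also have "\<dots> = (\<integral>\<^sup>+z. ennreal (norm (f z) powr p) * indicator (ball a \<rho>) z \<partial>lborel)"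
  proof (rule nn_integral_lborel_translation)
    have m: "(\<lambda>z. ennreal (norm (g z) powr p) * indicator (ball 0 \<rho>) z) \<in> borel_measurable borel"
      by (rule borel_measurable_norm_powr_on_ball[OF contg p])
    have "(\<lambda>z. ennreal (norm (g (z - a)) powr p) * indicator (ball 0 \<rho>) (z - a)) \<in> borel_measurable borel"
      by (rule measurable_compose[OF _ m]) simp
    then show "(\<lambda>z. ennreal (norm (f z) powr p) * indicator (ball a \<rho>) z) \<in> borel_measurable borel"
      by (simp add: g_def indicator_def dist_norm norm_minus_commute)
  qed
  finally show ?thesis .
qed

text \<open>Bound each supremum by an area mean over a slightly larger disc and integrate over the rotation
  angle.\<close>

theorem nn_integral_circle_sup_le:
  assumes f: "f holomorphic_on ball 0 R'" and p: "0 < p"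
    and \<rho>: "0 < \<rho>" and \<sigma>: "0 \<le> \<sigma>" and R: "0 \<le> R" "R + \<rho> < R'"
    and h: "\<And>t. 0 \<le> t \<Longrightarrow> t \<le> 2 * pi \<Longrightarrow>
      \<exists>w\<in>cball c \<sigma>. norm w \<le> R \<and> h t \<le> norm (f (cis t * w)) powr p"
  shows "(\<integral>\<^sup>+t. ennreal (h t) * indicator {0..2 * pi} t \<partial>lborel)
     \<le> ennreal (2 * pi * (((\<sigma> + \<rho>) / \<rho>)\<^sup>2 * circle_mean p f (R + \<rho>)))"
proof -
  have contf: "continuous_on (ball 0 R') f" by (rule holomorphic_on_imp_continuous_on[OF f])
  define H where "H = (\<lambda>z. ennreal (norm (f z) powr p) * indicator (ball 0 R') z)"
  have H[measurable]: "H \<in> borel_measurable borel"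
    unfolding H_def by (rule borel_measurable_norm_powr_on_ball[OF contf p])
  \<comment> \<open>Rotating by -t moves the disc of radius \<open>\<rho>\<close> about
    \<open>cis t * w\<close> to the disc about \<open>w\<close>, which lies in \<open>B\<close> for
    every t. The area of the first ball yields the quotient ((\<sigma> + \<rho>) / \<rho>)^2, and
    the second ball bounds the radii by \<open>R + \<rho>\<close>.\<close>
  define B where "B = ball c (\<sigma> + \<rho>) \<inter> ball 0 (R + \<rho>)"
  have B[measurable]: "B \<in> sets borel" by (simp add: B_def)
  define k where "k = pi * \<rho>\<^sup>2"
  have k: "0 < k" using \<rho> by (simp add: k_def)
  have [measurable]: "(\<lambda>x. cis (snd x) * fst x) \<in> borel_measurable ((lborel :: complex measure) \<Otimes>\<^sub>M lborel)"
      "(\<lambda>x. cis (fst x) * snd x) \<in> borel_measurable (lborel \<Otimes>\<^sub>M (lborel :: complex measure))"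
    unfolding lborel_prod by (auto intro!: borel_measurable_continuous_onI continuous_intros)
  have [measurable]: "(\<lambda>z. cis t * z) \<in> borel_measurable borel" for t
    by (intro borel_measurable_continuous_onI continuous_intros)
  have step: "ennreal k * ennreal (h t) \<le> (\<integral>\<^sup>+z. H (cis t * z) * indicator B z \<partial>lborel)"
    if t: "0 \<le> t" "t \<le> 2 * pi" for t
  proof -
    obtain w where w: "w \<in> cball c \<sigma>" "norm w \<le> R" "h t \<le> norm (f (cis t * w)) powr p"
      using h[OF t] by blast
    have sub: "ball (cis t * w) \<rho> \<subseteq> ball 0 R'"
    proof
      fix z assume "z \<in> ball (cis t * w) \<rho>"
      then have "norm (z - cis t * w) < \<rho>" by (simp add: dist_norm norm_minus_commute)
      moreover have "norm z \<le> norm (z - cis t * w) + norm (cis t * w)"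
        by (metis diff_add_cancel norm_triangle_ineq)
      ultimately show "z \<in> ball 0 R'" using w R by (simp add: norm_mult)
    qed
    have "ennreal k * ennreal (h t) \<le> ennreal (pi * \<rho>\<^sup>2 * norm (f (cis t * w)) powr p)"
      using w k by (simp add: ennreal_mult k_def mult_left_mono ennreal_leI)
    also have "\<dots> \<le> (\<integral>\<^sup>+z. ennreal (norm (f z) powr p) * indicator (ball (cis t * w) \<rho>) z \<partial>lborel)"
      by (intro norm_powr_sub_mean_value holomorphic_on_subset[OF f] sub p \<rho>)
    also have "\<dots> = (\<integral>\<^sup>+z. H z * indicator (ball (cis t * w) \<rho>) z \<partial>lborel)"
      using sub by (intro nn_integral_cong) (auto simp: H_def indicator_def)
    also have "\<dots> = (\<integral>\<^sup>+z. H (cis t * z) * indicator (ball (cis t * w) \<rho>) (cis t * z) \<partial>lborel)"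
    proof -
      have [measurable]: "ball (cis t * w) \<rho> \<in> sets borel" by simp
      have "(\<lambda>z. H z * indicator (ball (cis t * w) \<rho>) z) \<in> borel_measurable borel"
        by measurable
      then show ?thesis
        by (subst nn_integral_lborel_rotation[symmetric, of _ "cis t"]) simp_all
    qed
    also have "\<dots> \<le> (\<integral>\<^sup>+z. H (cis t * z) * indicator B z \<partial>lborel)"
    proof (intro nn_integral_mono mult_left_mono)
      fix z
      have "z \<in> B" if "cis t * z \<in> ball (cis t * w) \<rho>"
      proof -
        have "dist (cis t * w) (cis t * z) = dist w z"
          by (simp add: dist_norm right_diff_distrib[symmetric] norm_mult)
        with that have d: "dist w z < \<rho>" by simp
        have "dist c z \<le> dist c w + dist w z" by (rule dist_triangle)
        moreover have "norm z \<le> norm w + dist w z"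
          by (metis dist_norm dist_commute norm_triangle_sub)
        ultimately show ?thesis using d w by (auto simp: B_def)
      qed
      then show "indicator (ball (cis t * w) \<rho>) (cis t * z) \<le> (indicator B z :: ennreal)"
        by (auto simp: indicator_def)
    qed simp
    finally show ?thesis .
  qed
  define M where "M = circle_mean p f (R + \<rho>)"
  have M: "0 \<le> M" by (simp add: M_def circle_mean_nonneg)
  have "(\<integral>\<^sup>+t. ennreal (h t) * indicator {0..2 * pi} t \<partial>lborel)
      \<le> (\<integral>\<^sup>+t. ennreal (1 / k) * (\<integral>\<^sup>+z. H (cis t * z) * indicator B z * indicator {0..2*pi} t \<partial>lborel) \<partial>lborel)"
  proof (intro nn_integral_mono)
    fix t :: real
    have "ennreal (h t) = ennreal (1 / k) * (ennreal k * ennreal (h t))"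
      using k by (simp add: mult.assoc[symmetric] ennreal_mult[symmetric])
    also have "\<dots> \<le> ennreal (1 / k) * (\<integral>\<^sup>+z. H (cis t * z) * indicator B z \<partial>lborel)"
      if "t \<in> {0..2*pi}"
      using step[of t] that by (intro mult_left_mono) auto
    finally show "ennreal (h t) * indicator {0..2 * pi} t
        \<le> ennreal (1 / k) * (\<integral>\<^sup>+z. H (cis t * z) * indicator B z * indicator {0..2*pi} t \<partial>lborel)"
      by (cases "t \<in> {0..2*pi}") auto
  qed
  also have "\<dots> = ennreal (1 / k) * (\<integral>\<^sup>+t. (\<integral>\<^sup>+z. H (cis t * z) * indicator B z * indicator {0..2*pi} t \<partial>lborel) \<partial>lborel)"
    by (intro nn_integral_cmult) measurable
  also have "(\<integral>\<^sup>+t. (\<integral>\<^sup>+z. H (cis t * z) * indicator B z * indicator {0..2*pi} t \<partial>lborel) \<partial>lborel)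
      = (\<integral>\<^sup>+z. (\<integral>\<^sup>+t. H (cis t * z) * indicator B z * indicator {0..2*pi} t \<partial>lborel) \<partial>lborel)"
  proof -
    have "(\<lambda>x. H (cis (fst x) * snd x) * indicator B (snd x) * indicator {0..2*pi} (fst x))
        \<in> borel_measurable (lborel \<Otimes>\<^sub>M (lborel :: complex measure))"
      by measurable
    then show ?thesis
      using lborel_pair.Fubini'[of "\<lambda>t z. H (cis t * z) * indicator B z * indicator {0..2 * pi} t"]
      by (simp add: case_prod_unfold)
  qed
  \<comment> \<open>For fixed z in \<open>B\<close> the integral over t is 2 pi times the circle
    mean at radius |z| <= R + \<rho>, so monotonicity replaces it by the single value
    \<open>M\<close>.\<close>
  also have "\<dots> \<le> (\<integral>\<^sup>+z. ennreal (2 * pi * M) * indicator (ball c (\<sigma> + \<rho>)) z \<partial>lborel)"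
  proof (intro nn_integral_mono)
    fix z :: complex
    show "(\<integral>\<^sup>+t. H (cis t * z) * indicator B z * indicator {0..2*pi} t \<partial>lborel)
        \<le> ennreal (2 * pi * M) * indicator (ball c (\<sigma> + \<rho>)) z"
    proof (cases "z \<in> B")
      case True
      then have z: "norm z < R'" "z \<in> ball c (\<sigma> + \<rho>)" "norm z \<le> R + \<rho>"
        using R by (auto simp: B_def)
      have "(\<integral>\<^sup>+t. H (cis t * z) * indicator B z * indicator {0..2*pi} t \<partial>lborel)
          = (\<integral>\<^sup>+t. ennreal (norm (f (cis t * z)) powr p) * indicator {0..2*pi} t \<partial>lborel)"
        using True z by (intro nn_integral_cong) (simp add: H_def norm_mult)
      also have "\<dots> = ennreal (2 * pi * circle_mean p f (norm z))"
        by (rule nn_integral_circle_mean_rotated[OF contf z(1) p])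
      also have "\<dots> \<le> ennreal (2 * pi * M)"
        unfolding M_def using circle_mean_mono[OF f p _ z(3) R(2)]
        by (intro ennreal_leI mult_left_mono) auto
      finally show ?thesis using z by simp
    qed simp
  qed
  also have "\<dots> = ennreal (2 * pi * M) * ennreal (pi * (\<sigma> + \<rho>)\<^sup>2)"
    using \<rho> \<sigma> by (subst nn_integral_cmult_indicator) (simp_all add: emeasure_ball unit_ball_vol_2)
  also have "ennreal (1 / k) * (ennreal (2 * pi * M) * ennreal (pi * (\<sigma> + \<rho>)\<^sup>2))
      = ennreal ((1 / k) * ((2 * pi * M) * (pi * (\<sigma> + \<rho>)\<^sup>2)))"
    using k M by (simp add: ennreal_mult[symmetric])
  also have "(1 / k) * ((2 * pi * M) * (pi * (\<sigma> + \<rho>)\<^sup>2)) = 2 * pi * (((\<sigma> + \<rho>) / \<rho>)\<^sup>2 * M)"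
    using \<rho> by (simp add: k_def power_divide)
  finally show ?thesis
    by (simp add: M_def mult_left_mono)
qed

section \<open>The measure of a radial weight\<close>


text \<open>A null set of radii has a null preimage in the disc, by the formula for radial functions
  applied to its indicator.\<close>

lemma AE_lborel_norm_ball:
  fixes P :: "real \<Rightarrow> bool"
  assumes "AE r in lborel. P r" and R: "0 \<le> R"
  shows "AE z in (lborel :: complex measure). z \<in> ball 0 R \<longrightarrow> P (norm z)"
proof -
  obtain N where N: "\<And>r. r \<in> space lborel - N \<Longrightarrow> P r" "N \<in> null_sets lborel"
    using AE_E3[OF assms(1)] by blast
  have [measurable]: "N \<in> sets borel" using N(2) by auto
  have [measurable]: "ball (0::complex) R \<in> sets borel" by simp
  have "(\<integral>\<^sup>+z. indicator N (norm z) * indicator (ball 0 R) z \<partial>(lborel :: complex measure))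
      = (\<integral>\<^sup>+r. indicator N r * ennreal (2 * pi * r) * indicator {0..<R} r \<partial>lborel)"
    by (rule nn_integral_lborel_radial) (use R in auto)
  also have "\<dots> = 0"
  proof -
    have "AE r in lborel. r \<notin> N" using N(2) by (rule AE_not_in)
    then have "(\<integral>\<^sup>+r. indicator N r * ennreal (2 * pi * r) * indicator {0..<R} r \<partial>lborel) = nn_integral (lborel :: real measure) (\<lambda>_. 0)"
      by (intro nn_integral_cong_AE) (auto elim: eventually_mono)
    then show ?thesis by simp
  qed
  finally have "AE z in (lborel :: complex measure). indicator N (norm z) * indicator (ball 0 R) z = (0::ennreal)"
    by (subst (asm) nn_integral_0_iff_AE) auto
  then show ?thesis
    by eventually_elim (use N in \<open>auto simp: indicator_def split: if_splits\<close>)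
qed

lemma nn_integral_disc_area:
  assumes "f \<in> borel_measurable disc_area"
  shows "(\<integral>\<^sup>+z. f z \<partial>disc_area) = ennreal (1 / pi) * (\<integral>\<^sup>+z. f z * indicator (ball 0 1) z \<partial>lborel)"
proof -
  have "(\<integral>\<^sup>+z. f z \<partial>disc_area) = ennreal (1 / pi) * (\<integral>\<^sup>+z. f z \<partial>(lebesgue_on (ball 0 1)))"
    using assms unfolding disc_area_def by (subst nn_integral_scale_measure) simp_all
  also have "(\<integral>\<^sup>+z. f z \<partial>(lebesgue_on (ball 0 1))) = (\<integral>\<^sup>+z. f z * indicator (ball 0 1) z \<partial>lebesgue)"
    by (subst nn_integral_restrict_space) auto
  finally show ?thesis by (simp add: nn_integral_completion)
qed

text \<open>Only the measure \<open>\<omega>(r) dr\<close> matters, and the profile \<open>\<omega>\<close>, which is merely Lebesgue measurable,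
  is replaced by a Borel representative.\<close>

theorem radial_weight_measure:
  assumes \<omega>: "radial_weight \<omega>"
  obtains \<mu> :: "real measure" where "finite_measure \<mu>" "sets \<mu> = sets borel"
    "AE r in \<mu>. 0 \<le> r \<and> r < 1"
    "\<And>r. 0 \<le> r \<Longrightarrow> weight_tail \<omega> (of_real r) = measure \<mu> {r..<1}"
    "\<And>g p \<gamma>. continuous_on (ball 0 1) g \<Longrightarrow> 0 < p \<Longrightarrow>
      (\<integral>\<^sup>+z. ennreal (norm (g z) powr p * (1 - norm z) powr \<gamma> * \<omega> (norm z)) \<partial>disc_area)
      = (\<integral>\<^sup>+r. ennreal (circle_mean p g r * (1 - r) powr \<gamma> * (2 * r)) \<partial>\<mu>)"
proof -
  \<comment> \<open>The profile is arbitrary outside [0, 1); cutting it off makes it integrable on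
    the whole line.\<close>
  define w where "w = (\<lambda>r. indicator {0..<1} r *\<^sub>R \<omega> r)"
  have w0: "0 \<le> w r" for r
    using \<omega> by (auto simp: w_def radial_weight_def indicator_def)
  have int: "integrable lebesgue w"
    using \<omega> by (simp add: radial_weight_def set_integrable_def w_def)
  have "(\<lambda>r. ennreal (w r)) \<in> borel_measurable (completion lborel)"
    using int by measurable
  from completion_ex_borel_measurable[OF this]
  obtain W where W[measurable]: "W \<in> borel_measurable borel" and AE_W: "AE r in lborel. ennreal (w r) = W r"
    by auto
  \<comment> \<open>\<open>W\<close> equals \<open>w\<close> only almost everywhere, so the
    indicator is applied once more to keep the measure on [0, 1).\<close>
  define \<mu> where "\<mu> = density lborel (\<lambda>r. W r * indicator {0..<1} r)"
  have sets: "sets \<mu> = sets borel" by (simp add: \<mu>_def)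
  have em: "emeasure \<mu> A = (\<integral>\<^sup>+r. ennreal (w r * indicator A r) \<partial>lebesgue)" if "A \<in> sets borel" for A
  proof -
    have "emeasure \<mu> A = (\<integral>\<^sup>+r. W r * indicator {0..<1} r * indicator A r \<partial>lborel)"
      unfolding \<mu>_def using that by (subst emeasure_density) auto
    also have "\<dots> = (\<integral>\<^sup>+r. ennreal (w r * indicator A r) \<partial>lborel)"
      by (intro nn_integral_cong_AE, use AE_W in eventually_elim) (auto simp: w_def indicator_def)
    finally show ?thesis by (simp add: nn_integral_completion)
  qed
  have fin: "finite_measure \<mu>"
  proof
    have "emeasure \<mu> (space \<mu>) = (\<integral>\<^sup>+r. ennreal (w r) \<partial>lebesgue)"
      using em[of UNIV] by (simp add: \<mu>_def)
    also have "\<dots> = ennreal (integral\<^sup>L lebesgue w)"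
      using int w0 by (intro nn_integral_eq_integral) auto
    finally show "emeasure \<mu> (space \<mu>) \<noteq> \<infinity>" by simp
  qed
  show thesis
  proof (rule that[OF fin sets])
    show "AE r in \<mu>. 0 \<le> r \<and> r < 1"
      unfolding \<mu>_def by (subst AE_density) (auto simp: indicator_def)
  next
    fix r :: real assume r: "0 \<le> r"
    have "emeasure \<mu> {r..<1} = (\<integral>\<^sup>+s. ennreal (indicator {r..<1} s *\<^sub>R \<omega> s) \<partial>lebesgue)"
      using r by (subst em) (auto intro!: nn_integral_cong simp: w_def indicator_def)
    also have "\<dots> = ennreal (LINT s:{r..<1}|lebesgue. \<omega> s)"
      unfolding set_lebesgue_integral_def
    proof (rule nn_integral_eq_integral)
      have "set_integrable lebesgue {0..<1} \<omega>" using \<omega> by (simp add: radial_weight_def)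
      then have "set_integrable lebesgue {r..<1} \<omega>"
        by (rule set_integrable_subset) (use r in auto)
      then show "integrable lebesgue (\<lambda>s. indicator {r..<1} s *\<^sub>R \<omega> s)"
        by (simp add: set_integrable_def)
      show "AE s in lebesgue. 0 \<le> indicator {r..<1} s *\<^sub>R \<omega> s"
        using \<omega> r by (auto simp: radial_weight_def indicator_def)
    qed
    finally have "measure \<mu> {r..<1} = (LINT s:{r..<1}|lebesgue. \<omega> s)"
    proof (rule measure_eq_emeasure_eq_ennreal[rotated])
      show "0 \<le> (LINT s:{r..<1}|lebesgue. \<omega> s)"
        unfolding set_lebesgue_integral_def
        using \<omega> r by (intro Bochner_Integration.integral_nonneg) (auto simp: radial_weight_def indicator_def)
    qed
    then show "weight_tail \<omega> (of_real r) = measure \<mu> {r..<1}"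
      using r by (simp add: weight_tail_def)
  next
    fix g :: "complex \<Rightarrow> complex" and p \<gamma> :: real
    assume g: "continuous_on (ball 0 1) g" and p: "0 < p"
    define \<Phi> where "\<Phi> = (\<lambda>r. ennreal ((1 - r) powr \<gamma>) * W r)"
    have \<Phi>[measurable]: "\<Phi> \<in> borel_measurable borel" unfolding \<Phi>_def by measurable
    define G where "G = (\<lambda>z. ennreal (norm (g z) powr p) * indicator (ball 0 1) z * \<Phi> (norm z))"
    have [measurable]: "(\<lambda>z. ennreal (norm (g z) powr p) * indicator (ball 0 1) z) \<in> borel_measurable borel"
      by (rule borel_measurable_norm_powr_on_ball[OF g p])
    have G[measurable]: "G \<in> borel_measurable borel" unfolding G_def by measurable
    have G': "G \<in> borel_measurable disc_area"
    proof -
      have "G \<in> borel_measurable (lebesgue_on (ball 0 1))"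
        using measurable_completion[of G lborel borel] by (intro measurable_restrict_space1) simp
      then show ?thesis by (simp add: disc_area_def cong: measurable_cong_sets)
    qed
    have "AE z in (lborel :: complex measure). z \<in> ball 0 1 \<longrightarrow> ennreal (w (norm z)) = W (norm z)"
      by (rule AE_lborel_norm_ball[OF AE_W]) simp
    then have "AE z in lebesgue. z \<in> ball 0 1 \<longrightarrow> ennreal (w (norm (z::complex))) = W (norm z)"
      by (rule AE_completion)
    then have "AE z in lebesgue_on (ball 0 1). ennreal (w (norm (z::complex))) = W (norm z)"
      by (subst AE_restrict_space_iff) auto
    then have "AE z in disc_area. ennreal (w (norm z)) = W (norm z)"
    proof (elim AE_E)
      fix N assume N: "{z \<in> space (lebesgue_on (ball (0::complex) 1)). ennreal (w (norm z)) \<noteq> W (norm z)} \<subseteq> N"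
        "emeasure (lebesgue_on (ball 0 1)) N = 0" "N \<in> sets (lebesgue_on (ball 0 1))"
      show ?thesis
        by (rule AE_I'[of N]) (use N in \<open>auto simp: null_sets_def disc_area_def space_scale_measure\<close>)
    qed
    moreover have "AE z in disc_area. z \<in> ball 0 1"
      by (rule AE_I2) (auto simp: disc_area_def space_restrict_space space_scale_measure)
    ultimately have "AE z in disc_area. ennreal (norm (g z) powr p * (1 - norm z) powr \<gamma> * \<omega> (norm z)) = G z"
    proof eventually_elim
      case (elim z)
      then have "w (norm z) = \<omega> (norm z)" by (simp add: w_def)
      with elim w0[of "norm z"] show ?case
        by (simp add: G_def \<Phi>_def ennreal_mult mult_ac flip: elim(1))
    qed
    then have "(\<integral>\<^sup>+z. ennreal (norm (g z) powr p * (1 - norm z) powr \<gamma> * \<omega> (norm z)) \<partial>disc_area)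
        = (\<integral>\<^sup>+z. G z \<partial>disc_area)"
      by (rule nn_integral_cong_AE)
    also have "\<dots> = ennreal (1 / pi) * (\<integral>\<^sup>+z. ennreal (norm (g z) powr p) * \<Phi> (norm z) * indicator (ball 0 1) z \<partial>lborel)"
      unfolding nn_integral_disc_area[OF G']
      by (rule arg_cong[where f = "\<lambda>x. _ * x"], rule nn_integral_cong)
         (simp add: G_def indicator_def)
    also have "\<dots> = ennreal (1 / pi) * (\<integral>\<^sup>+r. ennreal (circle_mean p g r) * \<Phi> r * ennreal (2 * pi * r) * indicator {0..<1} r \<partial>lborel)"
      by (subst nn_integral_ball_polar[OF g p]) auto
    also have "\<dots> = (\<integral>\<^sup>+r. ennreal (1 / pi) * (ennreal (circle_mean p g r) * indicator {0..<1} r * \<Phi> r * ennreal (2 * pi * r)) \<partial>lborel)"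
    proof -
      have [measurable]: "(\<lambda>r. ennreal (circle_mean p g r) * indicator {0..<1} r) \<in> borel_measurable borel"
        by (rule borel_measurable_circle_mean[OF g p])
      have "(\<integral>\<^sup>+r. ennreal (circle_mean p g r) * \<Phi> r * ennreal (2 * pi * r) * indicator {0..<1} r \<partial>lborel)
        = (\<integral>\<^sup>+r. ennreal (circle_mean p g r) * indicator {0..<1} r * \<Phi> r * ennreal (2 * pi * r) \<partial>lborel)"
        by (simp add: mult_ac)
      then show ?thesis by (subst nn_integral_cmult) simp_all
    qed
    also have "\<dots> = (\<integral>\<^sup>+r. W r * indicator {0..<1} r *
        (ennreal (circle_mean p g r * (1 - r) powr \<gamma> * (2 * r)) * indicator {0..<1} r) \<partial>lborel)"
    proof (intro nn_integral_cong)
      fix r :: real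
      show "ennreal (1 / pi) * (ennreal (circle_mean p g r) * indicator {0..<1} r * \<Phi> r * ennreal (2 * pi * r))
        = W r * indicator {0..<1} r * (ennreal (circle_mean p g r * (1 - r) powr \<gamma> * (2 * r)) * indicator {0..<1} r)"
      proof (cases "r \<in> {0..<1}")
        case True
        \<comment> \<open>The factor 2 r that remains is the radial density of normalised
          area.\<close>
        have "ennreal (1 / pi) * ennreal (2 * pi * r) = ennreal (2 * r)"
          using True by (subst ennreal_mult[symmetric]) auto
        then have "ennreal (1 / pi) * (ennreal (circle_mean p g r) * \<Phi> r * ennreal (2 * pi * r))
            = ennreal (circle_mean p g r) * \<Phi> r * ennreal (2 * r)"
          by (metis mult.assoc mult.commute)
        then show ?thesis
          using True by (simp add: \<Phi>_def ennreal_mult circle_mean_nonneg mult_ac)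
      qed simp
    qed
    also have "\<dots> = (\<integral>\<^sup>+r. ennreal (circle_mean p g r * (1 - r) powr \<gamma> * (2 * r)) * indicator {0..<1} r \<partial>\<mu>)"
    proof -
      have [measurable]: "(\<lambda>r. ennreal (circle_mean p g r) * indicator {0..<1} r) \<in> borel_measurable borel"
        by (rule borel_measurable_circle_mean[OF g p])
      have "(\<lambda>r. ennreal (circle_mean p g r) * indicator {0..<1} r * ennreal ((1 - r) powr \<gamma>) * ennreal (2 * r)) \<in> borel_measurable borel"
        by measurable
      also have "(\<lambda>r. ennreal (circle_mean p g r) * indicator {0..<1} r * ennreal ((1 - r) powr \<gamma>) * ennreal (2 * r))
          = (\<lambda>r. ennreal (circle_mean p g r * (1 - r) powr \<gamma> * (2 * r)) * indicator {0..<1} r)"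
        by (auto simp: indicator_def ennreal_mult circle_mean_nonneg)
      finally show ?thesis
        unfolding \<mu>_def by (subst nn_integral_density) auto
    qed
    also have "\<dots> = (\<integral>\<^sup>+r. ennreal (circle_mean p g r * (1 - r) powr \<gamma> * (2 * r)) \<partial>\<mu>)"
    proof -
      have ae: "AE r in \<mu>. r \<in> {0..<1}"
        unfolding \<mu>_def by (subst AE_density) (auto simp: indicator_def)
      show ?thesis
        by (rule nn_integral_cong_AE, rule eventually_mono[OF ae]) simp
    qed
    finally show "(\<integral>\<^sup>+z. ennreal (norm (g z) powr p * (1 - norm z) powr \<gamma> * \<omega> (norm z)) \<partial>disc_area)
      = (\<integral>\<^sup>+r. ennreal (circle_mean p g r * (1 - r) powr \<gamma> * (2 * r)) \<partial>\<mu>)" .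
  qed
qed

section \<open>Circle means of a function and of its derivative\<close>


text \<open>Cauchy's inequality on the circle of radius \<open>d\<close> about a point \<xi> of
  modulus \<open>r\<close> bounds d |f'(\<xi>)| by |f| at its largest point on that circle. That
  point, rotated back, lies at distance \<open>d\<close> from \<open>r\<close>, so the average of
  suprema applies with both radii equal to \<open>d\<close>; hence the radius r + 2d and the factor
  (2d/d)^2 = 4.\<close>

lemma circle_mean_deriv_le:
  assumes f: "f holomorphic_on ball 0 R" and p: "0 < p" and r: "0 \<le> r" and d: "0 < d" "r + 2 * d < R"
  shows "d powr p * circle_mean p (deriv f) r \<le> 4 * circle_mean p f (r + 2 * d)"
proof -
  have f': "deriv f holomorphic_on ball 0 R" using f by (rule holomorphic_deriv) simp
  have contf': "continuous_on (ball 0 R) (deriv f)" by (rule holomorphic_on_imp_continuous_on[OF f'])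
  have contf: "continuous_on (ball 0 R) f" by (rule holomorphic_on_imp_continuous_on[OF f])
  define h where "h = (\<lambda>t. d powr p * norm (deriv f (of_real r * cis t)) powr p)"
  have "(\<integral>\<^sup>+t. ennreal (h t) * indicator {0..2 * pi} t \<partial>lborel)
     \<le> ennreal (2 * pi * (((d + d) / d)\<^sup>2 * circle_mean p f ((r + d) + d)))"
  proof (rule nn_integral_circle_sup_le[OF f p, where c = "of_real r"])
    fix t :: real
    define \<xi> where "\<xi> = of_real r * cis t"
    have sub: "cball \<xi> d \<subseteq> ball 0 R"
    proof
      fix z assume "z \<in> cball \<xi> d"
      then have "norm z \<le> norm \<xi> + d"
        using norm_triangle_sub[of z \<xi>] by (auto simp: dist_norm norm_minus_commute)
      then show "z \<in> ball 0 R" using r d by (simp add: \<xi>_def norm_mult)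
    qed
    have "continuous_on (sphere \<xi> d) (\<lambda>z. norm (f z))"
      using sub by (intro continuous_on_norm continuous_on_subset[OF contf]) auto
    moreover have "sphere \<xi> d \<noteq> {}" using d by simp
    ultimately obtain \<zeta> where \<zeta>: "\<zeta> \<in> sphere \<xi> d" "\<And>z. z \<in> sphere \<xi> d \<Longrightarrow> norm (f z) \<le> norm (f \<zeta>)"
      using continuous_attains_sup[OF compact_sphere] by blast
    have "norm ((deriv ^^ 1) f \<xi>) \<le> fact 1 * norm (f \<zeta>) / d ^ 1"
    proof (rule Cauchy_inequality)
      show "f holomorphic_on ball \<xi> d"
        using sub by (intro holomorphic_on_subset[OF f]) auto
      show "continuous_on (cball \<xi> d) f"
        using sub by (intro continuous_on_subset[OF contf]) auto
      show "norm (f x) \<le> norm (f \<zeta>)" if "norm (\<xi> - x) = d" for x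
        using \<zeta>(2)[of x] that by (simp add: dist_norm)
    qed (use d in auto)
    then have le: "d * norm (deriv f \<xi>) \<le> norm (f \<zeta>)"
      using d by (simp add: field_simps)
    define w where "w = cis (- t) * \<zeta>"
    have w: "cis t * w = \<zeta>" by (simp add: w_def mult.assoc[symmetric] cis_mult)
    have "dist (of_real r) w = dist \<xi> \<zeta>"
    proof -
      have "\<xi> - \<zeta> = cis t * (of_real r - w)" by (simp add: \<xi>_def w[symmetric] algebra_simps)
      then show ?thesis by (simp add: dist_norm norm_mult)
    qed
    then have wd: "dist (of_real r) w = d" using \<zeta> by simp
    moreover have "norm w \<le> r + d"
      using norm_triangle_sub[of w "of_real r"] wd r by (simp add: dist_norm norm_minus_commute)
    moreover have "h t \<le> norm (f (cis t * w)) powr p"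
    proof -
      have "h t = (d * norm (deriv f \<xi>)) powr p"
        using d by (simp add: h_def \<xi>_def powr_mult)
      also have "\<dots> \<le> norm (f \<zeta>) powr p"
        using le d p by (intro powr_mono2) auto
      finally show ?thesis by (simp add: w)
    qed
    ultimately show "\<exists>w\<in>cball (of_real r) d. norm w \<le> r + d \<and> h t \<le> norm (f (cis t * w)) powr p"
      by (intro bexI[of _ w]) auto
  qed (use r d in auto)
  moreover have "(\<integral>\<^sup>+t. ennreal (h t) * indicator {0..2 * pi} t \<partial>lborel)
      = (\<integral>\<^sup>+t. ennreal (d powr p) * (ennreal (norm (deriv f (of_real r * cis t)) powr p) * indicator {0..2 * pi} t) \<partial>lborel)"
    by (simp add: h_def ennreal_mult mult.assoc)
  moreover have "\<dots> = ennreal (d powr p) * ennreal (2 * pi * circle_mean p (deriv f) r)"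
  proof (subst nn_integral_cmult)
    have "(\<lambda>t. norm (deriv f (of_real r * cis t)) powr p) \<in> borel_measurable borel"
      using r d by (intro borel_measurable_continuous_onI continuous_on_circle_norm_powr[OF contf' _ p]) auto
    then show "(\<lambda>t. ennreal (norm (deriv f (of_real r * cis t)) powr p) * indicator {0..2 * pi} t) \<in> borel_measurable lborel"
      by measurable
    show "ennreal (d powr p) * (\<integral>\<^sup>+t. ennreal (norm (deriv f (of_real r * cis t)) powr p) * indicator {0..2 * pi} t \<partial>lborel)
      = ennreal (d powr p) * ennreal (2 * pi * circle_mean p (deriv f) r)"
      using r d by (subst nn_integral_circle_mean[OF contf' _ p]) auto
  qed
  ultimately have "ennreal (2 * pi * (d powr p * circle_mean p (deriv f) r))
      \<le> ennreal (2 * pi * (4 * circle_mean p f (r + 2 * d)))"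
    using d by (simp add: ennreal_mult[symmetric] circle_mean_nonneg mult_ac add.assoc flip: mult_2)
  then have "2 * pi * (d powr p * circle_mean p (deriv f) r) \<le> 2 * pi * (4 * circle_mean p f (r + 2 * d))"
    by (subst (asm) ennreal_le_iff) (auto simp: circle_mean_nonneg)
  then show ?thesis by (subst (asm) mult_le_cancel_left_pos) auto
qed

text \<open>Substitute for the triangle inequality, with leading factor 1 + \<epsilon> instead of a
  fixed constant. If |a - b| is small against |b|, the first term suffices, with (1 + \<delta>)^p =
  1 + \<epsilon>; otherwise |b| is at most |a - b| / \<delta> and the second term suffices.\<close>

lemma norm_powr_perturb:
  fixes p \<epsilon> :: real
  assumes p: "0 < p" and \<epsilon>: "0 < \<epsilon>"
  obtains C where "0 < C"
    "\<And>a b :: 'a::real_normed_vector. norm a powr p \<le> (1 + \<epsilon>) * norm b powr p + C * norm (a - b) powr p"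
proof -
  define \<delta> where "\<delta> = (1 + \<epsilon>) powr (1 / p) - 1"
  have \<delta>: "0 < \<delta>" using p \<epsilon> by (simp add: \<delta>_def)
  have \<delta>p: "(1 + \<delta>) powr p = 1 + \<epsilon>" using p \<epsilon> by (simp add: \<delta>_def powr_powr)
  define C where "C = (1 + 1 / \<delta>) powr p"
  have "0 < 1 + 1 / \<delta>" using \<delta> by (intro add_pos_pos) auto
  then have "0 < C" by (simp add: C_def)
  moreover have "norm a powr p \<le> (1 + \<epsilon>) * norm b powr p + C * norm (a - b) powr p"
    for a b :: 'a
  proof (cases "norm (a - b) \<le> \<delta> * norm b")
    case True
    have "norm a \<le> (1 + \<delta>) * norm b"
      using True norm_triangle_sub[of a b] by (simp add: algebra_simps)
    then have "norm a powr p \<le> ((1 + \<delta>) * norm b) powr p"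
      using p by (intro powr_mono2) auto
    also have "\<dots> = (1 + \<epsilon>) * norm b powr p"
      using \<delta> by (simp add: powr_mult \<delta>p)
    finally show ?thesis using \<open>0 < C\<close> by (simp add: add_increasing2)
  next
    case False
    then have "norm b \<le> norm (a - b) / \<delta>" using \<delta> by (simp add: field_simps)
    then have "norm a \<le> (1 + 1 / \<delta>) * norm (a - b)"
      using norm_triangle_sub[of a b] by (simp add: algebra_simps)
    then have "norm a powr p \<le> ((1 + 1 / \<delta>) * norm (a - b)) powr p"
      using p by (intro powr_mono2) auto
    also have "\<dots> = C * norm (a - b) powr p"
      using \<delta> by (simp add: powr_mult C_def)
    finally show ?thesis using \<epsilon> by (simp add: add_increasing)
  qed
  ultimately show thesis by (rule that)
qed

text \<open>Choosing \<open>w\<close> as a maximum point of |f'| on the segment gives a bound at a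
  single point, the form that the average of suprema takes as input.\<close>

lemma norm_increment_le_deriv:
  assumes f: "f holomorphic_on S" and S: "open S" and seg: "closed_segment a b \<subseteq> S"
  obtains w where "w \<in> closed_segment a b" "norm (f b - f a) \<le> norm (b - a) * norm (deriv f w)"
proof -
  have "continuous_on (closed_segment a b) (\<lambda>z. norm (deriv f z))"
    using holomorphic_deriv[OF f S] seg
    by (intro continuous_on_norm) (meson continuous_on_subset holomorphic_on_imp_continuous_on)
  then obtain w where w: "w \<in> closed_segment a b"
      "\<And>z. z \<in> closed_segment a b \<Longrightarrow> norm (deriv f z) \<le> norm (deriv f w)"
    using continuous_attains_sup[OF compact_segment] by (metis ends_in_segment(1) empty_iff)
  have "norm (f b - f a) \<le> norm (deriv f w) * norm (b - a)"
  proof (rule field_differentiable_bound[of "closed_segment a b" f "deriv f"])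
    fix z assume "z \<in> closed_segment a b"
    then show "(f has_field_derivative deriv f z) (at z within closed_segment a b)"
      using holomorphic_derivI[OF f S, of z] seg by (auto intro: has_field_derivative_at_within)
  qed (use w in auto)
  with w show thesis using that by (simp add: mult.commute)
qed

text \<open>\<open>C\<close> depends on p and \<epsilon> only, so one constant serves all nodes and
  all functions. The power (s - r)^p comes from the length of the radial segment, the squared
  quotient from averaging the maximum of |f'| over it, and \<rho> is the room that this averaging
  takes beyond \<open>s\<close>.\<close>

lemma circle_mean_increment:
  assumes p: "0 < p" and \<epsilon>: "0 < \<epsilon>"
  obtains C where "0 < C"
    "\<And>f R r s \<rho>. f holomorphic_on ball 0 R \<Longrightarrow> 0 \<le> r \<Longrightarrow> r < s \<Longrightarrow> 0 < \<rho> \<Longrightarrow> s + \<rho> < R \<Longrightarrow>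
      circle_mean p f s \<le> (1 + \<epsilon>) * circle_mean p f r
        + C * (s - r) powr p * ((s - r + \<rho>) / \<rho>)\<^sup>2 * circle_mean p (deriv f) (s + \<rho>)"
proof -
  obtain C where C: "0 < C"
    "\<And>a b :: complex. norm a powr p \<le> (1 + \<epsilon>) * norm b powr p + C * norm (a - b) powr p"
    using norm_powr_perturb[OF p \<epsilon>, where 'a = complex] by blast
  have "circle_mean p f s \<le> (1 + \<epsilon>) * circle_mean p f r
        + C * (s - r) powr p * ((s - r + \<rho>) / \<rho>)\<^sup>2 * circle_mean p (deriv f) (s + \<rho>)"
    if f: "f holomorphic_on ball 0 R" and rs: "0 \<le> r" "r < s" and \<rho>: "0 < \<rho>" "s + \<rho> < R" for f R r s \<rho>
  proof -
    have f': "deriv f holomorphic_on ball 0 R" using f by (rule holomorphic_deriv) simp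
    have contf: "continuous_on (ball 0 R) f" by (rule holomorphic_on_imp_continuous_on[OF f])
    \<comment> \<open>Dividing by \<open>s - r\<close> makes \<open>h\<close> at most |f'|^p at one
      point of the segment, as the average of suprema requires.\<close>
    define h where "h = (\<lambda>t. (norm (f (of_real s * cis t) - f (of_real r * cis t)) / (s - r)) powr p)"
    define M where "M = ((s - r + \<rho>) / \<rho>)\<^sup>2 * circle_mean p (deriv f) (s + \<rho>)"
    have M: "0 \<le> M" by (simp add: M_def circle_mean_nonneg)
    have h: "(\<integral>\<^sup>+t. ennreal (h t) * indicator {0..2 * pi} t \<partial>lborel) \<le> ennreal (2 * pi * M)"
      unfolding M_def
    proof (rule nn_integral_circle_sup_le[OF f' p, where c = "of_real s"])
      fix t :: real
      have seg: "closed_segment (of_real r * cis t) (of_real s * cis t) \<subseteq> ball 0 R"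
        using rs \<rho> by (intro closed_segment_subset) (auto simp: norm_mult)
      obtain v where v: "v \<in> closed_segment (of_real r * cis t) (of_real s * cis t)"
        "norm (f (of_real s * cis t) - f (of_real r * cis t))
          \<le> norm (of_real s * cis t - of_real r * cis t) * norm (deriv f v)"
        using norm_increment_le_deriv[OF f open_ball seg] by blast
      then obtain u where u: "0 \<le> u" "u \<le> 1" "v = (1 - u) *\<^sub>R (of_real r * cis t) + u *\<^sub>R (of_real s * cis t)"
        by (auto simp: in_segment)
      \<comment> \<open>\<open>q\<close> is the radius of \<open>v\<close>; rotated back by t,
        \<open>v\<close> becomes the real point \<open>q\<close> in [r, s].\<close>
      define q where "q = (1 - u) * r + u * s"
      have "q = r + u * (s - r)" by (simp add: q_def algebra_simps)
      moreover have "0 \<le> u * (s - r)" "u * (s - r) \<le> 1 * (s - r)"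
        using u rs by (intro mult_nonneg_nonneg mult_right_mono; simp)+
      ultimately have q: "r \<le> q" "q \<le> s" by auto
      have vq: "v = cis t * of_real q" using u by (simp add: q_def scaleR_conv_of_real algebra_simps)
      have "norm (of_real s * cis t - of_real r * cis t) = s - r"
        using rs by (simp add: left_diff_distrib[symmetric] norm_mult flip: of_real_diff)
      then have "norm (f (of_real s * cis t) - f (of_real r * cis t)) / (s - r) \<le> norm (deriv f v)"
        using v rs by (simp add: divide_le_eq mult.commute)
      then have "h t \<le> norm (deriv f v) powr p"
        unfolding h_def using rs p by (intro powr_mono2) auto
      then show "\<exists>w\<in>cball (of_real s) (s - r). norm w \<le> s \<and> h t \<le> norm (deriv f (cis t * w)) powr p"
        using q rs by (intro bexI[of _ "of_real q"]) (auto simp: vq dist_norm simp flip: of_real_diff)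
    qed (use rs \<rho> in auto)
    have m: "(\<lambda>t. norm (f (of_real x * cis t)) powr p) \<in> borel_measurable borel" if "\<bar>x\<bar> < R" for x
      using that by (intro borel_measurable_continuous_onI continuous_on_circle_norm_powr[OF contf _ p]) auto
    have [measurable]: "(\<lambda>t. norm (f (of_real r * cis t)) powr p) \<in> borel_measurable borel"
      using m[of r] rs \<rho> by auto
    have [measurable]: "h \<in> borel_measurable borel"
    proof -
      have "continuous_on UNIV (\<lambda>t. norm ((f (of_real s * cis t) - f (of_real r * cis t)) / of_real (s - r)) powr p)"
        using rs \<rho> p
        by (intro continuous_on_norm_powr continuous_intros continuous_on_compose2[OF contf])
           (auto simp: norm_mult)
      then have "(\<lambda>t. norm ((f (of_real s * cis t) - f (of_real r * cis t)) / of_real (s - r)) powr p) \<in> borel_measurable borel"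
        by (rule borel_measurable_continuous_onI)
      also have "(\<lambda>t. norm ((f (of_real s * cis t) - f (of_real r * cis t)) / of_real (s - r)) powr p) = h"
        using rs by (auto simp: h_def norm_divide simp flip: of_real_diff)
      finally show ?thesis .
    qed
    define C' where "C' = C * (s - r) powr p"
    have C': "0 \<le> C'" using C by (simp add: C'_def)
    have "ennreal (2 * pi * circle_mean p f s)
        = (\<integral>\<^sup>+t. ennreal (norm (f (of_real s * cis t)) powr p) * indicator {0..2 * pi} t \<partial>lborel)"
      using rs \<rho> by (subst nn_integral_circle_mean[OF contf _ p]) auto
    also have "\<dots> \<le> (\<integral>\<^sup>+t. ennreal (1 + \<epsilon>) * (ennreal (norm (f (of_real r * cis t)) powr p) * indicator {0..2 * pi} t)
         + ennreal C' * (ennreal (h t) * indicator {0..2 * pi} t) \<partial>lborel)"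
    proof (intro nn_integral_mono)
      fix t :: real
      have "norm (f (of_real s * cis t) - f (of_real r * cis t)) powr p = (s - r) powr p * h t"
        using rs by (simp add: h_def powr_divide)
      then have "norm (f (of_real s * cis t)) powr p \<le> (1 + \<epsilon>) * norm (f (of_real r * cis t)) powr p + C' * h t"
        using C(2)[of "f (of_real s * cis t)" "f (of_real r * cis t)"] by (simp add: C'_def mult_ac)
      then have "ennreal (norm (f (of_real s * cis t)) powr p)
          \<le> ennreal ((1 + \<epsilon>) * norm (f (of_real r * cis t)) powr p + C' * h t)"
        by (rule ennreal_leI)
      also have "\<dots> = ennreal (1 + \<epsilon>) * ennreal (norm (f (of_real r * cis t)) powr p) + ennreal C' * ennreal (h t)"
        using \<epsilon> C' by (simp add: ennreal_mult h_def)
      finally show "ennreal (norm (f (of_real s * cis t)) powr p) * indicator {0..2 * pi} t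
          \<le> ennreal (1 + \<epsilon>) * (ennreal (norm (f (of_real r * cis t)) powr p) * indicator {0..2 * pi} t)
           + ennreal C' * (ennreal (h t) * indicator {0..2 * pi} t)"
        by (simp add: indicator_def)
    qed
    also have "\<dots> = ennreal (1 + \<epsilon>) * ennreal (2 * pi * circle_mean p f r)
        + ennreal C' * (\<integral>\<^sup>+t. ennreal (h t) * indicator {0..2 * pi} t \<partial>lborel)"
    proof (subst nn_integral_add)
      have "(\<integral>\<^sup>+t. ennreal (norm (f (of_real r * cis t)) powr p) * indicator {0..2 * pi} t \<partial>lborel)
          = ennreal (2 * pi * circle_mean p f r)"
        using rs \<rho> by (intro nn_integral_circle_mean[OF contf _ p]) auto
      then show "(\<integral>\<^sup>+t. ennreal (1 + \<epsilon>) * (ennreal (norm (f (of_real r * cis t)) powr p) * indicator {0..2 * pi} t) \<partial>lborel)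
         + (\<integral>\<^sup>+t. ennreal C' * (ennreal (h t) * indicator {0..2 * pi} t) \<partial>lborel)
        = ennreal (1 + \<epsilon>) * ennreal (2 * pi * circle_mean p f r)
        + ennreal C' * (\<integral>\<^sup>+t. ennreal (h t) * indicator {0..2 * pi} t \<partial>lborel)"
        by (simp add: nn_integral_cmult)
    qed measurable
    also have "\<dots> \<le> ennreal (1 + \<epsilon>) * ennreal (2 * pi * circle_mean p f r) + ennreal C' * ennreal (2 * pi * M)"
      by (intro add_left_mono mult_left_mono h) auto
    also have "\<dots> = ennreal (2 * pi * ((1 + \<epsilon>) * circle_mean p f r + C' * M))"
      using \<epsilon> C' M by (simp add: ennreal_mult[symmetric] ennreal_plus[symmetric] circle_mean_nonneg algebra_simps del: ennreal_plus)
    finally have "2 * pi * circle_mean p f s \<le> 2 * pi * ((1 + \<epsilon>) * circle_mean p f r + C' * M)"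
      using \<epsilon> C' M by (subst (asm) ennreal_le_iff) (auto simp: circle_mean_nonneg)
    then have "circle_mean p f s \<le> (1 + \<epsilon>) * circle_mean p f r + C' * M"
      by (subst (asm) mult_le_cancel_left_pos) auto
    then show ?thesis by (simp add: C'_def M_def mult.assoc)
  qed
  with C(1) show thesis by (rule that)
qed

section \<open>Sufficiency\<close>


lemma comparable_on_refl: "comparable_on S F F"
  unfolding comparable_on_def by (intro exI[of _ 1]) auto

lemma comparable_on_sym: "comparable_on S F G \<Longrightarrow> comparable_on S G F"
  unfolding comparable_on_def by blast

lemma comparable_onI:
  assumes C: "0 < C" and FG: "\<And>x. x \<in> S \<Longrightarrow> F x \<le> ennreal C * G x"
    and D: "0 < D" and GF: "\<And>x. x \<in> S \<Longrightarrow> G x \<le> ennreal D * F x"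
  shows "comparable_on S F G"
  unfolding comparable_on_def
proof (intro exI conjI ballI)
  show "0 < max C D" using C by simp
  fix x assume x: "x \<in> S"
  show "F x \<le> ennreal (max C D) * G x"
    by (rule order_trans[OF FG[OF x]], intro mult_right_mono ennreal_leI) auto
  show "G x \<le> ennreal (max C D) * F x"
    by (rule order_trans[OF GF[OF x]], intro mult_right_mono ennreal_leI) auto
qed

lemma comparable_on_trans [trans]:
  assumes "comparable_on S F G" "comparable_on S G H"
  shows "comparable_on S F H"
proof -
  obtain C where C: "0 < C" "\<And>x. x \<in> S \<Longrightarrow> F x \<le> ennreal C * G x" "\<And>x. x \<in> S \<Longrightarrow> G x \<le> ennreal C * F x"
    using assms(1) unfolding comparable_on_def by blast
  obtain D where D: "0 < D" "\<And>x. x \<in> S \<Longrightarrow> G x \<le> ennreal D * H x" "\<And>x. x \<in> S \<Longrightarrow> H x \<le> ennreal D * G x"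
    using assms(2) unfolding comparable_on_def by blast
  show ?thesis
  proof (rule comparable_onI[of "C * D" _ _ _ "D * C"])
    fix x assume x: "x \<in> S"
    have "F x \<le> ennreal C * (ennreal D * H x)"
      by (rule order_trans[OF C(2)[OF x]]) (intro mult_left_mono D x, simp)
    then show "F x \<le> ennreal (C * D) * H x" using C D by (simp add: ennreal_mult mult.assoc)
    have "H x \<le> ennreal D * (ennreal C * F x)"
      by (rule order_trans[OF D(3)[OF x]]) (intro mult_left_mono C x, simp)
    then show "H x \<le> ennreal (D * C) * F x" using C D by (simp add: ennreal_mult mult.assoc)
  qed (use C D in auto)
qed

lemma comparable_on_add:
  assumes "comparable_on S F G" "comparable_on S F' G'"
  shows "comparable_on S (\<lambda>x. F x + F' x) (\<lambda>x. G x + G' x)"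
proof -
  obtain C where C: "0 < C" "\<And>x. x \<in> S \<Longrightarrow> F x \<le> ennreal C * G x" "\<And>x. x \<in> S \<Longrightarrow> G x \<le> ennreal C * F x"
    using assms(1) unfolding comparable_on_def by blast
  obtain D where D: "0 < D" "\<And>x. x \<in> S \<Longrightarrow> F' x \<le> ennreal D * G' x" "\<And>x. x \<in> S \<Longrightarrow> G' x \<le> ennreal D * F' x"
    using assms(2) unfolding comparable_on_def by blast
  have *: "a + b \<le> ennreal (C + D) * (a' + b')" if "a \<le> ennreal C * a'" "b \<le> ennreal D * b'" for a b a' b'
  proof -
    have "a \<le> ennreal (C + D) * a'"
      by (rule order_trans[OF that(1)], intro mult_right_mono ennreal_leI) (use D in auto)
    moreover have "b \<le> ennreal (C + D) * b'"
      by (rule order_trans[OF that(2)], intro mult_right_mono ennreal_leI) (use C in auto)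
    ultimately show ?thesis by (simp only: distrib_left add_mono)
  qed
  show ?thesis
    by (rule comparable_onI[of "C + D" _ _ _ "C + D"]) (use C D in \<open>auto simp del: ennreal_plus intro!: *\<close>)
qed

lemma comparable_on_compose:
  assumes "comparable_on S F G" "\<And>x. x \<in> S' \<Longrightarrow> h x \<in> S"
  shows "comparable_on S' (\<lambda>x. F (h x)) (\<lambda>x. G (h x))"
  using assms unfolding comparable_on_def by blast

lemma comparable_on_cong:
  assumes "\<And>x. x \<in> S \<Longrightarrow> F x = F' x" "\<And>x. x \<in> S \<Longrightarrow> G x = G' x"
  shows "comparable_on S F G \<longleftrightarrow> comparable_on S F' G'"
  using assms by (simp add: comparable_on_def)

lemma suminf_ennreal_Suc_le: "(\<Sum>n. f (Suc n)) \<le> (\<Sum>n. f n :: ennreal)"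
proof -
  have "f sums ((\<Sum>n. f (Suc n)) + f 0)"
    by (intro sums_Suc summable_sums summableI)
  then have "(\<Sum>n. f n) = (\<Sum>n. f (Suc n)) + f 0" by (rule sums_unique[symmetric])
  then show ?thesis by simp
qed

text \<open>Summing the recursion bounds a sum S by A 0 + \<kappa> S plus the sum of B. Subtracting
  \<kappa> S is legitimate only for finite S, so it is done for partial sums; the series itself may
  be infinite.\<close>

lemma suminf_le_of_geometric_recursion:
  fixes A B :: "nat \<Rightarrow> real"
  assumes A: "\<And>n. 0 \<le> A n" and B: "\<And>n. 0 \<le> B n" and \<kappa>: "0 \<le> \<kappa>" "\<kappa> < 1"
    and step: "\<And>n. A (Suc n) \<le> \<kappa> * A n + B n"
  shows "(\<Sum>n. ennreal (A n)) \<le> ennreal (1 / (1 - \<kappa>)) * (ennreal (A 0) + (\<Sum>n. ennreal (B n)))"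
proof (rule suminf_le_const)
  fix N
  have "(\<Sum>n<N. A n) \<le> A 0 + \<kappa> * (\<Sum>n<N. A n) + (\<Sum>n<N. B n)"
  proof (cases N)
    case (Suc M)
    have "(\<Sum>n<N. A n) = A 0 + (\<Sum>n<M. A (Suc n))"
      unfolding Suc by (rule sum.lessThan_Suc_shift)
    also have "(\<Sum>n<M. A (Suc n)) \<le> (\<Sum>n<M. \<kappa> * A n + B n)" by (intro sum_mono step)
    also have "\<dots> \<le> (\<Sum>n<N. \<kappa> * A n + B n)"
      using A B \<kappa> unfolding Suc by (intro sum_mono2) auto
    finally show ?thesis by (simp add: sum.distrib sum_distrib_left add.assoc)
  qed (use A in simp)
  then have "(1 - \<kappa>) * (\<Sum>n<N. A n) \<le> A 0 + (\<Sum>n<N. B n)" by (simp add: algebra_simps)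
  then have "(\<Sum>n<N. A n) \<le> 1 / (1 - \<kappa>) * (A 0 + (\<Sum>n<N. B n))"
    using \<kappa> by (simp add: field_simps)
  then have "ennreal (\<Sum>n<N. A n) \<le> ennreal (1 / (1 - \<kappa>) * (A 0 + (\<Sum>n<N. B n)))"
    by (rule ennreal_leI)
  also have "\<dots> = ennreal (1 / (1 - \<kappa>)) * (ennreal (A 0) + (\<Sum>n<N. ennreal (B n)))"
    using A B \<kappa> by (simp add: ennreal_mult[symmetric] ennreal_plus[symmetric] sum_nonneg del: ennreal_plus)
  also have "\<dots> \<le> ennreal (1 / (1 - \<kappa>)) * (ennreal (A 0) + (\<Sum>n. ennreal (B n)))"
    by (intro mult_left_mono add_left_mono sum_le_suminf) auto
  finally show "(\<Sum>n<N. ennreal (A n)) \<le> ennreal (1 / (1 - \<kappa>)) * (ennreal (A 0) + (\<Sum>n. ennreal (B n)))"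
    using A by simp
qed simp

section \<open>Finite measures on [0, 1) and their tails\<close>

text \<open>Abstracts the measure \<omega>(r) dr: the conditions on the weight and, in polar form,
  all the integrals are expressed through it. Positivity of the tails is the standing assumption on
  the weight.\<close>

locale radial_measure = finite_measure \<mu> for \<mu> :: "real measure" +
  assumes sets_eq: "sets \<mu> = sets borel"
    and AE_unit_interval: "AE r in \<mu>. 0 \<le> r \<and> r < 1"
    and measure_tail_pos: "\<And>r. 0 \<le> r \<Longrightarrow> r < 1 \<Longrightarrow> 0 < measure \<mu> {r..<1}"
begin

lemma space_eq: "space \<mu> = UNIV"
  using sets_eq_imp_space_eq[OF sets_eq] by simp

definition tail :: "real \<Rightarrow> real" where
  "tail r = measure \<mu> {r..<1}"

lemma tail_pos: "0 \<le> r \<Longrightarrow> r < 1 \<Longrightarrow> 0 < tail r"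
  unfolding tail_def by (rule measure_tail_pos)

lemma tail_nonneg: "0 \<le> tail r"
  by (simp add: tail_def)

lemma tail_antimono: "r \<le> s \<Longrightarrow> tail s \<le> tail r"
  unfolding tail_def by (intro finite_measure_mono) (auto simp: sets_eq)

lemma measure_Ico_eq_tail_diff:
  assumes "r \<le> s" "s \<le> 1"
  shows "measure \<mu> {r..<s} = tail r - tail s"
proof -
  have "measure \<mu> {r..<1} = measure \<mu> ({r..<s} \<union> {s..<1})"
    using assms by (intro arg_cong[where f = "measure \<mu>"]) auto
  also have "\<dots> = measure \<mu> {r..<s} + measure \<mu> {s..<1}"
    by (intro finite_measure_Union) (auto simp: sets_eq)
  finally show ?thesis by (simp add: tail_def)
qed

text \<open>For holomorphic \<open>f\<close> this is the polar form of the weighted area integral of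
  |f|^p (1 - |z|)^\<gamma>; with \<gamma> = 0 it is the p-th power of the Bergman norm.\<close>

definition mean_integral :: "real \<Rightarrow> real \<Rightarrow> (complex \<Rightarrow> complex) \<Rightarrow> ennreal" where
  "mean_integral p \<gamma> f = (\<integral>\<^sup>+r. ennreal (circle_mean p f r * (1 - r) powr \<gamma> * (2 * r)) \<partial>\<mu>)"

end

section \<open>Discretisation at geometric nodes\<close>

text \<open>The two tail conditions, at the points 1 - x^n only. In the application x is 1/K for the
  K of the reverse condition, \<theta> is the inverse of its constant, and q comes from iterating
  the doubling condition.\<close>

locale doubling_radial_measure = radial_measure +
  fixes x q \<theta> :: real
  assumes x: "0 < x" "x < 1" and q: "0 < q" and \<theta>: "0 < \<theta>" "\<theta> < 1"
    and tail_le: "\<And>n. tail (1 - x ^ n) \<le> q * tail (1 - x ^ Suc n)"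
    and tail_Suc_le: "\<And>n. tail (1 - x ^ Suc n) \<le> \<theta> * tail (1 - x ^ n)"
begin

definition node :: "nat \<Rightarrow> real" where "node n = 1 - x ^ n"

text \<open>For \<gamma> >= 0 this is, up to constants, the integral of (1 - r)^\<gamma> over [node
  n, 1), because a fixed share of the tail lies before the next node.\<close>

definition node_weight :: "real \<Rightarrow> nat \<Rightarrow> real" where
  "node_weight \<gamma> n = (x ^ n) powr \<gamma> * tail (node n)"

definition mean_sum :: "real \<Rightarrow> real \<Rightarrow> (complex \<Rightarrow> complex) \<Rightarrow> ennreal" where
  "mean_sum p \<gamma> f = (\<Sum>n. ennreal (circle_mean p f (node n) * node_weight \<gamma> n))"

lemma node_0 [simp]: "node 0 = 0" by (simp add: node_def)
lemma node_nonneg: "0 \<le> node n" using x by (simp add: node_def power_le_one)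
lemma node_less_1: "node n < 1" using x by (simp add: node_def)
lemma node_diff: "node (Suc n) - node n = x ^ n * (1 - x)" by (simp add: node_def algebra_simps)
lemma node_less_Suc: "node n < node (Suc n)" 
proof -
  have "0 < x ^ n * (1 - x)" using x by (intro mult_pos_pos) auto
  then show ?thesis using node_diff[of n] by linarith
qed
lemma node_mono: "m \<le> n \<Longrightarrow> node m \<le> node n"
  by (rule lift_Suc_mono_le[of node, OF less_imp_le[OF node_less_Suc]])

lemma node_weight_pos: "0 < node_weight \<gamma> n"
  using x tail_pos[OF node_nonneg node_less_1, of n] by (simp add: node_weight_def)

lemma node_weight_Suc_le:
  assumes "0 \<le> \<gamma>"
  shows "node_weight \<gamma> (Suc n) \<le> \<theta> * node_weight \<gamma> n"
proof -
  have "(x ^ Suc n) powr \<gamma> \<le> (x ^ n) powr \<gamma>"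
    using x assms by (intro powr_mono2) (auto intro!: mult_left_le_one_le)
  then have "(x ^ Suc n) powr \<gamma> * tail (node (Suc n)) \<le> (x ^ n) powr \<gamma> * (\<theta> * tail (node n))"
    using tail_Suc_le[of n] by (intro mult_mono) (auto simp: node_def tail_nonneg)
  then show ?thesis by (simp add: node_weight_def mult_ac)
qed

lemma node_weight_le_Suc: "node_weight \<gamma> n \<le> q * x powr (- \<gamma>) * node_weight \<gamma> (Suc n)"
proof -
  have "(x ^ n) powr \<gamma> = x powr (- \<gamma>) * (x ^ Suc n) powr \<gamma>"
    using x by (simp add: powr_mult powr_minus field_simps)
  then have "node_weight \<gamma> n = x powr (- \<gamma>) * (x ^ Suc n) powr \<gamma> * tail (node n)"
    by (simp add: node_weight_def)
  also have "\<dots> \<le> x powr (- \<gamma>) * (x ^ Suc n) powr \<gamma> * (q * tail (node (Suc n)))"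
    using tail_le[of n] by (intro mult_left_mono) (auto simp: node_def)
  finally show ?thesis by (simp add: node_weight_def mult_ac)
qed

lemma node_weight_add: "node_weight (\<gamma> + p) n = (x ^ n) powr p * node_weight \<gamma> n"
  using x by (simp add: node_weight_def powr_add)

lemma UN_node: "(\<Union>n. {node n..<node (Suc n)}) = {0..<1}"
proof (intro equalityI subsetI)
  fix r assume "r \<in> (\<Union>n. {node n..<node (Suc n)})"
  then obtain n where "node n \<le> r" "r < node (Suc n)" by auto
  then show "r \<in> {0..<1}" using node_nonneg[of n] node_less_1[of "Suc n"] by auto
next
  fix r :: real assume r: "r \<in> {0..<1}"
  then obtain N where "x ^ N < 1 - r" using x real_arch_pow_inv[of "1 - r" x] by auto
  then have ex: "\<exists>n. r < node n" by (auto simp: node_def intro!: exI[of _ N])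
  define m where "m = (LEAST n. r < node n)"
  have m: "r < node m" unfolding m_def by (rule LeastI_ex[OF ex])
  then obtain n where n: "m = Suc n" using r by (cases m) auto
  have "\<not> r < node n" using n not_less_Least[of n "\<lambda>n. r < node n"] by (simp add: m_def)
  then have "r \<in> {node n..<node (Suc n)}" using m n by simp
  then show "r \<in> (\<Union>n. {node n..<node (Suc n)})" by blast
qed

lemma disjoint_node: "disjoint_family (\<lambda>n. {node n..<node (Suc n)})"
proof (unfold disjoint_family_on_def, intro ballI impI)
  fix m n :: nat assume "m \<noteq> n"
  then have "Suc m \<le> n \<or> Suc n \<le> m" by auto
  then have "node (Suc m) \<le> node n \<or> node (Suc n) \<le> node m" using node_mono by blast
  then show "{node m..<node (Suc m)} \<inter> {node n..<node (Suc n)} = {}" by auto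
qed

text \<open>On [node n, node (n + 1)) the mean lies between its values at the two ends, 1 - r is
  comparable to x^n, and the reverse tail condition makes the mass of the interval comparable to the
  tail. The shifts of index are paid for by the comparability of consecutive node weights.\<close>

lemma comparable_mean_integral_sum:
  assumes p: "0 < p" and \<gamma>: "0 \<le> \<gamma>"
  shows "comparable_on {f. f holomorphic_on ball 0 1} (mean_integral p \<gamma>) (mean_sum p \<gamma>)"
proof -
  define Q where "Q = q * x powr (- \<gamma>)"
  \<comment> \<open>Inverse of what the lower bound loses: x^\<gamma> from 1 - r, 2 (1 - x) from the
    factor 2 r, and 1 - \<theta> from the share of the tail inside one interval.\<close>
  define c where "c = 1 / (2 * x powr \<gamma> * (1 - x) * (1 - \<theta>))"
  have Q: "0 < Q" and c: "0 < c" using q x \<theta> by (auto simp: Q_def c_def)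
  show ?thesis
  proof (rule comparable_onI[of "2 * Q" _ _ _ "Q * c"])
    fix f :: "complex \<Rightarrow> complex"
    assume "f \<in> {f. f holomorphic_on ball 0 1}"
    then have f: "f holomorphic_on ball 0 1" by simp
    have contf: "continuous_on (ball 0 1) f" by (rule holomorphic_on_imp_continuous_on[OF f])
    define a where "a = (\<lambda>n. circle_mean p f (node n))"
    define u where "u = node_weight \<gamma>"
    have a0: "0 \<le> a n" for n by (simp add: a_def circle_mean_nonneg)
    have u0: "0 < u n" for n by (simp add: u_def node_weight_pos)
    have uQ: "u n \<le> Q * u (Suc n)" for n using node_weight_le_Suc[of \<gamma> n] by (simp add: u_def Q_def)
    have sum: "mean_sum p \<gamma> f = (\<Sum>n. ennreal (a n * u n))" by (simp add: mean_sum_def a_def u_def)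
    define F where "F = (\<lambda>r. ennreal (circle_mean p f r * (1 - r) powr \<gamma> * (2 * r)))"
    define J where "J = (\<lambda>n. \<integral>\<^sup>+r. F r * indicator {node n..<node (Suc n)} r \<partial>\<mu>)"
    have J: "mean_integral p \<gamma> f = (\<Sum>n. J n)"
    proof -
      have [measurable]: "(\<lambda>r. ennreal (circle_mean p f r) * indicator {0..<1} r) \<in> borel_measurable borel"
        by (rule borel_measurable_circle_mean[OF contf p])
      \<comment> \<open>Measurability of the circle mean is available after cutting off at [0, 1),
        where \<open>\<mu>\<close> lives.\<close>
      define F' where "F' = (\<lambda>r. ennreal (circle_mean p f r) * indicator {0..<1} r * ennreal ((1 - r) powr \<gamma>) * ennreal (2 * r))"
      have [measurable]: "F' \<in> borel_measurable borel" unfolding F'_def by measurable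
      have F': "F' r = F r" if "r \<in> {0..<1}" for r
        using that by (simp add: F_def F'_def ennreal_mult circle_mean_nonneg)
      have "mean_integral p \<gamma> f = (\<integral>\<^sup>+r. F' r * indicator (\<Union>n. {node n..<node (Suc n)}) r \<partial>\<mu>)"
        unfolding mean_integral_def UN_node
        by (rule nn_integral_cong_AE, use AE_unit_interval in eventually_elim) (simp add: F' F_def)
      also have "\<dots> = (\<Sum>n. \<integral>\<^sup>+r. F' r * indicator {node n..<node (Suc n)} r \<partial>\<mu>)"
        using disjoint_node
        by (intro nn_integral_disjoint_family) (auto simp: sets_eq cong: measurable_cong_sets)
      also have "\<dots> = (\<Sum>n. J n)"
      proof (intro suminf_cong)
        fix n
        have "{node n..<node (Suc n)} \<subseteq> {0..<1}" using UN_node by blast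
        then show "(\<integral>\<^sup>+r. F' r * indicator {node n..<node (Suc n)} r \<partial>\<mu>) = J n"
          unfolding J_def by (intro nn_integral_cong) (use F' in \<open>auto simp: indicator_def\<close>)
      qed
      finally show ?thesis .
    qed
    have em: "emeasure \<mu> {node n..<node (Suc n)} = ennreal (tail (node n) - tail (node (Suc n)))" for n
      using measure_Ico_eq_tail_diff[of "node n" "node (Suc n)"] node_less_Suc[of n] node_less_1[of "Suc n"]
      by (simp add: emeasure_eq_measure)
    have pow: "x ^ Suc n \<le> 1 - r" "1 - r \<le> x ^ n" "0 \<le> r" "r < 1" if "r \<in> {node n..<node (Suc n)}" for n r
      using that node_nonneg[of n] node_less_1[of "Suc n"] by (auto simp: node_def)
    have upper: "J n \<le> ennreal (2 * Q) * ennreal (a (Suc n) * u (Suc n))" for n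
    proof -
      have "J n \<le> (\<integral>\<^sup>+r. ennreal (a (Suc n) * (x ^ n) powr \<gamma> * 2) * indicator {node n..<node (Suc n)} r \<partial>\<mu>)"
        unfolding J_def
      proof (intro nn_integral_mono)
        fix r
        have "circle_mean p f r * (1 - r) powr \<gamma> * (2 * r) \<le> a (Suc n) * (x ^ n) powr \<gamma> * 2"
          if r: "r \<in> {node n..<node (Suc n)}"
          unfolding a_def using pow[OF r] \<gamma> r node_less_1[of "Suc n"] a0[of "Suc n"]
          by (intro mult_mono powr_mono2 circle_mean_mono[OF f p] mult_nonneg_nonneg) (auto simp: a_def)
        then show "F r * indicator {node n..<node (Suc n)} r
            \<le> ennreal (a (Suc n) * (x ^ n) powr \<gamma> * 2) * indicator {node n..<node (Suc n)} r"
          unfolding F_def by (auto simp: indicator_def intro: ennreal_leI)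
      qed
      also have "\<dots> = ennreal (a (Suc n) * (x ^ n) powr \<gamma> * 2) * ennreal (tail (node n) - tail (node (Suc n)))"
        by (subst nn_integral_cmult_indicator) (auto simp: em sets_eq)
      also have "\<dots> \<le> ennreal (a (Suc n) * (x ^ n) powr \<gamma> * 2 * tail (node n))"
      proof -
        have "0 \<le> a (Suc n) * (x ^ n) powr \<gamma> * 2" using a0[of "Suc n"] by simp
        moreover have "0 \<le> tail (node n) - tail (node (Suc n))"
          using tail_antimono[OF less_imp_le[OF node_less_Suc[of n]]] by simp
        moreover have "tail (node n) - tail (node (Suc n)) \<le> tail (node n)"
          using tail_nonneg by simp
        ultimately show ?thesis
          by (simp only: ennreal_mult[symmetric] ennreal_leI mult_left_mono)
      qed
      also have "a (Suc n) * (x ^ n) powr \<gamma> * 2 * tail (node n) = 2 * (a (Suc n) * u n)"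
        by (simp add: u_def node_weight_def)
      also have "ennreal \<dots> \<le> ennreal (2 * (a (Suc n) * (Q * u (Suc n))))"
        using a0 uQ by (intro ennreal_leI mult_left_mono) auto
      finally show ?thesis
        using Q a0 u0[of "Suc n"] by (simp add: ennreal_mult[symmetric] less_imp_le mult_ac)
    qed
    have lower: "ennreal (a n * u n) \<le> ennreal (Q * c) * J (Suc n)" for n
    proof -
      \<comment> \<open>The term at node n is estimated on the following interval, because 2 r
        vanishes at the origin; from node 1 on, r is at least 1 - x.\<close>
      define m where "m = Suc n"
      define b where "b = a m * (x * x ^ m) powr \<gamma> * (2 * (1 - x))"
      have b: "0 \<le> b" using a0[of m] x by (simp add: b_def)
      have "a n * u n \<le> a m * (Q * u m)"
        unfolding m_def using circle_mean_mono[OF f p node_nonneg[of n]] node_less_Suc[of n] node_less_1[of "Suc n"]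
          uQ[of n] u0[of n] a0[of "Suc n"]
        by (intro mult_mono) (auto simp: a_def intro: less_imp_le)
      also have "\<dots> = Q * c * (b * ((1 - \<theta>) * tail (node m)))"
      proof -
        have c1: "c * (2 * x powr \<gamma> * (1 - x) * (1 - \<theta>)) = 1"
          using x \<theta> by (simp add: c_def)
        have "Q * c * (b * ((1 - \<theta>) * tail (node m)))
            = (c * (2 * x powr \<gamma> * (1 - x) * (1 - \<theta>))) * (a m * (Q * u m))"
          using x by (simp add: b_def u_def node_weight_def powr_mult mult_ac)
        then show ?thesis by (simp only: c1 mult_1)
      qed
      also have "\<dots> \<le> Q * c * (b * (tail (node m) - tail (node (Suc m))))"
      proof -
        have "(1 - \<theta>) * tail (node m) \<le> tail (node m) - tail (node (Suc m))"
          using tail_Suc_le[of m] by (simp add: node_def left_diff_distrib)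
        then show ?thesis using Q c b by (intro mult_left_mono) auto
      qed
      finally have "ennreal (a n * u n) \<le> ennreal (Q * c * (b * (tail (node m) - tail (node (Suc m)))))"
        by (rule ennreal_leI)
      also have "\<dots> = ennreal (Q * c) * (ennreal b * emeasure \<mu> {node m..<node (Suc m)})"
        using Q c b tail_antimono[OF less_imp_le[OF node_less_Suc[of m]]]
        by (simp add: em ennreal_mult[symmetric] less_imp_le)
      also have "ennreal b * emeasure \<mu> {node m..<node (Suc m)} = (\<integral>\<^sup>+r. ennreal b * indicator {node m..<node (Suc m)} r \<partial>\<mu>)"
        by (subst nn_integral_cmult_indicator) (auto simp: sets_eq)
      also have "\<dots> \<le> J m"
        unfolding J_def
      proof (intro nn_integral_mono)
        fix r
        have "b \<le> circle_mean p f r * (1 - r) powr \<gamma> * (2 * r)" if r: "r \<in> {node m..<node (Suc m)}"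
        proof -
          have "node 1 \<le> node m" by (rule node_mono) (simp add: m_def)
          then have "1 - x \<le> r" using r by (simp add: node_def)
          then show ?thesis
            unfolding b_def a_def using pow[OF r] \<gamma> r x
            by (intro mult_mono powr_mono2 circle_mean_mono[OF f p] mult_nonneg_nonneg node_nonneg circle_mean_nonneg)
               auto
        qed
        then show "ennreal b * indicator {node m..<node (Suc m)} r \<le> F r * indicator {node m..<node (Suc m)} r"
          unfolding F_def by (auto simp: indicator_def intro: ennreal_leI)
      qed
      finally show ?thesis by (simp add: m_def mult_left_mono)
    qed
    show "mean_integral p \<gamma> f \<le> ennreal (2 * Q) * mean_sum p \<gamma> f"
    proof -
      have "(\<Sum>n. J n) \<le> (\<Sum>n. ennreal (2 * Q) * ennreal (a (Suc n) * u (Suc n)))"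
        by (intro suminf_le upper summableI)
      also have "\<dots> = ennreal (2 * Q) * (\<Sum>n. ennreal (a (Suc n) * u (Suc n)))"
        by (rule ennreal_suminf_cmult)
      also have "\<dots> \<le> ennreal (2 * Q) * (\<Sum>n. ennreal (a n * u n))"
        by (intro mult_left_mono suminf_ennreal_Suc_le) simp
      finally show ?thesis by (simp add: J sum)
    qed
    show "mean_sum p \<gamma> f \<le> ennreal (Q * c) * mean_integral p \<gamma> f"
    proof -
      have "(\<Sum>n. ennreal (a n * u n)) \<le> (\<Sum>n. ennreal (Q * c) * J (Suc n))"
        by (intro suminf_le lower summableI)
      also have "\<dots> = ennreal (Q * c) * (\<Sum>n. J (Suc n))"
        by (rule ennreal_suminf_cmult)
      also have "\<dots> \<le> ennreal (Q * c) * (\<Sum>n. J n)"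
        by (intro mult_left_mono suminf_ennreal_Suc_le) simp
      finally show ?thesis by (simp add: J sum)
    qed
  qed (use Q c in auto)
qed

text \<open>In one direction the increment inequality is applied between consecutive nodes: its
  first term is absorbed by the decay of the node weights, its second is a derivative term one node
  further out. In the other direction Cauchy's estimate is used with half a gap as radius. The
  exponent grows by p because the gaps are proportional to x^n.\<close>

lemma comparable_mean_sum_deriv:
  assumes p: "0 < p" and \<gamma>: "0 \<le> \<gamma>"
  shows "comparable_on {f. f holomorphic_on ball 0 1} (mean_sum p \<gamma>)
    (\<lambda>f. mean_sum p (\<gamma> + p) (deriv f) + ennreal (norm (f 0) powr p))"
proof -
  define Q where "Q = q * x powr (- \<gamma>)"
  have Q: "0 < Q" using q x by (simp add: Q_def)
  \<comment> \<open>The factor 1 + (1 - \<theta>) of the increment times the decay \<theta> of the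
    weights equals 1 - (1 - \<theta>)^2 < 1.\<close>
  define \<kappa> where "\<kappa> = (1 + (1 - \<theta>)) * \<theta>"
  have "1 - \<kappa> = (1 - \<theta>)\<^sup>2" by (simp add: \<kappa>_def power2_eq_square algebra_simps)
  then have \<kappa>: "0 \<le> \<kappa>" "\<kappa> < 1" using \<theta> by (simp_all add: \<kappa>_def) (smt (verit) zero_less_power)
  obtain C where C: "0 < C"
    "\<And>f R r s \<rho>. f holomorphic_on ball 0 R \<Longrightarrow> 0 \<le> r \<Longrightarrow> r < s \<Longrightarrow> 0 < \<rho> \<Longrightarrow> s + \<rho> < R \<Longrightarrow>
      circle_mean p f s \<le> (1 + (1 - \<theta>)) * circle_mean p f r
        + C * (s - r) powr p * ((s - r + \<rho>) / \<rho>)\<^sup>2 * circle_mean p (deriv f) (s + \<rho>)"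
    using circle_mean_increment[OF p, of "1 - \<theta>"] \<theta> by auto
  define C1 where "C1 = C * (1 - x) powr p * ((1 + x) / x)\<^sup>2"
  have C1: "0 < C1" using C x by (simp add: C1_def)
  \<comment> \<open>\<open>Q\<close> moves the weight from node n + 1 to node n + 2, and x^(-2p)
    turns (x^(n+2))^p back into (x^n)^p.\<close>
  define C2 where "C2 = C1 * Q * x powr (- (2 * p))"
  have C2: "0 < C2" using C1 Q x by (simp add: C2_def)
  \<comment> \<open>The factor 4 and the half gap come from Cauchy's estimate, \<open>Q\<close> from
    moving to the next node weight.\<close>
  define C3 where "C3 = 4 * ((1 - x) / 2) powr (- p) * Q"
  have C3: "0 < C3" using Q x by (simp add: C3_def)
  show ?thesis
  proof (rule comparable_onI[of "1 / (1 - \<kappa>) * (node_weight \<gamma> 0 + C2)" _ _ _ "C3 + 1 / node_weight \<gamma> 0"])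
    fix f :: "complex \<Rightarrow> complex"
    assume "f \<in> {f. f holomorphic_on ball 0 1}"
    then have f: "f holomorphic_on ball 0 1" by simp
    define a where "a = (\<lambda>n. circle_mean p f (node n))"
    define b where "b = (\<lambda>n. circle_mean p (deriv f) (node n))"
    define u where "u = node_weight \<gamma>"
    define v where "v = node_weight (\<gamma> + p)"
    have a0: "0 \<le> a n" and b0: "0 \<le> b n" for n by (simp_all add: a_def b_def circle_mean_nonneg)
    have u0: "0 < u n" and v0: "0 < v n" for n by (simp_all add: u_def v_def node_weight_pos)
    have uQ: "u n \<le> Q * u (Suc n)" for n using node_weight_le_Suc[of \<gamma> n] by (simp add: u_def Q_def)
    have u\<theta>: "u (Suc n) \<le> \<theta> * u n" for n using node_weight_Suc_le[OF \<gamma>] by (simp add: u_def)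
    have vu: "v n = (x ^ n) powr p * u n" for n by (simp add: u_def v_def node_weight_add)
    have suma: "mean_sum p \<gamma> f = (\<Sum>n. ennreal (a n * u n))" by (simp add: mean_sum_def a_def u_def)
    have sumb: "mean_sum p (\<gamma> + p) (deriv f) = (\<Sum>n. ennreal (b n * v n))"
      by (simp add: mean_sum_def b_def v_def)
    have f0: "norm (f 0) powr p = a 0" by (simp add: a_def circle_mean_0)
    have step: "a (Suc n) * u (Suc n) \<le> \<kappa> * (a n * u n) + C2 * (b (Suc (Suc n)) * v (Suc (Suc n)))" for n
    proof -
      define d where "d = x ^ n * (1 - x)"
      have d: "0 < d" using x by (simp add: d_def)
      \<comment> \<open>With \<rho> equal to the length x d of the next gap, the radius s + \<rho>
        is exactly node n + 2.\<close>
      have nd: "node (Suc n) - node n = d" "node (Suc n) + x * d = node (Suc (Suc n))"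
        using node_diff[of n] node_diff[of "Suc n"] by (simp_all add: d_def)
      have "a (Suc n) \<le> (1 + (1 - \<theta>)) * a n
          + C * d powr p * ((d + x * d) / (x * d))\<^sup>2 * b (Suc (Suc n))"
        using C(2)[OF f node_nonneg[of n] node_less_Suc[of n], of "x * d"] d x node_less_1[of "Suc (Suc n)"]
        unfolding nd a_def b_def by auto
      also have "(d + x * d) / (x * d) = (1 + x) / x"
        using d x by (simp add: field_simps)
      also have "C * d powr p * ((1 + x) / x)\<^sup>2 = C1 * (x ^ n) powr p"
        using x by (simp add: d_def C1_def powr_mult)
      finally have "a (Suc n) * u (Suc n) \<le> ((1 + (1 - \<theta>)) * a n + C1 * (x ^ n) powr p * b (Suc (Suc n))) * u (Suc n)"
        using u0[of "Suc n"] by (intro mult_right_mono) auto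
      also have "\<dots> = (1 + (1 - \<theta>)) * a n * u (Suc n) + C1 * (x ^ n) powr p * b (Suc (Suc n)) * u (Suc n)"
        by (simp add: distrib_right)
      also have "\<dots> \<le> (1 + (1 - \<theta>)) * a n * (\<theta> * u n)
           + C1 * (x ^ n) powr p * b (Suc (Suc n)) * (Q * u (Suc (Suc n)))"
        using u\<theta> uQ a0 b0 \<theta> C1 by (intro add_mono mult_left_mono) auto
      also have "C1 * (x ^ n) powr p * b (Suc (Suc n)) * (Q * u (Suc (Suc n)))
          = C2 * (b (Suc (Suc n)) * v (Suc (Suc n)))"
      proof -
        have "(x ^ Suc (Suc n)) powr p = x powr (2 * p) * (x ^ n) powr p"
          using x by (simp add: powr_mult powr_add[symmetric] mult.assoc[symmetric])
        then have "(x ^ n) powr p = x powr (- (2 * p)) * (x ^ Suc (Suc n)) powr p"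
          using x by (simp add: powr_minus)
        then show ?thesis by (simp only: vu C2_def mult_ac)
      qed
      finally show ?thesis by (simp add: \<kappa>_def mult_ac)
    qed
    show "mean_sum p \<gamma> f \<le> ennreal (1 / (1 - \<kappa>) * (node_weight \<gamma> 0 + C2)) *
        (mean_sum p (\<gamma> + p) (deriv f) + ennreal (norm (f 0) powr p))"
    proof -
      define Y where "Y = (\<Sum>n. ennreal (b n * v n))"
      have "mean_sum p \<gamma> f \<le> ennreal (1 / (1 - \<kappa>)) *
          (ennreal (a 0 * u 0) + (\<Sum>n. ennreal (C2 * (b (Suc (Suc n)) * v (Suc (Suc n))))))"
        unfolding suma
        by (rule suminf_le_of_geometric_recursion) (use a0 b0 u0 v0 \<kappa> C2 step in \<open>auto simp: less_imp_le\<close>)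
      also have "(\<Sum>n. ennreal (C2 * (b (Suc (Suc n)) * v (Suc (Suc n)))))
          = ennreal C2 * (\<Sum>n. ennreal (b (Suc (Suc n)) * v (Suc (Suc n))))"
        using C2 b0 v0 by (subst ennreal_suminf_cmult[symmetric]) (simp add: ennreal_mult less_imp_le)
      also have "(\<Sum>n. ennreal (b (Suc (Suc n)) * v (Suc (Suc n)))) \<le> Y"
        unfolding Y_def
        by (rule order_trans[OF suminf_ennreal_Suc_le suminf_ennreal_Suc_le])
      also have "ennreal (a 0 * u 0) = ennreal (u 0) * ennreal (a 0)"
        using a0 u0 by (simp add: ennreal_mult[symmetric] less_imp_le mult.commute)
      also have "ennreal (u 0) * ennreal (a 0) + ennreal C2 * Y
          \<le> ennreal (u 0 + C2) * ennreal (a 0) + ennreal (u 0 + C2) * Y"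
        using u0[of 0] C2 by (intro add_mono mult_right_mono ennreal_leI) auto
      also have "\<dots> = ennreal (u 0 + C2) * (Y + ennreal (a 0))"
        by (simp add: distrib_left add.commute)
      also have "ennreal (1 / (1 - \<kappa>)) * (ennreal (u 0 + C2) * (Y + ennreal (a 0)))
          = ennreal (1 / (1 - \<kappa>) * (u 0 + C2)) * (Y + ennreal (a 0))"
      proof -
        have "ennreal (1 / (1 - \<kappa>) * (u 0 + C2)) = ennreal (1 / (1 - \<kappa>)) * ennreal (u 0 + C2)"
          using u0[of 0] C2 \<kappa> by (intro ennreal_mult) auto
        then show ?thesis by (simp only: mult.assoc)
      qed
      finally show ?thesis
        by (simp add: sumb Y_def f0 u_def mult_left_mono add_mono)
    qed
    show "mean_sum p (\<gamma> + p) (deriv f) + ennreal (norm (f 0) powr p)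
        \<le> ennreal (C3 + 1 / node_weight \<gamma> 0) * mean_sum p \<gamma> f"
    proof -
      have term_le: "b n * v n \<le> C3 * (a (Suc n) * u (Suc n))" for n
      proof -
        define d where "d = x ^ n * ((1 - x) / 2)"
        have d: "0 < d" using x by (simp add: d_def)
        have nd: "node n + 2 * d = node (Suc n)" using node_diff[of n] by (simp add: d_def)
        have "d powr p * b n \<le> 4 * a (Suc n)"
          using circle_mean_deriv_le[OF f p node_nonneg[of n] d] node_less_1[of "Suc n"]
          unfolding nd a_def b_def by simp
        then have "((1 - x) / 2) powr (- p) * (d powr p * b n) \<le> ((1 - x) / 2) powr (- p) * (4 * a (Suc n))"
          by (intro mult_left_mono) auto
        also have "((1 - x) / 2) powr (- p) * (d powr p * b n) = (x ^ n) powr p * b n"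
        proof -
          have dp: "d powr p = (x ^ n) powr p * ((1 - x) / 2) powr p"
            unfolding d_def by (rule powr_mult)
          have one: "((1 - x) / 2) powr (- p) * ((1 - x) / 2) powr p = 1"
            using x by (simp add: powr_minus)
          have "((1 - x) / 2) powr (- p) * (d powr p * b n)
              = (((1 - x) / 2) powr (- p) * ((1 - x) / 2) powr p) * ((x ^ n) powr p * b n)"
            unfolding dp by (simp only: mult_ac)
          then show ?thesis by (simp only: one mult_1)
        qed
        finally have m: "(x ^ n) powr p * b n \<le> ((1 - x) / 2) powr (- p) * (4 * a (Suc n))" .
        have "b n * v n = (x ^ n) powr p * b n * u n"
          unfolding vu by (simp only: mult_ac)
        also have "\<dots> \<le> ((1 - x) / 2) powr (- p) * (4 * a (Suc n)) * (Q * u (Suc n))"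
          by (rule mult_mono[OF m uQ]) (use a0[of "Suc n"] u0[of n] in \<open>auto simp: less_imp_le\<close>)
        also have "\<dots> = C3 * (a (Suc n) * u (Suc n))"
          unfolding C3_def by (simp only: mult_ac)
        finally show ?thesis .
      qed
      have "(\<Sum>n. ennreal (b n * v n)) \<le> (\<Sum>n. ennreal C3 * ennreal (a (Suc n) * u (Suc n)))"
      proof (intro suminf_le summableI)
        fix n
        have "ennreal C3 * ennreal (a (Suc n) * u (Suc n)) = ennreal (C3 * (a (Suc n) * u (Suc n)))"
          using C3 a0[of "Suc n"] u0[of "Suc n"] by (intro ennreal_mult[symmetric]) auto
        then show "ennreal (b n * v n) \<le> ennreal C3 * ennreal (a (Suc n) * u (Suc n))"
          by (simp only: ennreal_leI[OF term_le])
      qed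
      also have "\<dots> = ennreal C3 * (\<Sum>n. ennreal (a (Suc n) * u (Suc n)))"
        by (rule ennreal_suminf_cmult)
      also have "\<dots> \<le> ennreal C3 * (\<Sum>n. ennreal (a n * u n))"
        by (intro mult_left_mono suminf_ennreal_Suc_le) simp
      finally have 1: "(\<Sum>n. ennreal (b n * v n)) \<le> ennreal C3 * (\<Sum>n. ennreal (a n * u n))" .
      \<comment> \<open>Node 0 is the origin, so |f(0)|^p is the mean in the initial term of the
        series.\<close>
      have "ennreal (a 0) = ennreal (1 / u 0) * ennreal (a 0 * u 0)"
        using u0[of 0] a0[of 0] by (simp add: ennreal_mult[symmetric] less_imp_le)
      also have "\<dots> \<le> ennreal (1 / u 0) * (\<Sum>n. ennreal (a n * u n))"
        using sum_le_suminf[of "\<lambda>n. ennreal (a n * u n)" "{0}"] by (intro mult_left_mono) auto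
      finally have "(\<Sum>n. ennreal (b n * v n)) + ennreal (a 0)
          \<le> ennreal C3 * (\<Sum>n. ennreal (a n * u n)) + ennreal (1 / u 0) * (\<Sum>n. ennreal (a n * u n))"
        using 1 by (intro add_mono)
      also have "\<dots> = ennreal (C3 + 1 / u 0) * (\<Sum>n. ennreal (a n * u n))"
        using C3 u0[of 0] by (simp add: distrib_right less_imp_le)
      finally show ?thesis by (simp add: suma sumb f0 u_def)
    qed
  next
    show "0 < 1 / (1 - \<kappa>) * (node_weight \<gamma> 0 + C2)"
      using \<kappa> C2 node_weight_pos[of \<gamma> 0] by (intro mult_pos_pos divide_pos_pos add_pos_pos) simp_all
    show "0 < C3 + 1 / node_weight \<gamma> 0"
      using C3 node_weight_pos[of \<gamma> 0] by (intro divide_pos_pos add_pos_pos) simp_all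
  qed
qed

text \<open>The induction runs on sums over nodes, so the passage to integrals is made only once on
  either side.\<close>

lemma comparable_mean_sum_higher_deriv:
  assumes p: "0 < p"
  shows "comparable_on {f. f holomorphic_on ball 0 1} (mean_sum p 0)
    (\<lambda>f. mean_sum p (real k * p) ((deriv ^^ k) f) + ennreal (\<Sum>j<k. norm ((deriv ^^ j) f 0) powr p))"
proof (induction k)
  case 0
  then show ?case by (simp add: comparable_on_refl)
next
  case (Suc k)
  note Suc.IH
  also have "comparable_on {f. f holomorphic_on ball 0 1}
    (\<lambda>f. mean_sum p (real k * p) ((deriv ^^ k) f) + ennreal (\<Sum>j<k. norm ((deriv ^^ j) f 0) powr p))
    (\<lambda>f. (mean_sum p (real k * p + p) (deriv ((deriv ^^ k) f)) + ennreal (norm ((deriv ^^ k) f 0) powr p))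
       + ennreal (\<Sum>j<k. norm ((deriv ^^ j) f 0) powr p))"
  proof (rule comparable_on_add[OF comparable_on_compose[OF comparable_mean_sum_deriv[OF p]] comparable_on_refl])
    show "0 \<le> real k * p" using p by simp
    show "(deriv ^^ k) f \<in> {f. f holomorphic_on ball 0 1}" if "f \<in> {f. f holomorphic_on ball 0 1}" for f
      using that by (simp add: holomorphic_higher_deriv)
  qed
  also have "(\<lambda>f. (mean_sum p (real k * p + p) (deriv ((deriv ^^ k) f)) + ennreal (norm ((deriv ^^ k) f 0) powr p))
       + ennreal (\<Sum>j<k. norm ((deriv ^^ j) f 0) powr p))
     = (\<lambda>f. mean_sum p (real (Suc k) * p) ((deriv ^^ Suc k) f)
       + ennreal (\<Sum>j<Suc k. norm ((deriv ^^ j) f 0) powr p))"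
    by (auto simp: fun_eq_iff ennreal_plus sum_nonneg algebra_simps)
  finally show ?case .
qed

theorem comparable_mean_integral_higher_deriv:
  assumes p: "0 < p"
  shows "comparable_on {f. f holomorphic_on ball 0 1} (mean_integral p 0)
    (\<lambda>f. mean_integral p (real k * p) ((deriv ^^ k) f) + ennreal (\<Sum>j<k. norm ((deriv ^^ j) f 0) powr p))"
proof -
  have "comparable_on {f. f holomorphic_on ball 0 1} (mean_integral p 0) (mean_sum p 0)"
    using p by (intro comparable_mean_integral_sum) auto
  also note comparable_mean_sum_higher_deriv[OF p, of k]
  also have "comparable_on {f. f holomorphic_on ball 0 1}
    (\<lambda>f. mean_sum p (real k * p) ((deriv ^^ k) f) + ennreal (\<Sum>j<k. norm ((deriv ^^ j) f 0) powr p))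
    (\<lambda>f. mean_integral p (real k * p) ((deriv ^^ k) f) + ennreal (\<Sum>j<k. norm ((deriv ^^ j) f 0) powr p))"
    using p by (intro comparable_on_add[OF comparable_on_compose[OF comparable_on_sym[OF comparable_mean_integral_sum]] comparable_on_refl])
      (auto simp: holomorphic_higher_deriv)
  finally show ?thesis .
qed

end

section \<open>Monomials\<close>


lemma circle_mean_monomial:
  assumes "0 \<le> r"
  shows "circle_mean p (\<lambda>z. c * z ^ n) r = (norm c * r ^ n) powr p"
  using assms by (simp add: circle_mean_def norm_mult norm_power)

text \<open>The coefficient is the falling factorial n (n - 1) ... (n - j + 1). For j > n the
  truncated difference \<open>Suc n - j\<close> is 0, and so is the coefficient.\<close>

lemma higher_deriv_monomial:
  "(deriv ^^ j) (\<lambda>z. z ^ n) = (\<lambda>z::complex. pochhammer (of_nat (Suc n - j)) j * z ^ (n - j))"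
  using higher_deriv_power[of j "0::complex" n] by (simp add: fun_eq_iff)

text \<open>Each of the k factors lies between n/2 and n, because 2k <= n.\<close>

lemma norm_pochhammer_bounds:
  assumes "2 * k \<le> n"
  shows "norm (pochhammer (of_nat (Suc n - k)) k :: complex) \<le> real n ^ k"
    and "(real n / 2) ^ k \<le> norm (pochhammer (of_nat (Suc n - k)) k :: complex)"
proof -
  have eq: "norm (pochhammer (of_nat (Suc n - k)) k :: complex) = (\<Prod>i<k. real (Suc n - k + i))"
    by (simp add: pochhammer_prod prod_norm[symmetric] atLeast0LessThan flip: of_nat_add)
  have "(\<Prod>i<k. real (Suc n - k + i)) \<le> (\<Prod>i<k. real n)"
    using assms by (intro prod_mono) auto
  then show "norm (pochhammer (of_nat (Suc n - k)) k :: complex) \<le> real n ^ k"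
    by (simp add: eq)
  have "(\<Prod>i<k. real n / 2) \<le> (\<Prod>i<k. real (Suc n - k + i))"
    using assms by (intro prod_mono) auto
  then show "(real n / 2) ^ k \<le> norm (pochhammer (of_nat (Suc n - k)) k :: complex)"
    by (simp add: eq)
qed

text \<open>Radial integrand of |z^n|^p, with the 2 of the factor 2 r left out.\<close>

definition monomial_weight :: "real \<Rightarrow> nat \<Rightarrow> real \<Rightarrow> real" where
  "monomial_weight p n r = (r ^ n) powr p * r"

text \<open>Radial integrand for the k-th derivative of z^n, with n^k in place of the falling
  factorial. Grouping n with 1 - r shows that the natural scale is distance 1/n from 1.\<close>

definition monomial_deriv_weight :: "real \<Rightarrow> nat \<Rightarrow> nat \<Rightarrow> real \<Rightarrow> real" where
  "monomial_deriv_weight p k n r = ((real n * (1 - r)) ^ k * r ^ (n - k)) powr p * r"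

lemma borel_measurable_monomial_weight [measurable]:
  "monomial_weight p n \<in> borel_measurable borel" "monomial_deriv_weight p k n \<in> borel_measurable borel"
  unfolding monomial_weight_def monomial_deriv_weight_def by measurable

lemma monomial_weight_bounds:
  assumes "0 \<le> r" "r < 1" "0 < p"
  shows "0 \<le> monomial_weight p n r" "monomial_weight p n r \<le> 1"
proof -
  have "(r ^ n) powr p \<le> 1" using assms by (intro powr_le1) (auto intro: power_le_one)
  then show "monomial_weight p n r \<le> 1"
    using mult_mono[of "(r ^ n) powr p" 1 r 1] assms by (simp add: monomial_weight_def)
qed (use assms in \<open>simp add: monomial_weight_def\<close>)

lemma monomial_deriv_weight_bounds:
  assumes "0 \<le> r" "r < 1" "0 < p"
  shows "0 \<le> monomial_deriv_weight p k n r" "monomial_deriv_weight p k n r \<le> (real n ^ k) powr p"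
proof -
  have "(real n * (1 - r)) ^ k * r ^ (n - k) \<le> (real n * 1) ^ k * 1"
    using assms by (intro mult_mono power_mono mult_left_mono) (auto intro: power_le_one)
  then have "((real n * (1 - r)) ^ k * r ^ (n - k)) powr p \<le> (real n ^ k) powr p"
    using assms by (intro powr_mono2) auto
  then show "monomial_deriv_weight p k n r \<le> (real n ^ k) powr p"
    using mult_mono[of "((real n * (1 - r)) ^ k * r ^ (n - k)) powr p" "(real n ^ k) powr p" r 1] assms
    by (simp add: monomial_deriv_weight_def)
qed (use assms in \<open>simp add: monomial_deriv_weight_def\<close>)

text \<open>At distance at least b/n from 1 the factor n (1 - r) is at least b, and having k fewer
  powers of r only helps.\<close>

lemma monomial_deriv_weight_ge:
  assumes r: "0 \<le> r" "r \<le> 1 - b / real n" and b: "0 < b" and p: "0 < p" and n: "0 < n"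
  shows "b powr (real k * p) * monomial_weight p n r \<le> monomial_deriv_weight p k n r"
proof -
  have rb: "b \<le> real n * (1 - r)" using r n by (simp add: field_simps)
  have "0 < b / real n" using b n by simp
  then have r1: "r \<le> 1" using r by linarith
  have "b ^ k * r ^ n \<le> (real n * (1 - r)) ^ k * r ^ (n - k)"
    using rb b r r1 by (intro mult_mono power_mono power_decreasing) auto
  then have "(b ^ k * r ^ n) powr p \<le> ((real n * (1 - r)) ^ k * r ^ (n - k)) powr p"
    using b r p by (intro powr_mono2) auto
  moreover have "(b ^ k * r ^ n) powr p = b powr (real k * p) * (r ^ n) powr p"
    using b r by (simp add: powr_mult powr_powr flip: powr_realpow)
  ultimately have "b powr (real k * p) * (r ^ n) powr p * r
      \<le> ((real n * (1 - r)) ^ k * r ^ (n - k)) powr p * r"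
    using r by (intro mult_right_mono) auto
  then show ?thesis
    by (simp add: monomial_weight_def monomial_deriv_weight_def mult.assoc)
qed

text \<open>With y = a/n <= 1/2 one has 1 - y >= exp(-2y), so r^n >= exp(-2a) on the whole interval;
  the factor 1/2 bounds the remaining r.\<close>

lemma monomial_weight_ge:
  assumes r: "1 - a / real n \<le> r" "r < 1" and a: "0 < a" and p: "0 < p" and n: "2 * a \<le> real n"
  shows "exp (- 2 * a * p) / 2 \<le> monomial_weight p n r"
proof -
  define y where "y = a / real n"
  have n0: "0 < real n" using a n by linarith
  have y: "0 < y" "y \<le> 1 / 2" using a n n0 by (simp_all add: y_def field_simps)
  have r2: "1 / 2 \<le> r" using r y by (simp add: y_def)
  have "exp (- 2 * y) \<le> 1 - y"
  proof -
    have "ln (1 - y) \<ge> - 2 * y"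
    proof -
      have "ln (1 / (1 - y)) \<le> 1 / (1 - y) - 1" using y by (intro ln_le_minus_one) auto
      also have "\<dots> = y / (1 - y)" using y by (simp add: field_simps)
      also have "\<dots> \<le> 2 * y" using y by (simp add: divide_le_eq)
      finally show ?thesis using y by (simp add: ln_div)
    qed
    then have "exp (- 2 * y) \<le> exp (ln (1 - y))" by simp
    then show ?thesis using y by simp
  qed
  then have "exp (- 2 * y) ^ n \<le> r ^ n"
    using r by (intro power_mono) (auto simp: y_def)
  moreover have "exp (- 2 * y) ^ n = exp (- 2 * a)"
    using n0 by (simp add: y_def flip: exp_of_nat_mult)
  ultimately have "exp (- 2 * a) powr p \<le> (r ^ n) powr p"
    using p by (intro powr_mono2) auto
  then have "exp (- 2 * a) powr p * (1 / 2) \<le> (r ^ n) powr p * r"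
    using r2 by (intro mult_mono) auto
  then show ?thesis by (simp add: monomial_weight_def exp_powr_real)
qed

text \<open>Split \<open>[0, 1)\<close> at distances \<open>\<epsilon>/n\<close> and \<open>a/n\<close> from \<open>1\<close>, with \<open>n = 2m\<close>. Far from \<open>1\<close> half of the
  factor \<open>r ^ n\<close> is exponentially small in \<open>a\<close>, and the other half is the weight with index \<open>m\<close>.\<close>

lemma monomial_deriv_weight_split:
  assumes r: "0 \<le> r" "r < 1" and p: "0 < p" and m: "0 < m" "k \<le> m"
    and \<epsilon>: "0 < \<epsilon>" "\<epsilon> \<le> real m" and a: "\<epsilon> \<le> a"
  defines "n \<equiv> 2 * m"
  shows "monomial_deriv_weight p k n r
    \<le> (2 * \<epsilon>) powr (real k * p) * monomial_weight p n r
      + (2 powr (real k * p) * exp (- (a * p / 2)) * monomial_deriv_weight p k m r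
      + a powr (real k * p) * indicator {1 - a / real n..<1 - \<epsilon> / real n} r)"
    (is "?D \<le> ?X + (?Y + ?Z)")
proof -
  have n: "0 < real n" using m by (simp add: n_def)
  have kn: "k \<le> n" using m by (simp add: n_def)
  have X: "0 \<le> ?X" using monomial_weight_bounds(1)[OF r p] by simp
  have Y: "0 \<le> ?Y" using monomial_deriv_weight_bounds(1)[OF r p] by simp
  have Z: "0 \<le> ?Z" by simp
  \<comment> \<open>All three terms are nonnegative, so each range needs only one of them: the first
    near 1, the second far from 1, the last in between.\<close>
  consider "1 - \<epsilon> / real n \<le> r" | "r < 1 - a / real n" | "1 - a / real n \<le> r" "r < 1 - \<epsilon> / real n"
    by linarith
  then show ?thesis
  proof cases
    case 1
    have "real n * (1 - r) \<le> \<epsilon>" using 1 n by (simp add: field_simps)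
    moreover have r2: "1 / 2 \<le> r"
    proof -
      have "\<epsilon> / real n \<le> 1 / 2" using \<epsilon> m by (simp add: n_def field_simps)
      then show ?thesis using 1 by linarith
    qed
    \<comment> \<open>Here r >= 1/2, so the k missing powers of r cost at most 2^k.\<close>
    moreover have "r ^ (n - k) \<le> 2 ^ k * r ^ n"
    proof -
      have "1 \<le> (2 * r) ^ k" using r2 by (intro one_le_power) auto
      then have "1 * r ^ (n - k) \<le> (2 * r) ^ k * r ^ (n - k)" using r by (intro mult_right_mono) auto
      also have "\<dots> = 2 ^ k * (r ^ k * r ^ (n - k))" by (simp add: power_mult_distrib)
      also have "r ^ k * r ^ (n - k) = r ^ n" using kn by (simp flip: power_add)
      finally show ?thesis by simp
    qed
    ultimately have "(real n * (1 - r)) ^ k * r ^ (n - k) \<le> \<epsilon> ^ k * (2 ^ k * r ^ n)"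
      using r n \<epsilon> by (intro mult_mono power_mono) auto
    then have "((real n * (1 - r)) ^ k * r ^ (n - k)) powr p \<le> ((2 * \<epsilon>) ^ k * r ^ n) powr p"
      using r n p by (intro powr_mono2) (auto simp: power_mult_distrib mult_ac)
    also have "\<dots> = (2 * \<epsilon>) powr (real k * p) * (r ^ n) powr p"
      using r \<epsilon> by (simp add: powr_mult powr_powr flip: powr_realpow)
    finally have "?D \<le> ?X"
      using mult_right_mono[OF _ r(1)] by (auto simp: monomial_weight_def monomial_deriv_weight_def mult.assoc[symmetric])
    then show ?thesis using Y Z by linarith
  next
    case 2
    have "r ^ m \<le> exp (- (a / 2))"
    proof -
      have "r \<le> exp (- (a / real n))"
        using 2 exp_ge_add_one_self[of "- (a / real n)"] by linarith
      then have "r ^ m \<le> exp (- (a / real n)) ^ m" using r by (intro power_mono)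
      also have "\<dots> = exp (- (a / 2))"
        using m by (simp add: n_def flip: exp_of_nat_mult)
      finally show ?thesis .
    qed
    then have "2 ^ k * ((real m * (1 - r)) ^ k * r ^ (m - k)) * r ^ m
        \<le> 2 ^ k * ((real m * (1 - r)) ^ k * r ^ (m - k)) * exp (- (a / 2))"
      using r by (intro mult_left_mono) auto
    moreover have "(real n * (1 - r)) ^ k * r ^ (n - k) = 2 ^ k * ((real m * (1 - r)) ^ k * r ^ (m - k)) * r ^ m"
    proof -
      \<comment> \<open>Splitting off r^m leaves the weight with index m; writing n (1 - r) as 2 m
        (1 - r) gives 2^k.\<close>
      have e1: "n - k = (m - k) + m" using m by (simp add: n_def)
      have e2: "real n * (1 - r) = 2 * (real m * (1 - r))" by (simp add: n_def)
      show ?thesis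
        unfolding e1 e2 power_add power_mult_distrib[of 2] by (simp only: mult_ac)
    qed
    ultimately have "((real n * (1 - r)) ^ k * r ^ (n - k)) powr p
        \<le> (2 ^ k * ((real m * (1 - r)) ^ k * r ^ (m - k)) * exp (- (a / 2))) powr p"
      using r p by (intro powr_mono2) auto
    also have "\<dots> = 2 powr (real k * p) * exp (- (a * p / 2)) * ((real m * (1 - r)) ^ k * r ^ (m - k)) powr p"
    proof -
      have "(2 ^ k :: real) powr p = 2 powr (real k * p)" by (simp add: powr_powr flip: powr_realpow)
      moreover have "exp (- (a / 2)) powr p = exp (- (a * p / 2))" by (simp add: exp_powr_real)
      ultimately show ?thesis by (simp only: powr_mult mult_ac)
    qed
    finally have "?D \<le> ?Y"
      using mult_right_mono[OF _ r(1)] by (auto simp: monomial_deriv_weight_def mult.assoc[symmetric])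
    then show ?thesis using X Z by linarith
  next
    case 3
    have "real n * (1 - r) \<le> a" using 3 n by (simp add: field_simps)
    then have "(real n * (1 - r)) ^ k * r ^ (n - k) \<le> a ^ k * 1"
      using r n \<epsilon> a by (intro mult_mono power_mono) (auto intro: power_le_one)
    then have "((real n * (1 - r)) ^ k * r ^ (n - k)) powr p \<le> (a ^ k) powr p"
      using r n p by (intro powr_mono2) auto
    then have "((real n * (1 - r)) ^ k * r ^ (n - k)) powr p * r \<le> (a ^ k) powr p * 1"
      using r by (intro mult_mono) auto
    also have "(a ^ k) powr p * 1 = a powr (real k * p)"
      using \<epsilon> a by (simp add: powr_powr flip: powr_realpow)
    also have "\<dots> = ?Z" using 3 by simp
    finally have "?D \<le> ?Z" by (simp add: monomial_deriv_weight_def)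
    then show ?thesis using X Y by linarith
  qed
qed

section \<open>Testing the comparison on monomials\<close>

context radial_measure
begin

lemma integrable_bounded:
  fixes f :: "real \<Rightarrow> real"
  assumes f: "f \<in> borel_measurable borel" and B: "\<And>r. 0 \<le> r \<Longrightarrow> r < 1 \<Longrightarrow> \<bar>f r\<bar> \<le> B"
  shows "integrable \<mu> f"
proof (rule integrable_const_bound)
  show "AE r in \<mu>. norm (f r) \<le> B"
    using AE_unit_interval by eventually_elim (use B in auto)
  show "f \<in> borel_measurable \<mu>" using f by (simp add: sets_eq cong: measurable_cong_sets)
qed

lemma integrable_monomial_weight:
  assumes "0 < p"
  shows "integrable \<mu> (monomial_weight p n)" "integrable \<mu> (monomial_deriv_weight p k n)"
proof -
  have b: "\<bar>monomial_weight p n r\<bar> \<le> 1" "\<bar>monomial_deriv_weight p k n r\<bar> \<le> (real n ^ k) powr p"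
    if "0 \<le> r" "r < 1" for r
    using monomial_weight_bounds[OF that assms, of n] monomial_deriv_weight_bounds[OF that assms, of k n]
    by linarith+
  show "integrable \<mu> (monomial_weight p n)"
    by (rule integrable_bounded[OF borel_measurable_monomial_weight(1) b(1)])
  show "integrable \<mu> (monomial_deriv_weight p k n)"
    by (rule integrable_bounded[OF borel_measurable_monomial_weight(2) b(2)])
qed

lemma integral_mono_unit_interval:
  fixes f g :: "real \<Rightarrow> real"
  assumes "integrable \<mu> f" "integrable \<mu> g" "\<And>r. 0 \<le> r \<Longrightarrow> r < 1 \<Longrightarrow> f r \<le> g r"
  shows "integral\<^sup>L \<mu> f \<le> integral\<^sup>L \<mu> g"
  using assms(1,2)
  by (rule integral_mono_AE) (use AE_unit_interval in eventually_elim, use assms(3) in auto)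

lemma integral_nonneg_unit_interval:
  fixes f :: "real \<Rightarrow> real"
  assumes "\<And>r. 0 \<le> r \<Longrightarrow> r < 1 \<Longrightarrow> 0 \<le> f r"
  shows "0 \<le> integral\<^sup>L \<mu> f"
  by (rule integral_nonneg_AE) (use AE_unit_interval in eventually_elim, use assms in auto)

lemma integral_indicator_Ico:
  assumes "r \<le> s" "s \<le> 1"
  shows "integral\<^sup>L \<mu> (indicator {r..<s}) = tail r - tail s" "integrable \<mu> (indicator {r..<s} :: real \<Rightarrow> real)"
  using assms by (simp_all add: sets_eq measure_Ico_eq_tail_diff space_eq emeasure_eq_measure)

lemma tail_1: "tail 1 = 0"
  by (simp add: tail_def)

text \<open>For f = z^n with n >= 2k and n > 0, the derivatives of order below k vanish at 0, so the
  correction sum is 0, and replacing the falling factorial by n^k costs at most 2^(kp). The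
  integrals are finite, which allows passing to real numbers.\<close>

lemma comparable_monomials:
  assumes p: "0 < p"
    and comp: "comparable_on {f. f holomorphic_on ball 0 1} (mean_integral p 0)
      (\<lambda>f. mean_integral p (real k * p) ((deriv ^^ k) f) + ennreal (\<Sum>j<k. norm ((deriv ^^ j) f 0) powr p))"
  obtains C where "0 < C"
    "\<And>n. 2 * k \<le> n \<Longrightarrow> 0 < n \<Longrightarrow> integral\<^sup>L \<mu> (monomial_weight p n) \<le> C * integral\<^sup>L \<mu> (monomial_deriv_weight p k n)"
    "\<And>n. 2 * k \<le> n \<Longrightarrow> 0 < n \<Longrightarrow> integral\<^sup>L \<mu> (monomial_deriv_weight p k n) \<le> C * integral\<^sup>L \<mu> (monomial_weight p n)"
proof -
  obtain C where C: "0 < C"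
    "\<And>f. f holomorphic_on ball 0 1 \<Longrightarrow> mean_integral p 0 f \<le> ennreal C *
      (mean_integral p (real k * p) ((deriv ^^ k) f) + ennreal (\<Sum>j<k. norm ((deriv ^^ j) f 0) powr p))"
    "\<And>f. f holomorphic_on ball 0 1 \<Longrightarrow> mean_integral p (real k * p) ((deriv ^^ k) f)
        + ennreal (\<Sum>j<k. norm ((deriv ^^ j) f 0) powr p) \<le> ennreal C * mean_integral p 0 f"
    using comp unfolding comparable_on_def by auto
  have nn: "(\<integral>\<^sup>+r. ennreal (2 * f r) \<partial>\<mu>) = ennreal (2 * integral\<^sup>L \<mu> f)"
    if "integrable \<mu> f" "\<And>r. 0 \<le> r \<Longrightarrow> r < 1 \<Longrightarrow> 0 \<le> f r" for f
  proof -
    have "AE r in \<mu>. 0 \<le> 2 * f r" using AE_unit_interval by eventually_elim (use that in auto)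
    then show ?thesis using that(1) by (subst nn_integral_eq_integral) auto
  qed
  define D where "D = 2 powr (real k * p)"
  have D: "1 \<le> D" using p by (simp add: D_def ge_one_powr_ge_zero)
  have main: "integral\<^sup>L \<mu> (monomial_weight p n) \<le> C * integral\<^sup>L \<mu> (monomial_deriv_weight p k n)"
      "integral\<^sup>L \<mu> (monomial_deriv_weight p k n) \<le> D * (C * integral\<^sup>L \<mu> (monomial_weight p n))"
    if n: "2 * k \<le> n" "0 < n" for n
  proof -
    define f where "f = (\<lambda>z::complex. z ^ n)"
    define c where "c = norm (pochhammer (of_nat (Suc n - k)) k :: complex)"
    have c: "c \<le> real n ^ k" "(real n / 2) ^ k \<le> c"
      using norm_pochhammer_bounds[OF n(1)] by (simp_all add: c_def)
    have f: "f holomorphic_on ball 0 1" unfolding f_def by (intro holomorphic_intros)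
    have If: "mean_integral p 0 f = ennreal (2 * integral\<^sup>L \<mu> (monomial_weight p n))"
    proof -
      have "mean_integral p 0 f = (\<integral>\<^sup>+r. ennreal (2 * monomial_weight p n r) \<partial>\<mu>)"
        unfolding mean_integral_def
        by (rule nn_integral_cong_AE, use AE_unit_interval in eventually_elim)
           (use circle_mean_monomial[of _ p 1 n] in \<open>simp add: f_def monomial_weight_def mult_ac\<close>)
      then show ?thesis using nn integrable_monomial_weight[OF p] monomial_weight_bounds[OF _ _ p] by auto
    qed
    \<comment> \<open>\<open>g\<close> carries the exact coefficient \<open>c\<close> where the
      derivative weight has n^k.\<close>
    define g where "g = (\<lambda>r. (c * (1 - r) ^ k * r ^ (n - k)) powr p * r)"
    have g_le: "g r \<le> monomial_deriv_weight p k n r" and g_ge: "monomial_deriv_weight p k n r \<le> D * g r"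
      and g0: "0 \<le> g r"
      if r: "0 \<le> r" "r < 1" for r
    proof -
      have c0: "0 \<le> c" by (simp add: c_def)
      have "c * (1 - r) ^ k * r ^ (n - k) \<le> real n ^ k * (1 - r) ^ k * r ^ (n - k)"
        using r c by (intro mult_right_mono) auto
      then have "(c * (1 - r) ^ k * r ^ (n - k)) powr p \<le> ((real n * (1 - r)) ^ k * r ^ (n - k)) powr p"
        using r c0 p by (intro powr_mono2) (auto simp: power_mult_distrib)
      then show "g r \<le> monomial_deriv_weight p k n r"
        unfolding g_def monomial_deriv_weight_def using r by (intro mult_right_mono) auto
      have "real n ^ k * (1 - r) ^ k * r ^ (n - k) \<le> 2 ^ k * c * (1 - r) ^ k * r ^ (n - k)"
        using r c by (intro mult_right_mono) (auto simp: power_divide field_simps)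
      then have "((real n * (1 - r)) ^ k * r ^ (n - k)) powr p \<le> (2 ^ k * (c * (1 - r) ^ k * r ^ (n - k))) powr p"
        using r c0 p by (intro powr_mono2) (auto simp: power_mult_distrib mult.assoc)
      also have "\<dots> = D * (c * (1 - r) ^ k * r ^ (n - k)) powr p"
        by (simp add: D_def powr_mult powr_powr flip: powr_realpow)
      finally have "((real n * (1 - r)) ^ k * r ^ (n - k)) powr p * r \<le> D * (c * (1 - r) ^ k * r ^ (n - k)) powr p * r"
        using r by (intro mult_right_mono)
      then show "monomial_deriv_weight p k n r \<le> D * g r"
        by (simp add: g_def monomial_deriv_weight_def mult.assoc)
      show "0 \<le> g r" using r by (simp add: g_def)
    qed
    have intg: "integrable \<mu> g"
    proof (rule integrable_bounded)
      show "g \<in> borel_measurable borel" unfolding g_def by measurable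
      show "\<bar>g r\<bar> \<le> (real n ^ k) powr p" if r: "0 \<le> r" "r < 1" for r
        using g_le[OF r] g0[OF r] monomial_deriv_weight_bounds(2)[OF r p, of k n] by linarith
    qed
    have Ig: "mean_integral p (real k * p) ((deriv ^^ k) f) = ennreal (2 * integral\<^sup>L \<mu> g)"
    proof -
      have "mean_integral p (real k * p) ((deriv ^^ k) f) = (\<integral>\<^sup>+r. ennreal (2 * g r) \<partial>\<mu>)"
        unfolding mean_integral_def
      proof (rule nn_integral_cong_AE, use AE_unit_interval in eventually_elim)
        fix r :: real assume r: "0 \<le> r \<and> r < 1"
        have "circle_mean p ((deriv ^^ k) f) r = (c * r ^ (n - k)) powr p"
          unfolding f_def higher_deriv_monomial c_def using r by (intro circle_mean_monomial) auto
        moreover have "(1 - r) powr (real k * p) = ((1 - r) ^ k) powr p"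
          using r by (simp add: powr_powr flip: powr_realpow)
        ultimately have "circle_mean p ((deriv ^^ k) f) r * (1 - r) powr (real k * p)
            = (c * (1 - r) ^ k * r ^ (n - k)) powr p"
          by (simp only: powr_mult mult_ac)
        then show "ennreal (circle_mean p ((deriv ^^ k) f) r * (1 - r) powr (real k * p) * (2 * r)) = ennreal (2 * g r)"
          by (simp add: g_def mult.left_commute)
      qed
      then show ?thesis using nn[OF intg g0] by simp
    qed
    have S: "(\<Sum>j<k. norm ((deriv ^^ j) f 0) powr p) = 0"
      using n by (intro sum.neutral) (auto simp: f_def higher_deriv_monomial)
    have "0 \<le> integral\<^sup>L \<mu> g"
      by (rule integral_nonneg_unit_interval) (rule g0)
    moreover have "0 \<le> integral\<^sup>L \<mu> (monomial_weight p n)"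
      by (rule integral_nonneg_unit_interval) (rule monomial_weight_bounds(1)[OF _ _ p])
    ultimately have 1: "integral\<^sup>L \<mu> (monomial_weight p n) \<le> C * integral\<^sup>L \<mu> g"
      and 2: "integral\<^sup>L \<mu> g \<le> C * integral\<^sup>L \<mu> (monomial_weight p n)"
      using C(2,3)[OF f] C(1) unfolding If Ig S
      by (simp_all add: ennreal_mult[symmetric])
    have "integral\<^sup>L \<mu> g \<le> integral\<^sup>L \<mu> (monomial_deriv_weight p k n)"
      by (intro integral_mono_unit_interval intg integrable_monomial_weight p g_le)
    then have "C * integral\<^sup>L \<mu> g \<le> C * integral\<^sup>L \<mu> (monomial_deriv_weight p k n)"
      using C by (intro mult_left_mono) auto
    with 1 show "integral\<^sup>L \<mu> (monomial_weight p n) \<le> C * integral\<^sup>L \<mu> (monomial_deriv_weight p k n)"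
      by linarith
    have "integral\<^sup>L \<mu> (monomial_deriv_weight p k n) \<le> (\<integral>r. D * g r \<partial>\<mu>)"
      by (intro integral_mono_unit_interval integrable_mult_right intg integrable_monomial_weight p g_ge)
    also have "\<dots> = D * integral\<^sup>L \<mu> g" by simp
    also have "\<dots> \<le> D * (C * integral\<^sup>L \<mu> (monomial_weight p n))"
      using 2 D by (intro mult_left_mono) auto
    finally show "integral\<^sup>L \<mu> (monomial_deriv_weight p k n) \<le> D * (C * integral\<^sup>L \<mu> (monomial_weight p n))" .
  qed
  show thesis
  proof (rule that[of "D * C"])
    show "0 < D * C" using C D by simp
    fix n assume n: "2 * k \<le> n" "0 < n"
    have "0 \<le> integral\<^sup>L \<mu> (monomial_deriv_weight p k n)"
      by (rule integral_nonneg_unit_interval) (rule monomial_deriv_weight_bounds(1)[OF _ _ p])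
    then have "C * integral\<^sup>L \<mu> (monomial_deriv_weight p k n) \<le> D * C * integral\<^sup>L \<mu> (monomial_deriv_weight p k n)"
      using C D by (intro mult_right_mono) auto
    with main(1)[OF n] show "integral\<^sup>L \<mu> (monomial_weight p n) \<le> D * C * integral\<^sup>L \<mu> (monomial_deriv_weight p k n)"
      by linarith
    show "integral\<^sup>L \<mu> (monomial_deriv_weight p k n) \<le> D * C * integral\<^sup>L \<mu> (monomial_weight p n)"
      using main(2)[OF n] by (simp add: mult.assoc)
  qed
qed

end

section \<open>Necessity\<close>


context radial_measure
begin

lemma integral_monomial_weight_ge:
  assumes a: "0 < a" and p: "0 < p" and n: "2 * a \<le> real n"
  shows "exp (- 2 * a * p) / 2 * tail (1 - a / real n) \<le> integral\<^sup>L \<mu> (monomial_weight p n)"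
proof -
  have s: "1 - a / real n \<le> 1" using a by simp
  have "(\<integral>r. exp (- 2 * a * p) / 2 * indicator {1 - a / real n..<1} r \<partial>\<mu>) \<le> integral\<^sup>L \<mu> (monomial_weight p n)"
  proof (rule integral_mono_unit_interval)
    show "integrable \<mu> (\<lambda>r. exp (- 2 * a * p) / 2 * indicator {1 - a / real n..<1} r :: real)"
      by (intro integrable_mult_right integral_indicator_Ico(2)[OF s]) simp
    show "exp (- 2 * a * p) / 2 * indicator {1 - a / real n..<1} r \<le> monomial_weight p n r"
      if r: "0 \<le> r" "r < 1" for r
      using monomial_weight_ge[OF _ r(2) a p n] monomial_weight_bounds(1)[OF r p] by (auto simp: indicator_def)
  qed (rule integrable_monomial_weight(1)[OF p])
  then show ?thesis
    using integral_indicator_Ico(1)[OF s] by (simp add: tail_1)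
qed

text \<open>Where r < 1 - b/n the derivative weight is at least 2C times the monomial weight;
  elsewhere the monomial weight is at most 1. After integration the derivative term is at most C
  times the moment, half of the left-hand side, and is absorbed.\<close>

lemma integral_monomial_weight_le:
  assumes p: "0 < p" and C: "0 < C" and b: "0 < b" "2 * C \<le> b powr (real k * p)" and n: "0 < n"
    and le: "integral\<^sup>L \<mu> (monomial_deriv_weight p k n) \<le> C * integral\<^sup>L \<mu> (monomial_weight p n)"
  shows "integral\<^sup>L \<mu> (monomial_weight p n) \<le> 2 * tail (1 - b / real n)"
proof -
  have s: "1 - b / real n \<le> 1" using b by simp
  have int: "integrable \<mu> (indicator {1 - b / real n..<1} :: real \<Rightarrow> real)"
    by (rule integral_indicator_Ico(2)[OF s]) simp
  have "(\<integral>r. 2 * C * monomial_weight p n r \<partial>\<mu>)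
      \<le> (\<integral>r. monomial_deriv_weight p k n r + 2 * C * indicator {1 - b / real n..<1} r \<partial>\<mu>)"
  proof (rule integral_mono_unit_interval)
    show "integrable \<mu> (\<lambda>r. 2 * C * monomial_weight p n r)"
      by (intro integrable_mult_right integrable_monomial_weight p)
    show "integrable \<mu> (\<lambda>r. monomial_deriv_weight p k n r + 2 * C * indicator {1 - b / real n..<1} r)"
      by (intro Bochner_Integration.integrable_add integrable_mult_right integrable_monomial_weight p int)
    fix r :: real assume r: "0 \<le> r" "r < 1"
    note w = monomial_weight_bounds[OF r p, of n] monomial_deriv_weight_bounds(1)[OF r p, of k n]
    show "2 * C * monomial_weight p n r \<le> monomial_deriv_weight p k n r + 2 * C * indicator {1 - b / real n..<1} r"
    proof (cases "r < 1 - b / real n")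
      case True
      then have "b powr (real k * p) * monomial_weight p n r \<le> monomial_deriv_weight p k n r"
        using monomial_deriv_weight_ge[OF r(1) _ b(1) p n, of k] by simp
      moreover have "2 * C * monomial_weight p n r \<le> b powr (real k * p) * monomial_weight p n r"
        using b w by (intro mult_right_mono) auto
      ultimately show ?thesis using True by (simp add: indicator_def)
    next
      case False
      have "2 * C * monomial_weight p n r \<le> 2 * C * 1" using w C by (intro mult_left_mono) auto
      then show ?thesis using False r w by (simp add: indicator_def)
    qed
  qed
  also have "\<dots> = integral\<^sup>L \<mu> (monomial_deriv_weight p k n) + 2 * C * tail (1 - b / real n)"
    using integral_indicator_Ico(1)[OF s] int integrable_monomial_weight(2)[OF p, of k n] by (simp add: tail_1)
  finally have "2 * C * integral\<^sup>L \<mu> (monomial_weight p n)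
      \<le> C * integral\<^sup>L \<mu> (monomial_weight p n) + 2 * C * tail (1 - b / real n)"
    using le by simp
  then have "C * integral\<^sup>L \<mu> (monomial_weight p n) \<le> C * (2 * tail (1 - b / real n))"
    by (simp add: algebra_simps)
  then show ?thesis using C by (subst (asm) mult_le_cancel_left_pos)
qed

text \<open>Given r near 1, let n be 2b/(1 - r) rounded up. Then 1 - b/n is at least (1 + r)/2, and
  as the rounding adds at most 1 <= b/(1 - r), the point 1 - 3b/n is still at most r. This explains
  the factor 3 and the bound b >= 1.\<close>

lemma tail_doubling:
  assumes b: "1 \<le> b" and C: "0 < C"
    and le: "\<And>n. N \<le> n \<Longrightarrow> tail (1 - 3 * b / real n) \<le> C * tail (1 - b / real n)"
  obtains C' where "1 \<le> C'" "\<And>r. 0 \<le> r \<Longrightarrow> r < 1 \<Longrightarrow> tail r \<le> C' * tail ((1 + r) / 2)"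
proof -
  \<comment> \<open>From \<open>r0\<close> on, the index n is at least N; below \<open>r0\<close>
    the two tails lie between fixed positive constants.\<close>
  define r0 where "r0 = max 0 (1 - 2 * b / real (Suc N))"
  have r0: "0 \<le> r0" "r0 < 1" using b by (auto simp: r0_def)
  then have t0: "0 < tail ((1 + r0) / 2)" by (intro tail_pos) auto
  define C' where "C' = max 1 (max C (tail 0 / tail ((1 + r0) / 2)))"
  have "tail r \<le> C' * tail ((1 + r) / 2)" if r: "0 \<le> r" "r < 1" for r
  proof (cases "r0 \<le> r")
    case True
    define n where "n = nat \<lceil>2 * b / (1 - r)\<rceil>"
    have pos: "0 < 2 * b / (1 - r)" using b r by simp
    then have n: "2 * b / (1 - r) \<le> real n" "real n \<le> 2 * b / (1 - r) + 1"
      unfolding n_def by linarith+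
    have "2 * b / real (Suc N) \<ge> 1 - r" using True by (auto simp: r0_def)
    then have "real (Suc N) \<le> 2 * b / (1 - r)" using r by (simp add: field_simps)
    then have N: "N \<le> n" using n by linarith
    have n0: "0 < real n" using n pos by linarith
    have "1 \<le> b / (1 - r)" using b r by (simp add: le_divide_eq)
    moreover have "3 * b / (1 - r) = 2 * b / (1 - r) + b / (1 - r)" by (simp add: add_divide_distrib[symmetric])
    ultimately have "real n \<le> 3 * b / (1 - r)" using n by linarith
    then have "1 - 3 * b / real n \<le> r" using r n0 by (simp add: field_simps)
    then have "tail r \<le> tail (1 - 3 * b / real n)" by (rule tail_antimono)
    also have "\<dots> \<le> C * tail (1 - b / real n)" by (rule le[OF N])
    also have "\<dots> \<le> C * tail ((1 + r) / 2)"
    proof -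
      have "(1 + r) / 2 \<le> 1 - b / real n" using n n0 r by (simp add: field_simps)
      then show ?thesis using C by (intro mult_left_mono tail_antimono) auto
    qed
    also have "\<dots> \<le> C' * tail ((1 + r) / 2)"
      by (intro mult_right_mono tail_nonneg) (auto simp: C'_def)
    finally show ?thesis .
  next
    case False
    have "tail r \<le> tail 0 / tail ((1 + r0) / 2) * tail ((1 + r0) / 2)"
      using t0 tail_antimono[OF r(1)] by simp
    also have "\<dots> \<le> C' * tail ((1 + r) / 2)"
      using False tail_nonneg by (intro mult_mono tail_antimono) (auto simp: C'_def)
    finally show ?thesis .
  qed
  moreover have "1 \<le> C'" by (simp add: C'_def)
  ultimately show thesis using that by blast
qed

text \<open>The intervals decrease to the empty set, as 1 is excluded, and \<open>\<mu>\<close> is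
  finite.\<close>

lemma tail_tendsto_0: "(\<lambda>n. tail (1 - 1 / real (Suc n))) \<longlonglongrightarrow> 0"
proof -
  have "(\<lambda>n. measure \<mu> {1 - 1 / real (Suc n)..<1}) \<longlonglongrightarrow> measure \<mu> (\<Inter>n. {1 - 1 / real (Suc n)..<1})"
  proof (rule finite_Lim_measure_decseq)
    show "decseq (\<lambda>n. {1 - 1 / real (Suc n)..<1})"
      unfolding decseq_def by (auto simp: field_simps intro: order_trans[rotated])
  qed (auto simp: sets_eq)
  moreover have "(\<Inter>n. {1 - 1 / real (Suc n)..<1}) = {}"
  proof (rule ccontr)
    assume "(\<Inter>n. {1 - 1 / real (Suc n)..<1}) \<noteq> {}"
    then obtain r where "r \<in> (\<Inter>n. {1 - 1 / real (Suc n)..<1})" by blast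
    then have r: "r \<in> {1 - 1 / real (Suc n)..<1}" for n by (rule INT_D) simp
    have "r < 1" using r[of 0] by simp
    then obtain n where "1 / real (Suc n) < 1 - r"
      using reals_Archimedean[of "1 - r"] by (auto simp: inverse_eq_divide)
    then show False using r[of n] by auto
  qed
  ultimately show ?thesis by (simp add: tail_def)
qed

text \<open>Given r near 1, let m be a/(2(1 - r)) rounded up. Then a/(2m) <= 1 - r, and 2m(1 - r) <=
  a + 2 <= K \<epsilon> places 1 - (1 - r)/K beyond 1 - \<epsilon>/(2m). Even indices occur because
  the hypothesis comes from comparing the moments of index m and 2m.\<close>

lemma tail_reverse_doubling:
  assumes \<epsilon>: "0 < \<epsilon>" and a: "0 < a" and \<kappa>: "1 < \<kappa>"
    and le: "\<And>m. N \<le> m \<Longrightarrow> \<kappa> * tail (1 - \<epsilon> / real (2 * m)) \<le> tail (1 - a / real (2 * m))"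
  obtains K C' where "1 < K" "1 < C'" "\<And>r. 0 \<le> r \<Longrightarrow> r < 1 \<Longrightarrow> C' * tail (1 - (1 - r) / K) \<le> tail r"
proof -
  define r0 where "r0 = max 0 (1 - a / (2 * real (Suc N)))"
  have r0: "0 \<le> r0" "r0 < 1" using a by (auto simp: r0_def)
  then have t0: "0 < tail r0 / 2" using tail_pos by auto
  then obtain M where M: "tail (1 - 1 / real (Suc M)) < tail r0 / 2"
    using order_tendstoD(2)[OF tail_tendsto_0 t0] by (auto simp: eventually_sequentially)
  \<comment> \<open>The second bound serves r near 1. The first serves r < r0, where going K times
    closer to 1 leaves less than half of \<open>tail r0\<close>.\<close>
  define K where "K = max (2 + real M) ((a + 2) / \<epsilon>)"
  have K: "1 < K" "real (Suc M) \<le> K" "(a + 2) / \<epsilon> \<le> K" by (auto simp: K_def)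
  define C' where "C' = min \<kappa> 2"
  have C': "1 < C'" "C' \<le> \<kappa>" "C' \<le> 2" using \<kappa> by (auto simp: C'_def)
  have "C' * tail (1 - (1 - r) / K) \<le> tail r" if r: "0 \<le> r" "r < 1" for r
  proof (cases "r0 \<le> r")
    case True
    define m where "m = nat \<lceil>a / (2 * (1 - r))\<rceil>"
    have pos: "0 < a / (2 * (1 - r))" using a r by simp
    then have m: "a / (2 * (1 - r)) \<le> real m" "real m \<le> a / (2 * (1 - r)) + 1"
      unfolding m_def by linarith+
    have "a / (2 * real (Suc N)) \<ge> 1 - r" using True by (auto simp: r0_def)
    then have "real (Suc N) \<le> a / (2 * (1 - r))" using r by (simp add: field_simps)
    then have N: "N \<le> m" using m by linarith
    have m0: "0 < real m" using m pos by linarith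
    have "real (2 * m) * (1 - r) \<le> a + 2"
    proof -
      have "real m * (1 - r) \<le> (a / (2 * (1 - r)) + 1) * (1 - r)"
        using m r by (intro mult_right_mono) auto
      also have "\<dots> = a / 2 + (1 - r)" using r by (simp add: field_simps)
      finally show ?thesis using r by simp
    qed
    also have "\<dots> \<le> K * \<epsilon>" using K \<epsilon> by (simp add: divide_le_eq)
    finally have "(1 - r) / K \<le> \<epsilon> / real (2 * m)"
      using K m0 by (simp add: field_simps)
    then have "tail (1 - (1 - r) / K) \<le> tail (1 - \<epsilon> / real (2 * m))"
      by (intro tail_antimono) auto
    then have "C' * tail (1 - (1 - r) / K) \<le> \<kappa> * tail (1 - \<epsilon> / real (2 * m))"
      using C' tail_nonneg by (intro mult_mono) auto
    also have "\<dots> \<le> tail (1 - a / real (2 * m))" by (rule le[OF N])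
    also have "\<dots> \<le> tail r"
    proof (rule tail_antimono)
      show "r \<le> 1 - a / real (2 * m)" using m m0 r by (simp add: field_simps)
    qed
    finally show ?thesis .
  next
    case False
    have "(1 - r) / K \<le> 1 / real (Suc M)"
      using r K by (intro frac_le) auto
    then have "tail (1 - (1 - r) / K) \<le> tail (1 - 1 / real (Suc M))"
      by (intro tail_antimono) auto
    then have "C' * tail (1 - (1 - r) / K) \<le> 2 * (tail r0 / 2)"
      using M C' tail_nonneg by (intro mult_mono) auto
    also have "\<dots> \<le> tail r" using False tail_antimono[of r r0] by simp
    finally show ?thesis .
  qed
  with K(1) C'(1) show thesis by (rule that)
qed

text \<open>For the reverse condition start from A n <= C B n and split B n. C times the piece near
  1 and C times the piece far from 1 are each at most A n / 4, so the mass between 1 - a/n and 1 -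
  \<epsilon>/n, times C a^(kp), is at least half of A n. In turn A n dominates the tail at 1 -
  \<epsilon>/n.\<close>

theorem tail_conditions_of_comparable:
  assumes p: "0 < p" and k: "1 \<le> k"
    and comp: "comparable_on {f. f holomorphic_on ball 0 1} (mean_integral p 0)
      (\<lambda>f. mean_integral p (real k * p) ((deriv ^^ k) f) + ennreal (\<Sum>j<k. norm ((deriv ^^ j) f 0) powr p))"
  shows "\<exists>C\<ge>1. \<forall>r. 0 \<le> r \<and> r < 1 \<longrightarrow> tail r \<le> C * tail ((1 + r) / 2)"
    and "\<exists>K>1. \<exists>C>1. \<forall>r. 0 \<le> r \<and> r < 1 \<longrightarrow> C * tail (1 - (1 - r) / K) \<le> tail r"
proof -
  define s where "s = real k * p"
  have s: "0 < s" using p k by (simp add: s_def)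
  define A where "A = (\<lambda>n. integral\<^sup>L \<mu> (monomial_weight p n))"
  define B where "B = (\<lambda>n. integral\<^sup>L \<mu> (monomial_deriv_weight p k n))"
  obtain C where C: "0 < C" "\<And>n. 2 * k \<le> n \<Longrightarrow> 0 < n \<Longrightarrow> A n \<le> C * B n"
    "\<And>n. 2 * k \<le> n \<Longrightarrow> 0 < n \<Longrightarrow> B n \<le> C * A n"
    unfolding A_def B_def using comparable_monomials[OF p comp] by metis
  have A0: "0 \<le> A n" for n
    unfolding A_def by (rule integral_nonneg_unit_interval) (rule monomial_weight_bounds(1)[OF _ _ p])
  \<comment> \<open>Chosen so that b^s >= 2C, which is possible as s > 0; the bound 1 is what the
    rounding of indices requires.\<close>
  define b where "b = max 1 ((2 * C) powr (1 / s))"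
  have b: "1 \<le> b" "2 * C \<le> b powr s"
  proof -
    have "((2 * C) powr (1 / s)) powr s \<le> b powr s"
      using s by (intro powr_mono2) (auto simp: b_def)
    then show "2 * C \<le> b powr s" using s C by (simp add: powr_powr)
  qed (simp add: b_def)
  have upper: "A n \<le> 2 * tail (1 - b / real n)" if "2 * k \<le> n" for n
  proof -
    have n: "0 < n" using that k by auto
    show ?thesis
      unfolding A_def
      by (rule integral_monomial_weight_le[OF p C(1) _ _ n, of b k])
         (use b C(3)[OF that n] in \<open>auto simp: s_def A_def B_def\<close>)
  qed
  have lower: "exp (- 2 * c * p) / 2 * tail (1 - c / real n) \<le> A n" if "0 < c" "2 * c \<le> real n" for c n
    unfolding A_def by (rule integral_monomial_weight_ge[OF that(1) p that(2)])
  show "\<exists>C\<ge>1. \<forall>r. 0 \<le> r \<and> r < 1 \<longrightarrow> tail r \<le> C * tail ((1 + r) / 2)"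
  proof -
    \<comment> \<open>Constant of the lower estimate at distance 3b/n; with the upper estimate at
      distance b/n it gives the hypothesis of \<open>tail_doubling\<close>.\<close>
    define e where "e = exp (- 2 * (3 * b) * p) / 2"
    have e: "0 < e" by (simp add: e_def)
    have "tail (1 - 3 * b / real n) \<le> 2 / e * tail (1 - b / real n)" if n: "max (2 * k) (nat \<lceil>6 * b\<rceil>) \<le> n" for n
    proof -
      have n': "2 * (3 * b) \<le> real n" using n by linarith
      have "e * tail (1 - 3 * b / real n) \<le> 2 * tail (1 - b / real n)"
        using lower[of "3 * b" n] upper[of n] b n n' by (simp add: e_def)
      then show ?thesis using e by (simp add: field_simps)
    qed
    then obtain C' where "1 \<le> C'" "\<And>r. 0 \<le> r \<Longrightarrow> r < 1 \<Longrightarrow> tail r \<le> C' * tail ((1 + r) / 2)"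
      using tail_doubling[OF b(1), of "2 / e"] e by (metis divide_pos_pos zero_less_numeral)
    then show ?thesis by blast
  qed
  show "\<exists>K>1. \<exists>C>1. \<forall>r. 0 \<le> r \<and> r < 1 \<longrightarrow> C * tail (1 - (1 - r) / K) \<le> tail r"
  proof -
    define e where "e = exp (- 2 * (2 * b) * p) / 2"
    have e: "0 < e" by (simp add: e_def)
    define C4 where "C4 = 2 / e"
    have C4: "0 < C4" using e by (simp add: C4_def)
    \<comment> \<open>The distance b/m equals 2b/(2m), so the upper estimate at index m and the
      lower one at index 2m involve the same tail.\<close>
    have A_half: "A m \<le> C4 * A (2 * m)" if m: "2 * k \<le> m" "2 * b \<le> real m" for m
    proof -
      have "A m \<le> 2 * tail (1 - b / real m)" by (rule upper[OF m(1)])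
      also have "1 - b / real m = 1 - (2 * b) / real (2 * m)" by simp
      also have "2 * tail (1 - (2 * b) / real (2 * m)) = C4 * (e * tail (1 - (2 * b) / real (2 * m)))"
        using e by (simp add: C4_def)
      also have "\<dots> \<le> C4 * A (2 * m)"
        unfolding e_def by (intro mult_left_mono lower) (use m b C4 in auto)
      finally show ?thesis .
    qed
    \<comment> \<open>Solves C (2\<epsilon>)^s = 1/4, so that the piece near 1 is absorbed.\<close>
    define \<epsilon> where "\<epsilon> = (1 / (4 * C)) powr (1 / s) / 2"
    have \<epsilon>: "0 < \<epsilon>" using C by (simp add: \<epsilon>_def)
    have \<epsilon>C: "C * (2 * \<epsilon>) powr s = 1 / 4" using C s by (simp add: \<epsilon>_def powr_powr)
    \<comment> \<open>Collects the chain B m <= C A m <= C C4 A (2m), the outer factor C and the 2^s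
      of the splitting.\<close>
    define X where "X = C * 2 powr s * C * C4"
    have X: "0 < X" using C C4 by (simp add: X_def)
    \<comment> \<open>Large enough for exp(-ap/2) to bring \<open>X\<close> down to 1/4, and at
      least \<epsilon> as the splitting requires.\<close>
    define a where "a = max \<epsilon> (2 * ln (4 * X) / p)"
    have a: "\<epsilon> \<le> a" "0 < a" using \<epsilon> by (auto simp: a_def)
    have aX: "X * exp (- (a * p / 2)) \<le> 1 / 4"
    proof -
      have "ln (4 * X) \<le> a * p / 2" using p by (simp add: a_def field_simps max_def)
      then have "exp (- (a * p / 2)) \<le> exp (- ln (4 * X))" by simp
      also have "\<dots> = 1 / (4 * X)" using X by (simp add: exp_minus inverse_eq_divide)
      finally show ?thesis using X by (simp add: field_simps)
    qed
    define e' where "e' = exp (- 2 * \<epsilon> * p) / 2"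
    have e': "0 < e'" by (simp add: e'_def)
    \<comment> \<open>Half of A n survives the absorption, hence the 2; a^s bounds the middle piece,
      and e' compares A n with the tail at 1 - \<epsilon>/n.\<close>
    define C5 where "C5 = 2 * C * a powr s / e'"
    have C5: "0 < C5" using C e' a by (simp add: C5_def)
    have "(1 + 1 / C5) * tail (1 - \<epsilon> / real (2 * m)) \<le> tail (1 - a / real (2 * m))"
      if m: "max (2 * k) (max (nat \<lceil>2 * b\<rceil>) (nat \<lceil>\<epsilon>\<rceil>)) \<le> m" for m
    proof -
      have mk: "2 * k \<le> m" "k \<le> m" "0 < m" using m k by auto
      have mb: "2 * b \<le> real m" and m\<epsilon>: "\<epsilon> \<le> real m" using m by linarith+
      define n where "n = 2 * m"
      define \<Delta> where "\<Delta> = tail (1 - a / real n) - tail (1 - \<epsilon> / real n)"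
      have s1: "1 - a / real n \<le> 1 - \<epsilon> / real n" "1 - \<epsilon> / real n \<le> 1"
        using a \<epsilon> by (auto simp: divide_right_mono)
      note I = integral_indicator_Ico[OF s1]
      have "B n \<le> (\<integral>r. (2 * \<epsilon>) powr s * monomial_weight p n r
          + (2 powr s * exp (- (a * p / 2)) * monomial_deriv_weight p k m r
          + a powr s * indicator {1 - a / real n..<1 - \<epsilon> / real n} r) \<partial>\<mu>)"
        unfolding B_def
      proof (rule integral_mono_unit_interval)
        show "integrable \<mu> (\<lambda>r. (2 * \<epsilon>) powr s * monomial_weight p n r
          + (2 powr s * exp (- (a * p / 2)) * monomial_deriv_weight p k m r
          + a powr s * indicator {1 - a / real n..<1 - \<epsilon> / real n} r))"
          by (intro Bochner_Integration.integrable_add integrable_mult_right integrable_monomial_weight p I)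
      qed (use integrable_monomial_weight[OF p] monomial_deriv_weight_split[OF _ _ p mk(3,2) \<epsilon> m\<epsilon> a(1)]
           in \<open>auto simp: n_def s_def\<close>)
      also have "\<dots> = (2 * \<epsilon>) powr s * A n + (2 powr s * exp (- (a * p / 2)) * B m + a powr s * \<Delta>)"
        using integrable_monomial_weight[OF p] I by (simp add: A_def B_def \<Delta>_def)
      finally have "C * B n \<le> C * ((2 * \<epsilon>) powr s * A n + (2 powr s * exp (- (a * p / 2)) * B m + a powr s * \<Delta>))"
        using C by (intro mult_left_mono) auto
      also have "\<dots> = (C * (2 * \<epsilon>) powr s) * A n + C * 2 powr s * exp (- (a * p / 2)) * B m + C * a powr s * \<Delta>"
        by (simp only: distrib_left mult.assoc add.assoc)
      also have "\<dots> \<le> 1 / 4 * A n + 1 / 4 * A n + C * a powr s * \<Delta>"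
      proof -
        have "B m \<le> C * (C4 * A n)"
          using C(3)[OF mk(1,3)] A_half[OF mk(1) mb] C(1) unfolding n_def
          by (meson mult_left_mono order_trans less_imp_le)
        then have "C * 2 powr s * exp (- (a * p / 2)) * B m \<le> C * 2 powr s * exp (- (a * p / 2)) * (C * (C4 * A n))"
          using C by (intro mult_left_mono) auto
        also have "\<dots> = (X * exp (- (a * p / 2))) * A n" by (simp only: X_def mult_ac)
        also have "\<dots> \<le> 1 / 4 * A n" using aX A0 by (intro mult_right_mono) auto
        finally show ?thesis by (simp add: \<epsilon>C)
      qed
      finally have "A n \<le> 2 * C * a powr s * \<Delta>"
        using C(2)[of n] mk by (simp add: n_def)
      moreover have "e' * tail (1 - \<epsilon> / real n) \<le> A n"
        unfolding e'_def by (rule lower[OF \<epsilon>]) (use m\<epsilon> in \<open>simp add: n_def\<close>)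
      ultimately have "tail (1 - \<epsilon> / real n) \<le> C5 * \<Delta>"
        using e' by (simp add: C5_def field_simps)
      then have "1 / C5 * tail (1 - \<epsilon> / real n) \<le> \<Delta>" using C5 by (simp add: field_simps)
      then show ?thesis by (simp add: \<Delta>_def n_def distrib_right)
    qed
    then obtain K C' where "1 < K" "1 < C'"
        "\<And>r. 0 \<le> r \<Longrightarrow> r < 1 \<Longrightarrow> C' * tail (1 - (1 - r) / K) \<le> tail r"
      using tail_reverse_doubling[OF \<epsilon> a(2), of "1 + 1 / C5"] C5
      by (metis less_add_same_cancel1 zero_less_divide_1_iff)
    then show ?thesis by blast
  qed
qed

section \<open>Sufficiency from the tail conditions\<close>

text \<open>Halve the distance to 1 repeatedly: j steps with 2^j > K go beyond division by K and
  cost C^j.\<close>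

lemma tail_le_of_doubling:
  assumes "1 \<le> C" and C: "\<And>r. 0 \<le> r \<Longrightarrow> r < 1 \<Longrightarrow> tail r \<le> C * tail ((1 + r) / 2)"
    and K: "1 < K"
  obtains q where "0 < q" "\<And>r. 0 \<le> r \<Longrightarrow> r < 1 \<Longrightarrow> tail r \<le> q * tail (1 - (1 - r) / K)"
proof -
  have iter: "tail r \<le> C ^ j * tail (1 - (1 - r) / 2 ^ j)" if r: "0 \<le> r" "r < 1" for r j
  proof (induction j)
    case (Suc j)
    define t where "t = 1 - (1 - r) / 2 ^ j"
    have "(1 - r) / 2 ^ j \<le> 1 - r" "0 < (1 - r) / 2 ^ j" using r by (simp_all add: divide_le_eq mult_le_cancel_left1)
    then have t: "0 \<le> t" "t < 1" using r unfolding t_def by linarith+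
    note Suc.IH
    also have "C ^ j * tail (1 - (1 - r) / 2 ^ j) \<le> C ^ j * (C * tail ((1 + t) / 2))"
      using C[OF t] \<open>1 \<le> C\<close> by (intro mult_left_mono) (auto simp: t_def)
    also have "(1 + t) / 2 = 1 - (1 - r) / 2 ^ Suc j" by (simp add: t_def field_simps)
    finally show ?case by (simp add: mult_ac)
  qed simp
  obtain j where j: "K < 2 ^ j" using real_arch_pow[of 2 K] by auto
  show thesis
  proof (rule that[of "C ^ j"])
    show "0 < C ^ j" using \<open>1 \<le> C\<close> by simp
    fix r :: real assume r: "0 \<le> r" "r < 1"
    have "(1 - r) / 2 ^ j \<le> (1 - r) / K" using r j K by (intro divide_left_mono) auto
    then have "tail (1 - (1 - r) / 2 ^ j) \<le> tail (1 - (1 - r) / K)" by (intro tail_antimono) auto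
    then have "C ^ j * tail (1 - (1 - r) / 2 ^ j) \<le> C ^ j * tail (1 - (1 - r) / K)"
      using \<open>1 \<le> C\<close> by (intro mult_left_mono) auto
    with iter[OF r, of j] show "tail r \<le> C ^ j * tail (1 - (1 - r) / K)" by linarith
  qed
qed

theorem comparable_of_tail_conditions:
  assumes p: "0 < p"
    and C: "1 \<le> C" "\<And>r. 0 \<le> r \<Longrightarrow> r < 1 \<Longrightarrow> tail r \<le> C * tail ((1 + r) / 2)"
    and K: "1 < K" and D: "1 < D" "\<And>r. 0 \<le> r \<Longrightarrow> r < 1 \<Longrightarrow> D * tail (1 - (1 - r) / K) \<le> tail r"
  shows "comparable_on {f. f holomorphic_on ball 0 1} (mean_integral p 0)
    (\<lambda>f. mean_integral p (real k * p) ((deriv ^^ k) f) + ennreal (\<Sum>j<k. norm ((deriv ^^ j) f 0) powr p))"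
proof -
  obtain q where q: "0 < q" "\<And>r. 0 \<le> r \<Longrightarrow> r < 1 \<Longrightarrow> tail r \<le> q * tail (1 - (1 - r) / K)"
    using tail_le_of_doubling[OF C K] by blast
  \<comment> \<open>The ratio 1/K makes the reverse condition at one node a statement about the next
    node.\<close>
  define x where "x = 1 / K"
  have x: "0 < x" "x < 1" using K by (simp_all add: x_def)
  have r: "0 \<le> 1 - x ^ n" "1 - x ^ n < 1" for n using x by (simp_all add: power_le_one)
  have Suc: "1 - (1 - (1 - x ^ n)) / K = 1 - x ^ Suc n" for n by (simp add: x_def)
  interpret doubling_radial_measure \<mu> x q "1 / D"
  proof
    show "tail (1 - x ^ n) \<le> q * tail (1 - x ^ Suc n)" for n
      using q(2)[OF r[of n]] by (simp only: Suc)
    show "tail (1 - x ^ Suc n) \<le> 1 / D * tail (1 - x ^ n)" for n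
      using D(2)[OF r[of n]] D(1) unfolding Suc by (simp add: field_simps)
  qed (use x q D in auto)
  show ?thesis by (rule comparable_mean_integral_higher_deriv[OF p])
qed

end

theorem theorem5:
  fixes \<omega> :: "real \<Rightarrow> real" and p :: real and k :: nat
  assumes "radial_weight \<omega>"
    and "\<forall>z\<in>ball 0 1. weight_tail \<omega> z > 0"
    and "0 < p"
    and "1 \<le> k"
  shows "comparable_on {f. f holomorphic_on ball 0 1}
           (\<lambda>f. bergman_norm_pow \<omega> p f)
           (\<lambda>f. (\<integral>\<^sup>+ z. ennreal (norm ((deriv ^^ k) f z) powr p
                        * (1 - norm z) powr (real k * p) * \<omega> (norm z)) \<partial>disc_area)
                + ennreal (\<Sum>j<k. norm ((deriv ^^ j) f 0) powr p))
         \<longleftrightarrow> \<omega> \<in> D_class"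
proof -
  obtain \<mu> :: "real measure" where fin: "finite_measure \<mu>" and sets: "sets \<mu> = sets borel"
    and AE: "AE r in \<mu>. 0 \<le> r \<and> r < 1"
    and wt: "\<And>r. 0 \<le> r \<Longrightarrow> weight_tail \<omega> (of_real r) = measure \<mu> {r..<1}"
    and polar: "\<And>g p \<gamma>. continuous_on (ball 0 1) g \<Longrightarrow> 0 < p \<Longrightarrow>
      (\<integral>\<^sup>+z. ennreal (norm (g z) powr p * (1 - norm z) powr \<gamma> * \<omega> (norm z)) \<partial>disc_area)
      = (\<integral>\<^sup>+r. ennreal (circle_mean p g r * (1 - r) powr \<gamma> * (2 * r)) \<partial>\<mu>)"
    using radial_weight_measure[OF assms(1)] by blast
  interpret finite_measure \<mu> by (rule fin)
  interpret radial_measure \<mu>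
  proof
    show "0 < measure \<mu> {r..<1}" if "0 \<le> r" "r < 1" for r
      using assms(2) wt[of r] that by (metis abs_of_nonneg mem_ball_0 norm_of_real)
  qed (use sets AE in auto)
  have wt: "weight_tail \<omega> (of_real r) = tail r" if "0 \<le> r" for r
    using wt[OF that] by (simp add: tail_def)
  have norm_pow: "bergman_norm_pow \<omega> p f = mean_integral p 0 f" if "f holomorphic_on ball 0 1" for f
  proof -
    \<comment> \<open>In HOL \<open>0 powr 0\<close> is 0, but 1 - |z| is positive on the disc, so
      the inserted factor is 1.\<close>
    have "bergman_norm_pow \<omega> p f
        = (\<integral>\<^sup>+z. ennreal (norm (f z) powr p * (1 - norm z) powr 0 * \<omega> (norm z)) \<partial>disc_area)"
      unfolding bergman_norm_pow_def
      by (intro nn_integral_cong) (auto simp: disc_area_def space_scale_measure)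
    then show ?thesis
      using polar[OF holomorphic_on_imp_continuous_on[OF that] assms(3)] by (simp only: mean_integral_def)
  qed
  have "comparable_on {f. f holomorphic_on ball 0 1}
           (\<lambda>f. bergman_norm_pow \<omega> p f)
           (\<lambda>f. (\<integral>\<^sup>+ z. ennreal (norm ((deriv ^^ k) f z) powr p
                        * (1 - norm z) powr (real k * p) * \<omega> (norm z)) \<partial>disc_area)
                + ennreal (\<Sum>j<k. norm ((deriv ^^ j) f 0) powr p))
     \<longleftrightarrow> comparable_on {f. f holomorphic_on ball 0 1} (mean_integral p 0)
      (\<lambda>f. mean_integral p (real k * p) ((deriv ^^ k) f) + ennreal (\<Sum>j<k. norm ((deriv ^^ j) f 0) powr p))"
    (is "?L \<longleftrightarrow> ?R")
  proof (rule comparable_on_cong)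
    fix f :: "complex \<Rightarrow> complex" assume "f \<in> {f. f holomorphic_on ball 0 1}"
    then have f: "f holomorphic_on ball 0 1" by simp
    show "bergman_norm_pow \<omega> p f = mean_integral p 0 f" by (rule norm_pow[OF f])
    have "continuous_on (ball 0 1) ((deriv ^^ k) f)"
      using f by (intro holomorphic_on_imp_continuous_on holomorphic_higher_deriv) auto
    from polar[OF this assms(3), of "real k * p"]
    show "(\<integral>\<^sup>+ z. ennreal (norm ((deriv ^^ k) f z) powr p
                        * (1 - norm z) powr (real k * p) * \<omega> (norm z)) \<partial>disc_area)
                + ennreal (\<Sum>j<k. norm ((deriv ^^ j) f 0) powr p)
      = mean_integral p (real k * p) ((deriv ^^ k) f) + ennreal (\<Sum>j<k. norm ((deriv ^^ j) f 0) powr p)"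
      by (simp only: mean_integral_def)
  qed
  also have "?R \<longleftrightarrow> \<omega> \<in> D_class"
  proof -
    have hat: "\<omega> \<in> D_hat \<longleftrightarrow> (\<exists>C\<ge>1. \<forall>r. 0 \<le> r \<and> r < 1 \<longrightarrow> tail r \<le> C * tail ((1 + r) / 2))"
    proof -
      \<comment> \<open>\<open>weight_tail\<close> sees only the norm of its complex argument, hence
        the check that the real argument is nonnegative.\<close>
      have "weight_tail \<omega> (of_real ((1 + r) / 2)) = tail ((1 + r) / 2)" if "0 \<le> r" for r :: real
        using that by (intro wt) auto
      then show ?thesis using assms(1) wt by (auto simp: D_hat_def)
    qed
    have check: "\<omega> \<in> D_check \<longleftrightarrow>
      (\<exists>K>1. \<exists>C>1. \<forall>r. 0 \<le> r \<and> r < 1 \<longrightarrow> C * tail (1 - (1 - r) / K) \<le> tail r)"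
    proof -
      have "weight_tail \<omega> (of_real (1 - (1 - r) / K)) = tail (1 - (1 - r) / K)"
        if "0 \<le> r" "1 < K" for r K :: real
        using that by (intro wt) (auto simp: field_simps)
      then have "(\<forall>r. 0 \<le> r \<and> r < 1 \<longrightarrow> C * weight_tail \<omega> (of_real (1 - (1 - r) / K)) \<le> weight_tail \<omega> (of_real r))
          \<longleftrightarrow> (\<forall>r. 0 \<le> r \<and> r < 1 \<longrightarrow> C * tail (1 - (1 - r) / K) \<le> tail r)" if "1 < K" for K C
        using that by (intro all_cong1 imp_cong refl) (simp only: wt)
      then show ?thesis
        using assms(1) unfolding D_check_def mem_Collect_eq by meson
    qed
    show ?thesis
    proof
      assume ?R
      from tail_conditions_of_comparable[OF assms(3,4) this]
      show "\<omega> \<in> D_class" by (simp add: D_class_def hat check)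
    next
      assume "\<omega> \<in> D_class"
      then have "\<omega> \<in> D_hat" "\<omega> \<in> D_check" by (auto simp: D_class_def)
      then obtain C K D where "1 \<le> C" "\<And>r. 0 \<le> r \<Longrightarrow> r < 1 \<Longrightarrow> tail r \<le> C * tail ((1 + r) / 2)"
        "1 < K" "1 < D" "\<And>r. 0 \<le> r \<Longrightarrow> r < 1 \<Longrightarrow> D * tail (1 - (1 - r) / K) \<le> tail r"
        unfolding hat check by auto
      then show ?R by (rule comparable_of_tail_conditions[OF assms(3)])
    qed
  qed
  finally show ?thesis .
qed

end
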